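(* Let $\lambda:[0,\infty)\to[0,\infty)$ be a locally integrable arrival intensity with $\lambda(t)=0$ for $t<0$, whose Laplace transform $\widehat\lambda(z)=\int_0^\infty e^{-zt}\lambda(t)\,dt$ has abscissa of convergence $\sigma_\lambda>0$. Assume that for some real $\lambda_0>0$ one has $\lambda(t)\le\lambda_0e^{\sigma_\lambda t}$ for all $t\ge0$, that $\widehat\lambda$ has no zeros in $\{z\in\mathbb{C}:\mathrm{Re}(z)>\sigma_\lambda\}$, and that for some $\gamma\ge0$, $k_0>0$ (and the same $\lambda_0$) $$|\widehat\lambda(\sigma+i\omega)|\ge\frac{\lambda_0k_0}{[(\sigma-\sigma_\lambda)^2+\omega^2]^{\gamma/2}},\qquad\omega\in\mathbb{R},\ \sigma>\sigma_\lambda.$$ Let $M>0$ and let the service time distribution satisfy $G\in\mathscr{G}(M)$. Let $\tilde\mu_G=\frac1n\sum_{k=1}^n\int_0^TJ_b(t)X_k(t)\,dt$ be the estimator of $\mu_G=\int_0^\infty[1-G(t)]\,dt$ associated with the parameter $$b=b_*:=\frac{1}{2\sigma_\lambda}\Big\{\ln\big(\sigma_\lambda^{-2\gamma+1}M\lambda_0n\big)-3\ln\Big[\frac{1}{2\sigma_\lambda}\ln\big(\sigma_\lambda^{-2\gamma+1}M\lambda_0n\big)\Big]\Big\}-\frac14.$$ If $T=T_n\to\infty$ and $\frac1T[\ln(\lambda_0n)]^2\to0$ as $n\to\infty$, then $$\limsup_{n\to\infty}\Big\{\varphi_n^{-1}\mathcal{R}[\tilde\mu_G;\mathscr{G}(M)]\Big\}\le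 C_1,\qquad\varphi_n:=M\sigma_\lambda\Big[\ln\Big(\frac{M\lambda_0n}{\sigma_\lambda^{2\gamma-1}}\Big)\Big]^{-1},$$ where $C_1$ is a positive constant depending on $\gamma$ and $k_0$.
   Context: Model: in an $M_t/G/\infty$ queue customers arrive at the points $\tau_j$ of a non-homogeneous Poisson process on $[0,\infty)$ with intensity $\lambda(t)$, $t\ge0$; the service times $\sigma_j$ are positive, i.i.d. with distribution function $G$, independent of the arrivals; the queue length is $X(t)=\sum_j\mathbf{1}(\tau_j\le t,\ \sigma_j>t-\tau_j)$. Observed are $n$ independent realizations $X_1(t),\ldots,X_n(t)$ of $\{X(t)\}$ on $[0,T]$. $\mathbb{E}_G$ is expectation when the service time distribution is $G$. Class: a distribution function $G$ supported on $[0,\infty)$ belongs to $\mathscr{G}(M)$ if $\max_{k=1,2}\int_0^\infty kt^{k-1}[1-G(t)]\,dt\le M$. Risk: $\mathcal{R}[\tilde\mu_G;\mathscr{G}]:=\sup_{G\in\mathscr{G}}\big[\mathbb{E}_G|\tilde\mu_G-\mu_G|^2\big]^{1/2}$. Function $\psi_b$: for real $b>1/4$, $\psi_b$ is the infinitely differentiable function on $\mathbb{R}$ with $\psi_b=1$ on $[0,b]$, $\psi_b=0$ outside $[-1/4,b+1/4]$, and, with $\psi_0(t)=e^{-1/(t(1-t))}$ on $[0,1]$ and normalizing constant $c_0=\big(\int_0^1\psi_0(t)\,dt\big)^{-1}$, $$\psi_b(t)=4c_0\int_{-1/4}^t\psi_0(4x+1)\,dx\ \ (-\tfrac14\le t\le0),\qquad\psi_b(t)=1-4c_0\int_b^t\psi_0(4(x-b))\,dx\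 \ (b\le t\le b+\tfrac14).$$ Kernel $J_b$: with $\widehat\psi_b(z)=\int_{-\infty}^\infty e^{-zt}\psi_b(t)\,dt$, $$J_b(t):=\frac1{2\pi}\int_{-\infty}^\infty\frac{\widehat\psi_b(s+i\omega)}{\widehat\lambda(-s-i\omega)}e^{(s+i\omega)t}\,d\omega,$$ where $s$ is any real number with $s<-\sigma_\lambda$ (under the stated assumptions the choice is immaterial). All parameters ($M$, $\lambda$ and its constants) are fixed while $n\to\infty$. *)

theory Defs
  imports "HOL-Probability.Probability"
begin

section \<open>Laplace transforms\<close>

definition laplace :: "(real \<Rightarrow> real) \<Rightarrow> complex \<Rightarrow> complex" where
  "laplace f z = (LINT t:{0..}|lborel. exp (- z * of_real t) * of_real (f t))"

definition bilateral_laplace :: "(real \<Rightarrow> real) \<Rightarrow> complex \<Rightarrow> complex" where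
  "bilateral_laplace f z = (LINT t|lborel. exp (- z * of_real t) * of_real (f t))"

text \<open>Convergence is meant in the improper sense; the infimum is taken in the extended reals, so
  that the abscissa may be infinite.\<close>

definition abscissa_of_convergence :: "(real \<Rightarrow> real) \<Rightarrow> ereal" where
  "abscissa_of_convergence f = Inf {ereal (Re z) | z. \<exists>L.
     ((\<lambda>R. LINT t:{0..R}|lborel. exp (- z * of_real t) * of_real (f t)) \<longlongrightarrow> L) at_top}"

section \<open>The queue\<close>

text \<open>A Poisson process is given by an enumeration \<open>\<tau>\<close> (in any order) of its points. Points are
  indexed by all of \<^typ>\<open>nat\<close>, which is appropriate when the intensity has infinite total mass; this
  is so whenever its Laplace transform has a positive abscissa of convergence. Because the intensity
  measure has no atoms, points almost surely do not coincide, so counting indices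
  is the same as counting points. The Poisson probabilities are written out because
  \<^const>\<open>poisson_pmf\<close> is unspecified at rate 0, which does occur here.\<close>

locale poisson_process = prob_space P for P :: "'w measure" +
  fixes lam :: "real \<Rightarrow> real" and \<tau> :: "nat \<Rightarrow> 'w \<Rightarrow> real"
  assumes arrival_measurable: "\<And>j. random_variable borel (\<tau> j)"
    and arrival_nonneg: "AE \<omega> in P. \<forall>j. 0 \<le> \<tau> j \<omega>"
    and locally_finite: "AE \<omega> in P. \<forall>t. finite {j. \<tau> j \<omega> \<le> t}"
    and count_poisson: "\<And>B k. B \<in> sets borel \<Longrightarrow> bounded B \<Longrightarrow> B \<subseteq> {0..} \<Longrightarrow>
      prob {\<omega> \<in> space P. card {j. \<tau> j \<omega> \<in> B} = k} =
        (LINT t:B|lborel. lam t) ^ k / fact k * exp (- (LINT t:B|lborel. lam t))"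
    and count_indep: "\<And>(I :: nat set) B. disjoint_family_on B I \<Longrightarrow>
      (\<And>i. i \<in> I \<Longrightarrow> B i \<in> sets borel \<and> bounded (B i) \<and> B i \<subseteq> {0..}) \<Longrightarrow>
      indep_vars (\<lambda>_. count_space UNIV) (\<lambda>i \<omega>. card {j. \<tau> j \<omega> \<in> B i}) I"

locale MtG_infinity = poisson_process P lam \<tau>
  for P :: "'w measure" and lam :: "real \<Rightarrow> real" and \<tau> :: "nat \<Rightarrow> 'w \<Rightarrow> real" +
  fixes \<sigma> :: "nat \<Rightarrow> 'w \<Rightarrow> real" and G :: "real \<Rightarrow> real"
  assumes service_indep: "indep_vars (\<lambda>_. borel) \<sigma> UNIV"
    and service_distribution: "\<And>j. cdf (distr P borel (\<sigma> j)) = G"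
    and arrivals_services_indep:
      "indep_var (PiM UNIV (\<lambda>_. borel)) (\<lambda>\<omega> j. \<tau> j \<omega>) (PiM UNIV (\<lambda>_. borel)) (\<lambda>\<omega> j. \<sigma> j \<omega>)"

text \<open>In the locale above, the set below is almost surely finite for all \<open>t\<close>.\<close>

definition queue_length :: "(nat \<Rightarrow> real) \<Rightarrow> (nat \<Rightarrow> real) \<Rightarrow> real \<Rightarrow> nat" where
  "queue_length \<tau> \<sigma> t = card {j. \<tau> j \<le> t \<and> \<sigma> j > t - \<tau> j}"

text \<open>Canonical sample space of one realization: the sequence of pairs (arrival time, service time).\<close>

type_synonym realization = "nat \<Rightarrow> real \<times> real"

abbreviation arrival :: "nat \<Rightarrow> realization \<Rightarrow> real" where
  "arrival j \<omega> \<equiv> fst (\<omega> j)"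

abbreviation service :: "nat \<Rightarrow> realization \<Rightarrow> real" where
  "service j \<omega> \<equiv> snd (\<omega> j)"

section \<open>Service time distributions and risk\<close>

definition service_class :: "real \<Rightarrow> (real \<Rightarrow> real) set" where
  "service_class M = {G. (\<exists>\<nu>. real_distribution \<nu> \<and> G = cdf \<nu>) \<and> (\<forall>t<0. G t = 0) \<and>
     (MAX k\<in>{1, 2::nat}. \<integral>\<^sup>+ t\<in>{0..}. ennreal (real k * t ^ (k - 1) * (1 - G t)) \<partial>lborel)
       \<le> ennreal M}"

definition mean_service :: "(real \<Rightarrow> real) \<Rightarrow> real" where
  "mean_service G = (LINT t:{0..}|lborel. 1 - G t)"

definition esqrt :: "ennreal \<Rightarrow> ennreal" where
  "esqrt x = (if x = \<infinity> then \<infinity> else ennreal (sqrt (enn2real x)))"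

text \<open>The estimator is complex-valued because the kernel below is defined by a complex integral
  (whose value is real for the parameters of interest).\<close>

definition risk ::
  "('g \<Rightarrow> 'w measure) \<Rightarrow> ('w \<Rightarrow> complex) \<Rightarrow> ('g \<Rightarrow> real) \<Rightarrow> 'g set \<Rightarrow> ennreal" where
  "risk P est \<mu> \<G> =
     (SUP G\<in>\<G>. esqrt (\<integral>\<^sup>+ \<omega>. ennreal ((cmod (est \<omega> - of_real (\<mu> G)))\<^sup>2) \<partial>P G))"

section \<open>The estimator\<close>

text \<open>The value 0 at the end points is the limit of the formula; the formula itself would give 1
  there, since division by 0 yields 0.\<close>

definition psi0 :: "real \<Rightarrow> real" where
  "psi0 t = (if 0 < t \<and> t < 1 then exp (- 1 / (t * (1 - t))) else 0)"

definition c0 :: real where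
  "c0 = inverse (LINT t:{0..1}|lborel. psi0 t)"

definition psi :: "real \<Rightarrow> real \<Rightarrow> real" where
  "psi b t =
    (if t < - 1/4 \<or> t > b + 1/4 then 0
     else if t \<le> 0 then 4 * c0 * (LINT x:{- 1/4..t}|lborel. psi0 (4 * x + 1))
     else if t \<le> b then 1
     else 1 - 4 * c0 * (LINT x:{b..t}|lborel. psi0 (4 * (x - b))))"

text \<open>\<open>s\<close> is the abscissa of the vertical line of integration.\<close>

definition deconv_kernel :: "(real \<Rightarrow> real) \<Rightarrow> real \<Rightarrow> real \<Rightarrow> real \<Rightarrow> complex" where
  "deconv_kernel lam s b t = 1 / (2 * of_real pi) *
     (LINT w|lborel. bilateral_laplace (psi b) (Complex s w) / laplace lam (- Complex s w)
        * exp (Complex s w * of_real t))"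

definition estimator ::
  "(real \<Rightarrow> complex) \<Rightarrow> nat \<Rightarrow> real \<Rightarrow> (nat \<Rightarrow> realization) \<Rightarrow> complex" where
  "estimator J n T \<omega> = 1 / of_nat n * (\<Sum>k<n. LINT t:{0..T}|lborel.
     J t * of_nat (queue_length (\<lambda>j. arrival j (\<omega> k)) (\<lambda>j. service j (\<omega> k)) t))"

definition b_star :: "real \<Rightarrow> real \<Rightarrow> real \<Rightarrow> real \<Rightarrow> nat \<Rightarrow> real" where
  "b_star \<sigma> \<gamma> M lam0 n =
     (let L = ln (\<sigma> powr (- 2 * \<gamma> + 1) * M * lam0 * real n)
      in 1 / (2 * \<sigma>) * (L - 3 * ln (1 / (2 * \<sigma>) * L)) - 1/4)"

definition rate_phi :: "real \<Rightarrow> real \<Rightarrow> real \<Rightarrow> real \<Rightarrow> nat \<Rightarrow> real" where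
  "rate_phi \<sigma> \<gamma> M lam0 n =
     M * \<sigma> * inverse (ln (M * lam0 * real n / \<sigma> powr (2 * \<gamma> - 1)))"

end

theory Submission
  imports Defs "HOL-Complex_Analysis.Cauchy_Integral_Theorem" "HOL-Real_Asymp.Real_Asymp"
begin

text \<open>Let \<open>m(t)\<close> be the mean queue length and \<open>H = 1 - G\<close> on \<open>[0,
  \<infinity>)\<close>. Then \<open>m\<close> is the convolution of \<open>lam\<close> with
  \<open>H\<close>, and \<open>\<mu>\<^sub>G\<close> is the integral of \<open>H\<close>. The
  kernel \<open>J\<^sub>b\<close> undoes the convolution: its transform has \<open>laplace lam
  (- z)\<close> in the denominator, so the integral of \<open>J\<^sub>b (x + u) lam(u)\<close>
  over \<open>u\<close> is \<open>\<psi>\<^sub>b(x)\<close>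
  (\<open>deconv_kernel_convolution\<close>), and the integral of \<open>J\<^sub>b m\<close> is
  the integral of \<open>\<psi>\<^sub>b H\<close>. As \<open>\<psi>\<^sub>b = 1\<close> on
  \<open>[0, b]\<close> and the integral of \<open>y H(y)\<close> is at most \<open>M/2\<close>,
  cutting off at \<open>b\<close> costs at most \<open>M/(2b)\<close>. Writing \<open>L\<close>
  for the logarithm in the rate, \<open>b\<^sub>*\<close> is asymptotic to
  \<open>L/(2\<sigma>)\<close>, so this bias is \<open>M\<sigma>/L\<close> up to a factor
  tending to 1, which is exactly the rate. All other contributions are of smaller order, and
  therefore the constant can be an absolute one.

  The other contributions are controlled by a single bound on the kernel, \<open>|J\<^sub>b(t)|
  \<le> K exp(- (\<sigma> + \<delta>) t)\<close> with \<open>K = D exp((\<sigma> + \<delta>)(b +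
  1/4))\<close> and \<open>D\<close> independent of \<open>b\<close> and \<open>\<delta>\<close>
  (\<open>deconv_kernel_bound\<close>). It is obtained by moving the line of integration to
  \<open>Re z = - (\<sigma> + \<delta>)\<close> and by playing the decay of the transform of
  \<open>\<psi>\<^sub>b\<close>, which is faster than every power because
  \<open>\<psi>\<^sub>b\<close> is smooth, against the growth of order \<open>\<gamma>\<close>
  of \<open>1 / laplace lam (- z)\<close>. For \<open>\<delta> = 1/L\<close> the definition of
  \<open>b\<^sub>*\<close> makes \<open>K\<^sup>2\<close> of order \<open>n / L\<^sup>3\<close>.
  Stopping at time \<open>T\<close> then costs \<open>exp(- T/L)\<close> times
  \<open>\<surd>n\<close> and a power of \<open>L\<close>, which is negligible since
  \<open>T\<close> exceeds \<open>L\<^sup>2\<close> eventually.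

  For the variance, \<open>X(t)\<close> has the first two moments of a Poisson variable, so its
  variance is its mean \<open>m(t) \<le> lam0 M exp(\<sigma> t)\<close>
  (\<open>queue_mean_variance\<close>, \<open>mean_queue_le\<close>). A weighted Cauchy-Schwarz
  inequality reduces the variance of the integral of \<open>J\<^sub>b X\<close> to these
  pointwise variances, and the mean square of the stochastic error is of order \<open>K\<^sup>2
  / n\<close>, that is \<open>L\<^sup>-\<^sup>3\<close>
  (\<open>estimator_stochastic_error\<close>), while the squared rate is of order
  \<open>L\<^sup>-\<^sup>2\<close>.\<close>

section \<open>Laplace transforms of exponentially bounded functions\<close>

lemma power_le_fact_exp:
  fixes x :: real
  assumes "x \<ge> 0"
  shows "x ^ k \<le> fact k * exp x"
proof -
  have "(\<Sum>n\<in>{k}. inverse (fact n) * x ^ n) \<le> (\<Sum>n. inverse (fact n) * x ^ n)"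
    using summable_exp[of x] assms by (intro sum_le_suminf) auto
  then show ?thesis
    by (simp add: exp_def scaleR_conv_of_real field_simps)
qed

lemma set_integral_exp_tail:
  fixes a c :: real
  assumes "a > 0"
  shows "set_integrable lborel {c..} (\<lambda>t. exp (- (a * t)))"
    and "(LINT t:{c..}|lborel. exp (- (a * t))) = exp (- (a * c)) / a"
proof -
  have *: "((\<lambda>x. exp (- a * x)) has_integral (exp (- a * c) / a)) {c..}"
    using has_integral_exp_minus_to_infinity[OF assms, of c] by simp
  have int: "(\<lambda>t. exp (- (a * t))) absolutely_integrable_on {c..}"
    by (rule nonnegative_absolutely_integrable_1)
       (use * in \<open>auto simp: has_integral_iff\<close>)
  have m: "(\<lambda>t. indicator {c..} t *\<^sub>R exp (- (a * t))) \<in> borel_measurable lborel"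
    by simp
  show i: "set_integrable lborel {c..} (\<lambda>t. exp (- (a * t)))"
    using int m unfolding set_integrable_def by (simp add: integrable_completion)
  show "(LINT t:{c..}|lborel. exp (- (a * t))) = exp (- (a * c)) / a"
    using set_borel_integral_eq_integral(2)[OF i] * by (simp add: has_integral_iff)
qed

lemma set_integrable_laplace:
  fixes f :: "real \<Rightarrow> real"
  assumes [measurable]: "f \<in> borel_measurable borel"
    and f: "\<And>t. t \<ge> 0 \<Longrightarrow> \<bar>f t\<bar> \<le> C * exp (a * t)" and z: "Re z > a"
  shows "set_integrable lborel {0..} (\<lambda>t. exp (- z * of_real t) * of_real (f t))"
proof (rule set_integrable_bound)
  show "set_integrable lborel {0..} (\<lambda>t. C * exp (- ((Re z - a) * t)))"
    using set_integral_exp_tail(1)[of "Re z - a" 0] z by (intro set_integrable_mult_right) simp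
  show "set_borel_measurable lborel {0..} (\<lambda>t. exp (- z * of_real t) * of_real (f t))"
    unfolding set_borel_measurable_def by measurable
  show "AE t in lborel. t \<in> {0..} \<longrightarrow> norm (exp (- z * of_real t) * of_real (f t) :: complex)
      \<le> norm (C * exp (- ((Re z - a) * t)))"
  proof (intro AE_I2 impI)
    fix t :: real assume "t \<in> {0..}"
    then have t: "t \<ge> 0" by simp
    have "norm (exp (- z * of_real t) * of_real (f t) :: complex) = exp (- Re z * t) * \<bar>f t\<bar>"
      by (simp add: norm_mult)
    also have "\<dots> \<le> exp (- Re z * t) * (C * exp (a * t))"
      by (intro mult_left_mono f t) simp
    also have "\<dots> = C * exp (- ((Re z - a) * t))"
      by (simp add: mult_exp_exp algebra_simps)
    finally show "norm (exp (- z * of_real t) * of_real (f t) :: complex)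
      \<le> norm (C * exp (- ((Re z - a) * t)))"
      by (metis abs_ge_self order_trans real_norm_def)
  qed
qed

lemma norm_exp_minus_linear:
  fixes w :: complex
  shows "norm (exp w - 1 - w) \<le> (norm w)\<^sup>2 * exp (norm w)"
proof -
  have "cmod (exp w - (\<Sum>k\<le>1. w ^ k / fact k))
      \<le> exp \<bar>Re w\<bar> * cmod w ^ Suc 1 / fact 1"
    by (rule Taylor_exp)
  also have "exp \<bar>Re w\<bar> * cmod w ^ Suc 1 / fact 1 \<le> exp (norm w) * (norm w)\<^sup>2"
    using abs_Re_le_cmod[of w] by (simp add: power2_eq_square mult_right_mono)
  finally show ?thesis by (simp add: algebra_simps)
qed

text \<open>Differentiation under the integral sign. The remainder of the linear approximation
  of \<open>exp(- h t)\<close> is at most \<open>(|h| t)\<^sup>2 exp(|h| t)\<close>, which an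
  exponential with a rate below \<open>Re z - a\<close> absorbs.\<close>

lemma holomorphic_laplace:
  fixes f :: "real \<Rightarrow> real"
  assumes f_meas [measurable]: "f \<in> borel_measurable borel"
    and f: "\<And>t. t \<ge> 0 \<Longrightarrow> \<bar>f t\<bar> \<le> C * exp (a * t)"
  shows "laplace f holomorphic_on {z. Re z > a}"
proof -
  have "\<exists>D. (laplace f has_field_derivative D) (at z)" if z: "Re z > a" for z
  proof -
    \<comment> \<open>One quarter of the margin absorbs \<open>t\<^sup>2\<close>, one
      absorbs \<open>exp(|h| t)\<close>, and two remain for integrability.\<close>
    define \<epsilon> where "\<epsilon> = (Re z - a) / 4"
    have \<epsilon>: "\<epsilon> > 0" and ez: "Re z - a = 4 * \<epsilon>" using z by (auto simp: \<epsilon>_def)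
    have C: "C \<ge> 0" using f[of 0] by (simp add: order_trans[OF abs_ge_zero])
    have poly_exp: "t ^ 2 \<le> 2 / \<epsilon>\<^sup>2 * exp (\<epsilon> * t)" "t \<le> 1 / \<epsilon> * exp (\<epsilon> * t)" if "t \<ge> 0" for t
    proof -
      have "(\<epsilon> * t) ^ 2 \<le> fact 2 * exp (\<epsilon> * t)" "(\<epsilon> * t) ^ 1 \<le> fact 1 * exp (\<epsilon> * t)"
        using that \<epsilon> by (intro power_le_fact_exp; simp)+
      then show "t ^ 2 \<le> 2 / \<epsilon>\<^sup>2 * exp (\<epsilon> * t)" "t \<le> 1 / \<epsilon> * exp (\<epsilon> * t)"
        using \<epsilon> by (auto simp: field_simps power_mult_distrib)
    qed
    define D where "D = laplace (\<lambda>t. - t * f t) z"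
    define K where "K = 2 / \<epsilon>\<^sup>2 * C * (1 / (2 * \<epsilon>))"
    have tf: "\<bar>- t * f t\<bar> \<le> (1 / \<epsilon> * C) * exp ((a + \<epsilon>) * t)" if "t \<ge> 0" for t
    proof -
      have "\<bar>- t * f t\<bar> = t * \<bar>f t\<bar>" using that by (simp add: abs_mult)
      also have "\<dots> \<le> (1 / \<epsilon> * exp (\<epsilon> * t)) * (C * exp (a * t))"
        using poly_exp(2)[OF that] f[OF that] C that by (intro mult_mono) auto
      also have "\<dots> = (1 / \<epsilon> * C) * exp ((a + \<epsilon>) * t)"
        by (simp add: exp_add algebra_simps)
      finally show ?thesis .
    qed
    have bound: "norm (laplace f (z + h) - laplace f z - h * D) \<le> K * (norm h)\<^sup>2"
      if h: "norm h \<le> \<epsilon>" for h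
    proof -
      have "\<bar>Re h\<bar> \<le> \<epsilon>" using abs_Re_le_cmod[of h] h by simp
      then have zh: "Re (z + h) > a" using ez \<epsilon> by simp
      have i1: "set_integrable lborel {0..} (\<lambda>t. exp (- (z + h) * of_real t) * of_real (f t))"
        using set_integrable_laplace[OF f_meas f zh] by blast
      have i2: "set_integrable lborel {0..} (\<lambda>t. exp (- z * of_real t) * of_real (f t))"
        using set_integrable_laplace[OF f_meas f z] by blast
      have i3: "set_integrable lborel {0..} (\<lambda>t. exp (- z * of_real t) * of_real (- t * f t))"
        using set_integrable_laplace[OF _ tf, of z] ez \<epsilon> by simp
      note i3' = set_integrable_mult_right[OF i3, of h]
      have "laplace f (z + h) - laplace f z - h * D =
          (LINT t:{0..}|lborel. exp (- (z + h) * of_real t) * of_real (f t)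
             - exp (- z * of_real t) * of_real (f t)
             - h * (exp (- z * of_real t) * of_real (- t * f t)))"
        unfolding laplace_def D_def
        by (simp only: set_integral_diff i1 i2 i3' set_integral_mult_right)
      also have "norm \<dots> \<le> (LINT t:{0..}|lborel. (norm h)\<^sup>2 * (2 / \<epsilon>\<^sup>2 * C) * exp (- (2 * \<epsilon> * t)))"
      proof (rule order_trans[OF set_integral_norm_bound])
        show "set_integrable lborel {0..} (\<lambda>t. exp (- (z + h) * of_real t) * of_real (f t)
             - exp (- z * of_real t) * of_real (f t)
             - h * (exp (- z * of_real t) * of_real (- t * f t)))"
          by (intro set_integral_diff i1 i2 i3')
        show "(LINT t:{0..}|lborel. norm (exp (- (z + h) * of_real t) * of_real (f t)
             - exp (- z * of_real t) * of_real (f t)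
             - h * (exp (- z * of_real t) * of_real (- t * f t))))
            \<le> (LINT t:{0..}|lborel. (norm h)\<^sup>2 * (2 / \<epsilon>\<^sup>2 * C) * exp (- (2 * \<epsilon> * t)))"
        proof (rule set_integral_mono)
          show "set_integrable lborel {0..} (\<lambda>t. norm (exp (- (z + h) * of_real t) * of_real (f t)
             - exp (- z * of_real t) * of_real (f t)
             - h * (exp (- z * of_real t) * of_real (- t * f t))))"
            by (intro set_integrable_norm set_integral_diff i1 i2 i3')
          show "set_integrable lborel {0..} (\<lambda>t. (norm h)\<^sup>2 * (2 / \<epsilon>\<^sup>2 * C) * exp (- (2 * \<epsilon> * t)))"
            using set_integral_exp_tail(1)[of "2 * \<epsilon>" 0] \<epsilon> by (intro set_integrable_mult_right) simp
          fix t :: real assume "t \<in> {0..}"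
          then have t: "t \<ge> 0" by simp
          have "exp (- (z + h) * of_real t) * of_real (f t) - exp (- z * of_real t) * of_real (f t)
             - h * (exp (- z * of_real t) * of_real (- t * f t))
             = exp (- z * of_real t) * of_real (f t) * (exp (- h * of_real t) - 1 - (- h * of_real t))"
            by (simp add: algebra_simps exp_add exp_diff exp_minus field_simps)
          also have "norm \<dots> \<le> (exp (- (Re z * t)) * (C * exp (a * t))) *
              ((norm (- h * of_real t))\<^sup>2 * exp (norm (- h * of_real t)))"
            unfolding norm_mult[of "_ * _" "_ - _"]
            using f[OF t] by (intro mult_mono norm_exp_minus_linear) (auto simp: norm_mult C)
          also have "\<dots> \<le> (exp (- (Re z * t)) * (C * exp (a * t))) *
              ((norm h)\<^sup>2 * (2 / \<epsilon>\<^sup>2 * exp (\<epsilon> * t)) * exp (\<epsilon> * t))"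
          proof (intro mult_left_mono mult_mono)
            show "(norm (- h * of_real t))\<^sup>2 \<le> (norm h)\<^sup>2 * (2 / \<epsilon>\<^sup>2 * exp (\<epsilon> * t))"
              using mult_left_mono[OF poly_exp(1)[OF t], of "(norm h)\<^sup>2"]
              by (simp add: norm_mult power_mult_distrib)
          qed (use t h C in \<open>auto simp: norm_mult intro!: mult_right_mono\<close>)
          also have "\<dots> = (norm h)\<^sup>2 * (2 / \<epsilon>\<^sup>2 * C) * exp (- (2 * \<epsilon> * t))"
          proof -
            have "exp (- (Re z * t)) * exp (a * t) * exp (\<epsilon> * t) * exp (\<epsilon> * t) = exp (- (2 * \<epsilon> * t))"
              using ez by (simp add: mult_exp_exp) (simp add: algebra_simps)
            then show ?thesis by (simp add: algebra_simps)
          qed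
          finally show "norm (exp (- (z + h) * of_real t) * of_real (f t)
             - exp (- z * of_real t) * of_real (f t)
             - h * (exp (- z * of_real t) * of_real (- t * f t)))
             \<le> (norm h)\<^sup>2 * (2 / \<epsilon>\<^sup>2 * C) * exp (- (2 * \<epsilon> * t))" .
        qed
      qed
      also have "\<dots> = K * (norm h)\<^sup>2"
        using set_integral_exp_tail(2)[of "2 * \<epsilon>" 0] \<epsilon> by (simp add: K_def mult_ac)
      finally show ?thesis .
    qed
    have "((\<lambda>h. (laplace f (z + h) - laplace f z) / h) \<longlongrightarrow> D) (at 0)"
    proof (rule LIM_zero_cancel, rule Lim_null_comparison[rotated])
      have "((\<lambda>h::complex. K * norm h) \<longlongrightarrow> K * norm (0::complex)) (at 0)"
        by (intro tendsto_intros)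
      then show "((\<lambda>h::complex. K * norm h) \<longlongrightarrow> 0) (at 0)" by simp
      show "eventually (\<lambda>h. norm ((laplace f (z + h) - laplace f z) / h - D) \<le> K * norm h) (at 0)"
        unfolding eventually_at
      proof (intro exI[of _ \<epsilon>] conjI ballI impI \<epsilon>)
        fix h :: complex assume "h \<noteq> 0 \<and> dist h 0 < \<epsilon>"
        then have h0: "h \<noteq> 0" and h: "norm h < \<epsilon>" by auto
        have "(laplace f (z + h) - laplace f z) / h - D = (laplace f (z + h) - laplace f z - h * D) / h"
          using h0 by (simp add: field_simps)
        also have "norm \<dots> \<le> K * (norm h)\<^sup>2 / norm h"
          using bound[of h] h by (simp add: norm_divide divide_right_mono)
        also have "\<dots> = K * norm h" using h0 by (simp add: power2_eq_square)
        finally show "norm ((laplace f (z + h) - laplace f z) / h - D) \<le> K * norm h" .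
      qed
    qed
    then show ?thesis unfolding DERIV_def by blast
  qed
  then show ?thesis
    by (auto simp: holomorphic_on_def field_differentiable_def intro: has_field_derivative_at_within)
qed

section \<open>Decay of the Laplace transform of the cutoff\<close>

text \<open>A family that contains \<^const>\<open>psi0\<close> and is closed under
  differentiation, so that statements about all derivatives of \<^const>\<open>psi0\<close>
  become inductions over the family.\<close>

definition smooth_bump :: "real poly \<Rightarrow> nat \<Rightarrow> real \<Rightarrow> real" where
  "smooth_bump p m t =
     (if 0 < t \<and> t < 1 then poly p t / (t * (1 - t)) ^ m * exp (- 1 / (t * (1 - t))) else 0)"

lemma smooth_bump_outside: "t \<le> 0 \<or> 1 \<le> t \<Longrightarrow> smooth_bump p m t = 0"
  by (auto simp: smooth_bump_def)

lemma psi0_eq_smooth_bump: "psi0 = smooth_bump 1 0"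
  by (auto simp: psi0_def smooth_bump_def)

text \<open>The exponential beats every negative power of \<open>t (1 - t)\<close>. Quadratic
  decay at both end points makes the extension by 0 differentiable there.\<close>

lemma smooth_bump_quadratic:
  obtains K where "K \<ge> 0" "\<And>t a. a \<in> {0, 1} \<Longrightarrow> \<bar>smooth_bump p m t\<bar> \<le> K * (t - a)\<^sup>2"
proof -
  have "bounded (poly p ` {0..1})"
    by (intro compact_imp_bounded compact_continuous_image continuous_intros) auto
  then obtain B where B: "\<And>t. t \<in> {0..1} \<Longrightarrow> \<bar>poly p t\<bar> \<le> B"
    unfolding bounded_iff by (metis imageI real_norm_def)
  have B0: "B \<ge> 0" using B[of 0] by (simp add: order_trans[OF abs_ge_zero])
  have main: "\<bar>smooth_bump p m t\<bar> \<le> (B * fact (m + 2)) * (t - a)\<^sup>2" if a: "a \<in> {0, 1}" for t a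
  proof (cases "0 < t \<and> t < 1")
    case True
    define u where "u = t * (1 - t)"
    have u: "u > 0" using True by (simp add: u_def)
    have "u \<le> \<bar>t - a\<bar>"
      using True a mult_left_le[of t "1 - t"] mult_left_le[of "1 - t" t] unfolding u_def
      by (auto simp: mult.commute)
    then have u2: "u\<^sup>2 \<le> (t - a)\<^sup>2" using u by (metis abs_of_pos power2_abs power_mono abs_ge_zero)
    have "(1 / u) ^ (m + 2) * (u\<^sup>2 * exp (- 1 / u)) \<le> fact (m + 2) * exp (1 / u) * (u\<^sup>2 * exp (- 1 / u))"
      using u by (intro mult_right_mono power_le_fact_exp) simp_all
    also have "\<dots> = fact (m + 2) * u\<^sup>2 * (exp (1 / u) * exp (- 1 / u))" by (simp only: mult_ac)
    also have "exp (1 / u) * exp (- 1 / u) = 1" by (simp add: mult_exp_exp)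
    also have "(1 / u) ^ (m + 2) * (u\<^sup>2 * exp (- 1 / u)) = exp (- 1 / u) / u ^ m"
      using u by (simp add: power_add power_one_over field_simps power2_eq_square)
    finally have "exp (- 1 / u) / u ^ m \<le> fact (m + 2) * u\<^sup>2" by simp
    then have "\<bar>poly p t\<bar> * (exp (- 1 / u) / u ^ m) \<le> B * (fact (m + 2) * u\<^sup>2)"
      using B[of t] True u B0 by (intro mult_mono) auto
    also have "\<dots> \<le> B * (fact (m + 2) * (t - a)\<^sup>2)"
      using u2 B0 by (intro mult_left_mono) auto
    finally show ?thesis
      using True u by (simp add: smooth_bump_def u_def[symmetric] abs_mult)
  next
    case False
    then show ?thesis using B0 by (auto simp: smooth_bump_def)
  qed
  show ?thesis
    by (rule that[of "B * fact (m + 2)"]) (use B0 main in auto)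
qed

lemma has_field_derivative_zero_quadratic:
  fixes f :: "real \<Rightarrow> real"
  assumes "\<And>t. \<bar>f t\<bar> \<le> K * (t - a)\<^sup>2"
  shows "(f has_field_derivative 0) (at a)"
proof -
  have fa: "f a = 0" using assms[of a] by simp
  have "((\<lambda>h. (f (a + h) - f a) / h) \<longlongrightarrow> 0) (at 0)"
  proof (rule Lim_null_comparison)
    have "((\<lambda>h::real. K * \<bar>h\<bar>) \<longlongrightarrow> K * \<bar>0\<bar>) (at 0)" by (intro tendsto_intros)
    then show "((\<lambda>h::real. K * \<bar>h\<bar>) \<longlongrightarrow> 0) (at 0)" by simp
    show "\<forall>\<^sub>F h in at 0. norm ((f (a + h) - f a) / h) \<le> K * \<bar>h\<bar>"
      unfolding eventually_at_filter
    proof (intro always_eventually allI impI)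
      fix h :: real assume "h \<noteq> 0"
      then show "norm ((f (a + h) - f a) / h) \<le> K * \<bar>h\<bar>"
        using assms[of "a + h"] fa
        by (simp add: field_simps power2_eq_square abs_mult_self_eq[of h, symmetric] del: abs_mult_self_eq)
    qed
  qed
  then show ?thesis by (simp add: DERIV_def)
qed

definition bump_deriv_poly :: "real poly \<Rightarrow> nat \<Rightarrow> real poly" where
  "bump_deriv_poly p m = pderiv p * [:0, 1, -1:]\<^sup>2
     - smult (real m) (p * [:0, 1, -1:] * [:1, -2:]) + p * [:1, -2:]"

lemma smooth_bump_has_derivative:
  "(smooth_bump p m has_field_derivative smooth_bump (bump_deriv_poly p m) (m + 2) t) (at t)"
proof -
  obtain K where K: "\<And>t a. a \<in> {0, 1} \<Longrightarrow> \<bar>smooth_bump p m t\<bar> \<le> K * (t - a)\<^sup>2"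
    using smooth_bump_quadratic by blast
  consider "0 < t \<and> t < 1" | "t = 0 \<or> t = 1" | "t < 0 \<or> t > 1" by linarith
  then show ?thesis
  proof cases
    case 1
    define u where "u = t * (1 - t)"
    have u: "u > 0" using 1 by (simp add: u_def)
    have "((\<lambda>t. poly p t / (t * (1 - t)) ^ m * exp (- 1 / (t * (1 - t)))) has_field_derivative
        smooth_bump (bump_deriv_poly p m) (m + 2) t) (at t)"
    proof -
      have du: "((\<lambda>t. t * (1 - t)) has_field_derivative 1 - 2 * t) (at t)"
        by (auto intro!: derivative_eq_intros)
      have d1: "((\<lambda>t. (t * (1 - t)) ^ m) has_field_derivative real m * u ^ (m - 1) * (1 - 2 * t)) (at t)"
        using DERIV_power[OF du, of m] by (simp add: u_def mult_ac)
      have d2: "((\<lambda>t. exp (- 1 / (t * (1 - t)))) has_field_derivative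
          exp (- 1 / u) * ((1 - 2 * t) / u\<^sup>2)) (at t)"
      proof -
        have "((\<lambda>t. exp (- 1 / (t * (1 - t)))) has_field_derivative
            exp (- 1 / u) * ((0 * u - (- 1) * (1 - 2 * t)) / (u * u))) (at t)"
          using DERIV_fun_exp[OF DERIV_divide[OF DERIV_const[of "- 1"] du]] u 1 unfolding u_def by simp
        then show ?thesis by (simp add: power2_eq_square)
      qed
      have "((\<lambda>t. poly p t / (t * (1 - t)) ^ m * exp (- 1 / (t * (1 - t)))) has_field_derivative
        (poly (pderiv p) t * u ^ m - poly p t * (real m * u ^ (m - 1) * (1 - 2 * t))) / (u ^ m * u ^ m)
           * exp (- 1 / u) + exp (- 1 / u) * ((1 - 2 * t) / u\<^sup>2) * (poly p t / u ^ m)) (at t)"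
        using DERIV_mult[OF DERIV_divide[OF poly_DERIV d1] d2, of p] u 1 unfolding u_def by simp
      also have "(poly (pderiv p) t * u ^ m - poly p t * (real m * u ^ (m - 1) * (1 - 2 * t))) / (u ^ m * u ^ m)
           * exp (- 1 / u) + exp (- 1 / u) * ((1 - 2 * t) / u\<^sup>2) * (poly p t / u ^ m)
         = smooth_bump (bump_deriv_poly p m) (m + 2) t"
      proof -
        have pu: "poly [:0, 1, -1:] t = u" "poly [:1, -2:] t = 1 - 2 * t"
          by (simp_all add: u_def algebra_simps)
        have pow: "real m * u ^ (m - 1) * u = real m * u ^ m"
          by (cases m) auto
        have "smooth_bump (bump_deriv_poly p m) (m + 2) t =
           (poly (pderiv p) t * u\<^sup>2 - real m * (poly p t * u * (1 - 2 * t)) + poly p t * (1 - 2 * t))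
             / u ^ (m + 2) * exp (- 1 / u)"
          using 1 by (simp only: smooth_bump_def bump_deriv_poly_def poly_add poly_diff poly_mult
              poly_smult poly_power pu u_def[symmetric]) simp
        also have "\<dots> = (poly (pderiv p) t * u ^ m - poly p t * (real m * u ^ (m - 1) * (1 - 2 * t))) / (u ^ m * u ^ m)
           * exp (- 1 / u) + exp (- 1 / u) * ((1 - 2 * t) / u\<^sup>2) * (poly p t / u ^ m)"
        proof -
          have alg: "(P * u\<^sup>2 - k * (q * u * w) + q * w) / (A * u\<^sup>2) * e
              = (P * A - q * (B * w)) / (A * A) * e + e * (w / u\<^sup>2) * (q / A)"
            if "A \<noteq> 0" "B * u = k * A" for P A B k q w e :: real
          proof -
            have "B = k * A / u" using that u by (simp add: field_simps)
            then have x1: "(P * A - q * (B * w)) / (A * A) = P / A - k * q * w / (A * u)"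
              using that by (simp add: diff_divide_distrib mult_ac)
            have x2: "(P * u\<^sup>2 - k * (q * u * w) + q * w) / (A * u\<^sup>2)
                = P / A - k * q * w / (A * u) + w * q / (A * u\<^sup>2)"
              using that u by (simp add: diff_divide_distrib add_divide_distrib power2_eq_square mult_ac)
            show ?thesis unfolding x1 x2 by (simp add: algebra_simps)
          qed
          show ?thesis
            unfolding power_add by (rule alg) (use u pow in auto)
        qed
        finally show ?thesis by simp
      qed
      finally show ?thesis .
    qed
    moreover have "\<forall>\<^sub>F x in nhds t. smooth_bump p m x = poly p x / (x * (1 - x)) ^ m * exp (- 1 / (x * (1 - x)))"
    proof -
      have "\<forall>\<^sub>F x in nhds t. x \<in> {0<..<1}"
        using 1 by (intro eventually_nhds_in_open) auto
      then show ?thesis by eventually_elim (auto simp: smooth_bump_def)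
    qed
    ultimately show ?thesis
      by (subst DERIV_cong_ev[OF refl _ refl]) auto
  next
    case 2
    then have "(smooth_bump p m has_field_derivative 0) (at t)"
      by (intro has_field_derivative_zero_quadratic[of _ K] K) auto
    then show ?thesis using 2 by (auto simp: smooth_bump_def)
  next
    case 3
    have "\<forall>\<^sub>F x in nhds t. smooth_bump p m x = 0"
    proof -
      have "\<forall>\<^sub>F x in nhds t. x \<in> {..<0} \<union> {1<..}"
        using 3 by (intro eventually_nhds_in_open) auto
      then show ?thesis by eventually_elim (auto simp: smooth_bump_def)
    qed
    then have "(smooth_bump p m has_field_derivative 0) (at t)"
      by (subst DERIV_cong_ev[OF refl _ refl]) auto
    then show ?thesis using 3 by (auto simp: smooth_bump_def)
  qed
qed

lemma continuous_smooth_bump: "continuous_on A (smooth_bump p m)"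
  by (rule DERIV_continuous_on) (rule has_field_derivative_at_within[OF smooth_bump_has_derivative])

lemma borel_measurable_smooth_bump [measurable]: "smooth_bump p m \<in> borel_measurable borel"
  by (rule borel_measurable_continuous_onI[OF continuous_smooth_bump])

lemma smooth_bump_bounded:
  obtains K where "K \<ge> 0" "\<And>t. \<bar>smooth_bump p m t\<bar> \<le> K"
proof -
  obtain K where K: "K \<ge> 0" "\<And>t a. a \<in> {0, 1} \<Longrightarrow> \<bar>smooth_bump p m t\<bar> \<le> K * (t - a)\<^sup>2"
    using smooth_bump_quadratic by blast
  have "\<bar>smooth_bump p m t\<bar> \<le> K" for t
  proof (cases "0 < t \<and> t < 1")
    case True
    then have "K * (t - 0)\<^sup>2 \<le> K * 1" by (intro mult_left_mono K(1)) (auto simp: power_le_one)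
    then show ?thesis using K(2)[of 0 t] by simp
  qed (use K(1) in \<open>auto simp: smooth_bump_def\<close>)
  with K(1) show ?thesis using that by blast
qed

lemma laplace_smooth_bump:
  "laplace (smooth_bump p m) z = (LINT t:{0..1}|lborel. exp (- z * of_real t) * of_real (smooth_bump p m t))"
  unfolding laplace_def set_lebesgue_integral_def
  by (intro Bochner_Integration.integral_cong) (auto simp: indicator_def smooth_bump_outside)

lemma set_integrable_smooth_bump:
  "set_integrable lborel {0..1} (\<lambda>t. exp (- z * of_real t) * of_real (smooth_bump p m t) :: complex)"
  by (intro borel_integrable_atLeastAtMost' continuous_intros continuous_smooth_bump)

lemma laplace_integration_by_parts:
  fixes f g :: "real \<Rightarrow> real" and z :: complex
  assumes "a \<le> b" and f: "\<And>t. (f has_real_derivative g t) (at t)" "f a = 0" "f b = 0"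
    and g: "continuous_on UNIV g"
  shows "z * (LINT t:{a..b}|lborel. exp (- z * of_real t) * of_real (f t))
    = (LINT t:{a..b}|lborel. exp (- z * of_real t) * of_real (g t))"
proof -
  let ?e = "\<lambda>t. exp (- z * complex_of_real t)"
  have cf: "continuous_on A f" and cg: "continuous_on A g" for A
    using DERIV_continuous_on[OF has_field_derivative_at_within[OF f(1)]] continuous_on_subset[OF g]
    by auto
  have i: "set_integrable lborel {a..b} (\<lambda>t. ?e t * of_real (h t))" if "continuous_on {a..b} h" for h
    by (intro borel_integrable_atLeastAtMost' continuous_intros that)
  have "(LINT t|lborel. indicat_real {a..b} t *\<^sub>R (?e t * of_real (g t) - z * (?e t * of_real (f t))))
     = ?e b * of_real (f b) - ?e a * of_real (f a)"
  proof (rule integral_FTC_Icc[OF assms(1)])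
    fix t :: real
    have 1: "((\<lambda>t. complex_of_real (f t)) has_vector_derivative of_real (g t)) (at t within {a..b})"
      using f(1)[of t]
      by (intro has_vector_derivative_of_real) (auto intro: has_field_derivative_at_within
         simp: has_real_derivative_iff_has_vector_derivative[symmetric])
    have 2: "(?e has_vector_derivative - z * ?e t) (at t within {a..b})"
      by (rule has_vector_derivative_real_field) (auto intro!: derivative_eq_intros)
    show "((\<lambda>t. ?e t * of_real (f t)) has_vector_derivative
        ?e t * of_real (g t) - z * (?e t * of_real (f t))) (at t within {a..b})"
      using has_vector_derivative_mult[OF 2 1] by (simp add: algebra_simps)
  qed (intro continuous_intros cf cg)
  then have "(LINT t:{a..b}|lborel. ?e t * of_real (g t) - z * (?e t * of_real (f t))) = 0"
    by (simp add: set_lebesgue_integral_def f)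
  then show ?thesis
    by (subst (asm) set_integral_diff(2)[OF i[OF cg] set_integrable_mult_right[OF i[OF cf]]]) simp
qed

lemma laplace_smooth_bump_deriv:
  "z * laplace (smooth_bump p m) z = laplace (smooth_bump (bump_deriv_poly p m) (m + 2)) z"
  unfolding laplace_smooth_bump
  by (rule laplace_integration_by_parts)
     (auto simp: smooth_bump_outside continuous_smooth_bump simp del: add_2_eq_Suc'
       intro: smooth_bump_has_derivative)

lemma laplace_smooth_bump_decay:
  "\<exists>C\<ge>0. \<forall>z. cmod z ^ k * cmod (laplace (smooth_bump p m) z) \<le> C * exp \<bar>Re z\<bar>"
proof (induction k arbitrary: p m)
  case 0
  obtain K where K: "K \<ge> 0" "\<And>t. \<bar>smooth_bump p m t\<bar> \<le> K" using smooth_bump_bounded by blast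
  have "cmod (laplace (smooth_bump p m) z) \<le> K * exp \<bar>Re z\<bar>" for z
  proof -
    have "cmod (laplace (smooth_bump p m) z) \<le> (LINT t:{0..1::real}|lborel. K * exp \<bar>Re z\<bar>)"
      unfolding laplace_smooth_bump
    proof (rule order_trans[OF set_integral_norm_bound set_integral_mono])
      show "set_integrable lborel {0..1} (\<lambda>t. exp (- z * of_real t) * complex_of_real (smooth_bump p m t))"
        by (rule set_integrable_smooth_bump)
      show "set_integrable lborel {0..1} (\<lambda>t. cmod (exp (- z * of_real t) * of_real (smooth_bump p m t)))"
        by (intro set_integrable_norm set_integrable_smooth_bump)
      show "set_integrable lborel {0..1::real} (\<lambda>t. K * exp \<bar>Re z\<bar>)"
        by (intro borel_integrable_atLeastAtMost' continuous_intros)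
      fix t :: real assume "t \<in> {0..1}"
      then have "- Re z * t \<le> \<bar>Re z\<bar>"
        by (simp add: abs_if) (smt (verit) mult_left_le mult_nonneg_nonneg mult_minus_left)
      then show "cmod (exp (- z * of_real t) * of_real (smooth_bump p m t)) \<le> K * exp \<bar>Re z\<bar>"
        using K by (subst mult.commute) (auto simp: norm_mult intro!: mult_mono)
    qed
    then show ?thesis by (simp add: set_lebesgue_integral_def)
  qed
  then show ?case using K(1) by auto
next
  case (Suc k)
  obtain C where "C \<ge> 0" and C: "\<And>z. cmod z ^ k *
      cmod (laplace (smooth_bump (bump_deriv_poly p m) (m + 2)) z) \<le> C * exp \<bar>Re z\<bar>"
    using Suc by blast
  have "cmod z ^ Suc k * cmod (laplace (smooth_bump p m) z) \<le> C * exp \<bar>Re z\<bar>" for z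
    using C[of z] by (simp only: laplace_smooth_bump_deriv[symmetric] norm_mult power_Suc2 mult_ac)
  then show ?case using \<open>C \<ge> 0\<close> by blast
qed

lemma psi0_nonneg: "psi0 u \<ge> 0" by (simp add: psi0_def)

lemma psi0_outside: "u \<le> 0 \<or> 1 \<le> u \<Longrightarrow> psi0 u = 0" by (auto simp: psi0_def)

lemma continuous_psi0: "continuous_on A psi0"
  unfolding psi0_eq_smooth_bump by (rule continuous_smooth_bump)

lemma borel_measurable_psi0 [measurable]: "psi0 \<in> borel_measurable borel"
  unfolding psi0_eq_smooth_bump by measurable

lemma psi0_integral_pos: "(LINT u:{0..1}|lborel. psi0 u) > 0"
proof -
  have "exp (- 16 / 3) * (1 / 2 :: real) = (LINT u:{1/4..3/4::real}|lborel. exp (- 16 / 3))"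
    by (simp add: set_lebesgue_integral_def)
  also have "\<dots> \<le> (LINT u:{1/4..3/4}|lborel. psi0 u)"
  proof (rule set_integral_mono)
    fix u :: real assume u: "u \<in> {1/4..3/4}"
    have "(u - 1/4) * (3/4 - u) \<ge> 0" using u by (intro mult_nonneg_nonneg) auto
    moreover have "(u - 1/4) * (3/4 - u) = u * (1 - u) - 3 / 16" by (simp add: field_simps)
    ultimately have "u * (1 - u) \<ge> 3 / 16" by linarith
    then have "1 / (u * (1 - u)) \<le> 16 / 3" by (simp add: divide_simps)
    then show "exp (- 16 / 3) \<le> psi0 u" using u by (simp add: psi0_def)
  qed (auto intro!: borel_integrable_atLeastAtMost' continuous_intros continuous_psi0)
  also have "\<dots> \<le> (LINT u:{0..1}|lborel. psi0 u)"
    unfolding set_lebesgue_integral_def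
  proof (rule integral_mono)
    fix u :: real
    show "indicat_real {1/4..3/4} u *\<^sub>R psi0 u \<le> indicat_real {0..1} u *\<^sub>R psi0 u"
      using psi0_nonneg[of u] by (simp add: indicator_def)
  qed (rule borel_integrable_atLeastAtMost'[OF continuous_psi0, unfolded set_integrable_def])+
  finally have "exp (- 16 / 3) * (1 / 2) \<le> (LINT u:{0..1}|lborel. psi0 u)" .
  moreover have "exp (- 16 / 3) * (1 / 2) > (0 :: real)" by simp
  ultimately show ?thesis by (rule less_le_trans[rotated])
qed

lemma c0_pos: "c0 > 0" using psi0_integral_pos by (simp add: c0_def)

definition bump_primitive :: "real \<Rightarrow> real" where
  "bump_primitive u = (LBINT y=0..ereal u. psi0 y)"

lemma bump_primitive_has_derivative: "(bump_primitive has_real_derivative psi0 u) (at u)"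
proof -
  have "((\<lambda>u. LBINT y=ereal 0..ereal u. psi0 y) has_vector_derivative psi0 u)
      (at u within {- \<bar>u\<bar> - 1..\<bar>u\<bar> + 1})"
    by (intro interval_integral_FTC2 continuous_psi0) auto
  moreover have "at u within {- \<bar>u\<bar> - 1..\<bar>u\<bar> + 1} = at u"
    by (rule at_within_Icc_at) (auto simp: abs_if)
  ultimately show ?thesis
    by (simp add: bump_primitive_def[abs_def] has_real_derivative_iff_has_vector_derivative zero_ereal_def)
qed

lemma bump_primitive_mono: "u \<le> v \<Longrightarrow> bump_primitive u \<le> bump_primitive v"
  using DERIV_nonneg_imp_nondecreasing[of u v bump_primitive] bump_primitive_has_derivative psi0_nonneg
  by blast

lemma bump_primitive_nonpos: "u \<le> 0 \<Longrightarrow> bump_primitive u = 0"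
proof -
  assume "u \<le> 0"
  then have "bump_primitive u = - (LBINT y=ereal u..ereal 0. psi0 y)"
    unfolding bump_primitive_def zero_ereal_def by (rule_tac interval_integral_endpoints_reverse)
  also have "(LBINT y=ereal u..ereal 0. psi0 y) = (LINT y:{u..0}|lborel. psi0 y)"
    using \<open>u \<le> 0\<close> by (rule interval_integral_Icc)
  also have "\<dots> = (LINT y:{u..0}|lborel. 0)"
    by (rule set_lebesgue_integral_cong) (auto simp: psi0_outside)
  finally show ?thesis by (simp add: set_lebesgue_integral_def)
qed

lemma bump_primitive_ge_1: "1 \<le> u \<Longrightarrow> c0 * bump_primitive u = 1"
proof -
  assume "1 \<le> u"
  then have "bump_primitive u = (LINT y:{0..u}|lborel. psi0 y)"
    unfolding bump_primitive_def zero_ereal_def by (intro interval_integral_Icc) simp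
  also have "\<dots> = (LINT y:{0..1}|lborel. psi0 y)"
    unfolding set_lebesgue_integral_def using \<open>1 \<le> u\<close>
    by (intro Bochner_Integration.integral_cong) (auto simp: indicator_def psi0_outside)
  finally show ?thesis using psi0_integral_pos by (simp add: c0_def)
qed

text \<open>Both ramps of the cutoff are values of one primitive of the bump. This replaces the
  case distinction in the definition by a single smooth formula.\<close>

lemma psi_eq_primitive:
  assumes "b \<ge> 0"
  shows "psi b t = c0 * (bump_primitive (4 * t + 1) - bump_primitive (4 * (t - b)))"
proof -
  have ramp: "4 * (LINT x:{a..t}|lborel. psi0 (4 * x + d)) = bump_primitive (4 * t + d) - bump_primitive (4 * a + d)"
    if "a \<le> t" for a d t
  proof -
    have "(LBINT x. indicat_real {a..t} x *\<^sub>R psi0 (4 * x + d))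
       = bump_primitive (4 * t + d) / 4 - bump_primitive (4 * a + d) / 4"
    proof (rule integral_FTC_Icc[OF that])
      fix x :: real
      have "((\<lambda>t. bump_primitive (4 * t + d) / 4) has_real_derivative psi0 (4 * x + d)) (at x)"
        by (auto intro!: derivative_eq_intros DERIV_chain2[OF bump_primitive_has_derivative])
      then show "((\<lambda>t. bump_primitive (4 * t + d) / 4) has_vector_derivative psi0 (4 * x + d)) (at x within {a..t})"
        by (simp add: has_real_derivative_iff_has_vector_derivative has_vector_derivative_at_within)
    qed (intro continuous_on_compose2[OF continuous_psi0[of UNIV]] continuous_intros, auto)
    then show ?thesis by (simp add: set_lebesgue_integral_def)
  qed
  have 1: "4 * (LINT x:{- 1/4..t}|lborel. psi0 (4 * x + 1)) = bump_primitive (4 * t + 1)" if "- 1/4 \<le> t" for t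
    using ramp[OF that, of 1] by (simp add: bump_primitive_nonpos)
  have 2: "4 * (LINT x:{b..t}|lborel. psi0 (4 * (x - b))) = bump_primitive (4 * (t - b))" if "b \<le> t" for t
    using ramp[OF that, of "- 4 * b"] by (simp add: bump_primitive_nonpos right_diff_distrib)
  consider "t < - 1/4" | "t > b + 1/4" | "- 1/4 \<le> t" "t \<le> 0" | "0 < t" "t \<le> b" | "b < t" "0 < t" "t \<le> b + 1/4"
    using assms by linarith
  then show ?thesis
  proof cases
    case 1
    then show ?thesis using assms by (simp add: psi_def bump_primitive_nonpos)
  next
    case 2
    then show ?thesis using assms bump_primitive_ge_1[of "4 * t + 1"] bump_primitive_ge_1[of "4 * (t - b)"]
      by (simp add: psi_def right_diff_distrib)
  next
    case 3
    then show ?thesis using assms 1[of t] by (simp add: psi_def bump_primitive_nonpos mult_ac)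
  next
    case 4
    then show ?thesis using assms bump_primitive_ge_1[of "4 * t + 1"]
      by (simp add: psi_def bump_primitive_nonpos right_diff_distrib)
  next
    case 5
    then show ?thesis using assms 2[of t] bump_primitive_ge_1[of "4 * t + 1"]
      by (simp add: psi_def right_diff_distrib mult_ac)
  qed
qed

lemma psi_bounds: assumes "b \<ge> 0" shows "0 \<le> psi b t" "psi b t \<le> 1"
proof -
  have "bump_primitive (4 * (t - b)) \<le> bump_primitive (4 * t + 1)"
    using assms by (intro bump_primitive_mono) simp
  then show "0 \<le> psi b t" unfolding psi_eq_primitive[OF assms] using c0_pos by simp
  have "bump_primitive (4 * (t - b)) \<ge> bump_primitive (min 0 (4 * (t - b)))"
    by (intro bump_primitive_mono) simp
  then have "bump_primitive (4 * (t - b)) \<ge> 0" by (simp add: bump_primitive_nonpos)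
  then have "c0 * bump_primitive (4 * (t - b)) \<ge> 0" using c0_pos by simp
  moreover have "c0 * bump_primitive (4 * t + 1) \<le> c0 * bump_primitive (max 1 (4 * t + 1))"
    using c0_pos by (intro mult_left_mono bump_primitive_mono) auto
  ultimately show "psi b t \<le> 1" unfolding psi_eq_primitive[OF assms]
    using bump_primitive_ge_1[of "max 1 (4 * t + 1)"] by (simp add: right_diff_distrib)
qed

lemma psi_eq_1: "0 \<le> t \<Longrightarrow> t \<le> b \<Longrightarrow> psi b t = 1"
  using bump_primitive_ge_1[of "4 * t + 1"]
  by (simp add: psi_eq_primitive bump_primitive_nonpos right_diff_distrib)

lemma psi_outside:
  assumes "t \<le> - 1/4 \<or> t \<ge> b + 1/4" "b \<ge> 0"
  shows "psi b t = 0"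
  using assms(1)
proof
  assume "t \<le> - 1/4"
  then show ?thesis using assms(2) by (simp add: psi_eq_primitive bump_primitive_nonpos)
next
  assume "b + 1/4 \<le> t"
  then have "c0 * bump_primitive (4 * t + 1) = c0 * bump_primitive (4 * (t - b))"
    using assms(2) by (simp add: bump_primitive_ge_1)
  then show ?thesis using assms(2) by (simp only: psi_eq_primitive right_diff_distrib)
qed

lemma psi_has_derivative:
  assumes "b \<ge> 0"
  shows "(psi b has_real_derivative 4 * c0 * (psi0 (4 * t + 1) - psi0 (4 * (t - b)))) (at t)"
proof -
  have "((\<lambda>t. c0 * (bump_primitive (4 * t + 1) - bump_primitive (4 * (t - b)))) has_real_derivative
      4 * c0 * (psi0 (4 * t + 1) - psi0 (4 * (t - b)))) (at t)"
    by (auto intro!: derivative_eq_intros DERIV_chain2[OF bump_primitive_has_derivative] simp: algebra_simps)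
  then show ?thesis by (simp add: psi_eq_primitive[OF assms, abs_def])
qed

lemma continuous_psi: "b \<ge> 0 \<Longrightarrow> continuous_on A (psi b)"
  by (rule DERIV_continuous_on) (rule has_field_derivative_at_within[OF psi_has_derivative])

lemma laplace_psi0_whole_line:
  "laplace psi0 z = (LINT u|lborel. exp (- z * of_real u) * of_real (psi0 u))"
  unfolding laplace_def set_lebesgue_integral_def
  by (intro Bochner_Integration.integral_cong) (auto simp: indicator_def psi0_outside)

lemma integrable_psi0_exp_affine:
  "integrable lborel (\<lambda>t. exp (- z * of_real t) * complex_of_real (psi0 (4 * t + c)))"
proof -
  have "set_integrable lborel {- c / 4..(1 - c) / 4} (\<lambda>t. exp (- z * of_real t) * complex_of_real (psi0 (4 * t + c)))"
    by (intro borel_integrable_atLeastAtMost' continuous_intros continuous_on_compose2[OF continuous_psi0[of UNIV]]) auto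
  then show ?thesis unfolding set_integrable_def
    by (rule Bochner_Integration.integrable_cong[OF refl, THEN iffD1, rotated])
       (auto simp: indicator_def psi0_outside field_simps)
qed

lemma integral_psi0_exp_affine:
  "(LINT t|lborel. exp (- z * of_real t) * complex_of_real (psi0 (4 * t + c)))
     = exp (z * of_real c / 4) * laplace psi0 (z / 4) / 4"
proof -
  have "laplace psi0 (z / 4) = (LINT u|lborel. exp (- (z / 4) * of_real u) * of_real (psi0 u))"
    by (rule laplace_psi0_whole_line)
  also have "\<dots> = 4 * (LINT t|lborel. exp (- (z / 4) * of_real (c + 4 * t)) * of_real (psi0 (c + 4 * t)))"
    by (subst lborel_integral_real_affine[where t = c and c = 4]) (auto simp: scaleR_conv_of_real)
  also have "(LINT t|lborel. exp (- (z / 4) * of_real (c + 4 * t)) * of_real (psi0 (c + 4 * t)))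
      = (LINT t|lborel. exp (- (z * of_real c / 4)) * (exp (- z * of_real t) * complex_of_real (psi0 (4 * t + c))))"
  proof (intro Bochner_Integration.integral_cong refl)
    fix t :: real
    have "- (z / 4) * complex_of_real (c + 4 * t) = - (z * of_real c / 4) + (- z * of_real t)"
      by (simp add: algebra_simps)
    then have "exp (- (z / 4) * complex_of_real (c + 4 * t)) = exp (- (z * of_real c / 4)) * exp (- z * of_real t)"
      by (simp only: exp_add)
    then show "exp (- (z / 4) * complex_of_real (c + 4 * t)) * complex_of_real (psi0 (c + 4 * t)) =
        exp (- (z * of_real c / 4)) * (exp (- z * of_real t) * complex_of_real (psi0 (4 * t + c)))"
      by (simp only: mult.assoc add.commute)
  qed
  also have "\<dots> = exp (- (z * of_real c / 4)) * (LINT t|lborel. exp (- z * of_real t) * complex_of_real (psi0 (4 * t + c)))"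
    by (rule integral_mult_right_zero)
  finally show ?thesis by (simp add: exp_minus)
qed

text \<open>Multiplication by \<open>z\<close> amounts to differentiating the cutoff, whose
  derivative consists of two rescaled copies of the bump, one for each ramp.\<close>

lemma bilateral_laplace_psi:
  assumes "b \<ge> 0"
  shows "z * bilateral_laplace (psi b) z = of_real c0 * laplace psi0 (z / 4) * (exp (z / 4) - exp (- z * of_real b))"
proof -
  let ?I = "{- 1/4..b + 1/4}"
  let ?f = "psi b" and ?g = "\<lambda>t. 4 * c0 * (psi0 (4 * t + 1) - psi0 (4 * (t - b)))"
  have "continuous_on UNIV ?g"
    by (intro continuous_intros continuous_on_compose2[OF continuous_psi0[of UNIV]]) auto
  then have "z * (LINT t:?I|lborel. exp (- z * of_real t) * of_real (?f t)) =
      (LINT t:?I|lborel. exp (- z * of_real t) * of_real (?g t))"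
    by (intro laplace_integration_by_parts psi_has_derivative assms)
       (use assms in \<open>auto simp: psi_outside\<close>)
  also have "(LINT t:?I|lborel. exp (- z * of_real t) * of_real (?f t)) = bilateral_laplace (psi b) z"
    unfolding bilateral_laplace_def set_lebesgue_integral_def
    by (intro Bochner_Integration.integral_cong) (use assms in \<open>auto simp: indicator_def psi_outside\<close>)
  also have "(LINT t:?I|lborel. exp (- z * of_real t) * complex_of_real (?g t)) =
     (LINT t|lborel. 4 * of_real c0 * (exp (- z * of_real t) * of_real (psi0 (4 * t + 1)))
        - 4 * of_real c0 * (exp (- z * of_real t) * of_real (psi0 (4 * t + (- 4 * b)))))"
    unfolding set_lebesgue_integral_def
  proof (intro Bochner_Integration.integral_cong refl)
    fix t :: real
    have "t \<notin> ?I \<Longrightarrow> psi0 (4 * t + 1) = 0 \<and> psi0 (4 * (t - b)) = 0"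
      using assms by (auto intro!: psi0_outside)
    then show "indicat_real ?I t *\<^sub>R (exp (- z * of_real t) * complex_of_real (?g t)) =
        4 * of_real c0 * (exp (- z * of_real t) * of_real (psi0 (4 * t + 1)))
        - 4 * of_real c0 * (exp (- z * of_real t) * of_real (psi0 (4 * t + (- 4 * b))))"
      by (cases "t \<in> ?I") (simp_all add: algebra_simps)
  qed
  also have "\<dots> = of_real c0 * laplace psi0 (z / 4) * (exp (z / 4) - exp (- z * of_real b))"
    by (subst Bochner_Integration.integral_diff)
       (auto intro!: integrable_mult_right integrable_psi0_exp_affine
          simp only: integral_mult_right_zero integral_psi0_exp_affine, simp add: algebra_simps)
  finally show ?thesis .
qed

text \<open>The parameter \<open>b\<close> only shifts the right ramp and hence enters only
  through an exponential. The restriction \<open>b \<ge> 1/4\<close> lets this exponential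
  dominate the contribution of the left ramp as well.\<close>

lemma bilateral_laplace_psi_decay:
  "\<exists>C\<ge>0. \<forall>b\<ge>1/4. \<forall>z. cmod z ^ Suc k * cmod (bilateral_laplace (psi b) z)
     \<le> C * exp (\<bar>Re z\<bar> * (b + 1/4))"
proof -
  obtain C where C0: "C \<ge> 0" and C: "\<And>z. cmod z ^ k * cmod (laplace psi0 z) \<le> C * exp \<bar>Re z\<bar>"
    using laplace_smooth_bump_decay[of k 1 0] unfolding psi0_eq_smooth_bump by blast
  have "cmod z ^ Suc k * cmod (bilateral_laplace (psi b) z) \<le> (2 * c0 * 4 ^ k * C) * exp (\<bar>Re z\<bar> * (b + 1/4))"
    if b: "b \<ge> 1/4" for b z
  proof -
    have "cmod z ^ Suc k * cmod (bilateral_laplace (psi b) z) = cmod z ^ k * cmod (z * bilateral_laplace (psi b) z)"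
      by (simp add: norm_mult)
    also have "\<dots> = c0 * 4 ^ k * (cmod (z / 4) ^ k * cmod (laplace psi0 (z / 4))) * cmod (exp (z / 4) - exp (- z * of_real b))"
      using b c0_pos by (simp add: bilateral_laplace_psi norm_mult norm_divide power_divide)
    also have "\<dots> \<le> c0 * 4 ^ k * (C * exp (\<bar>Re z\<bar> / 4)) * (exp (\<bar>Re z\<bar> * b) + exp (\<bar>Re z\<bar> * b))"
    proof (rule mult_mono[OF mult_left_mono])
      show "cmod (z / 4) ^ k * cmod (laplace psi0 (z / 4)) \<le> C * exp (\<bar>Re z\<bar> / 4)"
        using C[of "z / 4"] by simp
      have "Re z / 4 \<le> \<bar>Re z\<bar> * b" "- Re z * b \<le> \<bar>Re z\<bar> * b"
        using b mult_left_mono[of "1/4" b "\<bar>Re z\<bar>"] mult_right_mono[of "- Re z" "\<bar>Re z\<bar>" b] by auto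
      then have "cmod (exp (z / 4)) \<le> exp (\<bar>Re z\<bar> * b)" "cmod (exp (- z * of_real b)) \<le> exp (\<bar>Re z\<bar> * b)"
        by simp_all
      then show "cmod (exp (z / 4) - exp (- z * of_real b)) \<le> exp (\<bar>Re z\<bar> * b) + exp (\<bar>Re z\<bar> * b)"
        using norm_triangle_ineq4[of "exp (z / 4)" "exp (- z * of_real b)"] by linarith
    qed (use c0_pos C0 in auto)
    also have "\<dots> = (2 * c0 * 4 ^ k * C) * exp (\<bar>Re z\<bar> * (b + 1/4))"
      by (simp add: exp_add distrib_left)
    finally show ?thesis .
  qed
  then show ?thesis using C0 c0_pos by (intro exI[of _ "2 * c0 * 4 ^ k * C"]) auto
qed

section \<open>Shifting a vertical line of integration\<close>

lemma integrable_inverse_1_plus_square_UNIV: "integrable lborel (\<lambda>w::real. 1 / (1 + w\<^sup>2))"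
  and lborel_integral_inverse_1_plus_square: "(LINT w|lborel. 1 / (1 + w\<^sup>2 :: real)) = pi"
  using integrable_inverse_1_plus_square LBINT_inverse_1_plus_square
  by (simp_all add: set_integrable_def interval_lebesgue_integral_def set_lebesgue_integral_def inverse_eq_divide)

lemma vertical_line_integrable:
  fixes F :: "complex \<Rightarrow> complex"
  assumes "continuous_on UNIV (\<lambda>w. F (Complex x w))"
    and "\<And>w. cmod (F (Complex x w)) \<le> K / (1 + w\<^sup>2)"
  shows "integrable lborel (\<lambda>w. F (Complex x w))"
proof (rule Bochner_Integration.integrable_bound)
  show "integrable lborel (\<lambda>w::real. K * (1 / (1 + w\<^sup>2)))"
    by (intro integrable_mult_right integrable_inverse_1_plus_square_UNIV)
  show "(\<lambda>w. F (Complex x w)) \<in> borel_measurable lborel"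
    using borel_measurable_continuous_onI[OF assms(1)] by simp
  have "K / (1 + w\<^sup>2) \<le> \<bar>K / (1 + w\<^sup>2)\<bar>" for w :: real by (rule abs_ge_self)
  then show "AE w in lborel. cmod (F (Complex x w)) \<le> norm (K * (1 / (1 + w\<^sup>2)))"
    using assms(2) by (intro AE_I2) (metis order_trans real_norm_def times_divide_eq_right mult.right_neutral)
qed

lemma continuous_on_Complex_line: "continuous_on A (\<lambda>w. Complex x w)"
  unfolding Complex_eq by (intro continuous_intros)

lemma vertical_line_integral_tendsto:
  fixes F :: "complex \<Rightarrow> complex"
  assumes c: "continuous_on UNIV (\<lambda>w. F (Complex x w))"
    and "\<And>w. cmod (F (Complex x w)) \<le> K / (1 + w\<^sup>2)"
  shows "(\<lambda>n. integral {- real n..real n} (\<lambda>w. F (Complex x w)))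
     \<longlonglongrightarrow> (LINT w|lborel. F (Complex x w))"
proof -
  have i: "integrable lborel (\<lambda>w. F (Complex x w))"
    by (rule vertical_line_integrable[OF assms])
  have "(\<lambda>n. LINT w|lborel. indicator {- real n..real n} w *\<^sub>R F (Complex x w))
     \<longlonglongrightarrow> (LINT w|lborel. F (Complex x w))"
  proof (rule integral_dominated_convergence)
    show "integrable lborel (\<lambda>w. norm (F (Complex x w)))" using i by simp
    show "AE w in lborel. (\<lambda>n. indicat_real {- real n..real n} w *\<^sub>R F (Complex x w)) \<longlonglongrightarrow> F (Complex x w)"
    proof (intro AE_I2)
      fix w :: real
      have "eventually (\<lambda>n. indicat_real {- real n..real n} w *\<^sub>R F (Complex x w) = F (Complex x w)) sequentially"
        using eventually_ge_at_top[of "nat \<lceil>\<bar>w\<bar>\<rceil>"]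
      proof eventually_elim
        case (elim n)
        then have "\<bar>w\<bar> \<le> real n" by linarith
        then show ?case by (simp add: indicator_def abs_le_iff)
      qed
      then show "(\<lambda>n. indicat_real {- real n..real n} w *\<^sub>R F (Complex x w)) \<longlonglongrightarrow> F (Complex x w)"
        by (rule tendsto_eventually)
    qed
  qed (use i in \<open>auto simp: indicator_def\<close>)
  moreover have "(LINT w|lborel. indicator {- real n..real n} w *\<^sub>R F (Complex x w))
      = integral {- real n..real n} (\<lambda>w. F (Complex x w))" for n
  proof -
    have "set_integrable lborel {- real n..real n} (\<lambda>w. F (Complex x w))"
      by (intro borel_integrable_atLeastAtMost' continuous_on_subset[OF c]) auto
    from set_borel_integral_eq_integral(2)[OF this] show ?thesis
      by (simp add: set_lebesgue_integral_def)
  qed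
  ultimately show ?thesis by simp
qed

text \<open>Cauchy's theorem on rectangles of half height \<open>n\<close>: the horizontal sides
  contribute \<open>O(n\<^sup>-\<^sup>2)\<close>.\<close>

lemma vertical_line_integral_shift:
  fixes F :: "complex \<Rightarrow> complex"
  assumes hol: "F holomorphic_on {z. Re z < c}" and ab: "a < b" "b < c"
    and bound: "\<And>x w. a \<le> x \<Longrightarrow> x \<le> b \<Longrightarrow> cmod (F (Complex x w)) \<le> K / (1 + w\<^sup>2)"
  shows "(LINT w|lborel. F (Complex a w)) = (LINT w|lborel. F (Complex b w))"
proof -
  let ?S = "{z. Re z < c}"
  have contF: "continuous_on ?S F" by (rule holomorphic_on_imp_continuous_on[OF hol])
  have contl: "continuous_on UNIV (\<lambda>w. F (Complex x w))" if "x < c" for x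
    by (rule continuous_on_compose2[OF contF continuous_on_Complex_line]) (use that in auto)
  define I where "I x n = integral {- real n..real n} (\<lambda>w. F (Complex x w))" for x n
  have convS: "convex ?S" by (rule convex_halfspace_Re_lt)
  have key: "cmod (I b n - I a n) \<le> 2 * (K / (1 + (real n)\<^sup>2) * (b - a))" if n: "n > 0" for n
  proof -
    define p1 p2 p3 p4 where p: "p1 = Complex a (- real n)" "p2 = Complex b (- real n)"
      "p3 = Complex b (real n)" "p4 = Complex a (real n)"
    note p_simps = p[THEN arg_cong[of _ _ Re]] p[THEN arg_cong[of _ _ Im]]
    have pS: "{p1, p2, p3, p4} \<subseteq> ?S" using ab by (auto simp: p)
    have seg: "closed_segment u v \<subseteq> ?S" if "u \<in> {p1, p2, p3, p4}" "v \<in> {p1, p2, p3, p4}" for u v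
      using that pS by (intro closed_segment_subset convS) auto
    have cint: "F contour_integrable_on linepath u v"
      if "u \<in> {p1, p2, p3, p4}" "v \<in> {p1, p2, p3, p4}" for u v
      by (intro contour_integrable_continuous_linepath continuous_on_subset[OF contF] seg that)
    have "(F has_contour_integral 0) (linepath p1 p2 +++ linepath p2 p3 +++ linepath p3 p4 +++ linepath p4 p1)"
      by (rule Cauchy_theorem_convex_simple[OF hol convS])
         (use seg in \<open>auto intro!: valid_path_join simp: path_image_join\<close>)
    then have "contour_integral (linepath p1 p2 +++ linepath p2 p3 +++ linepath p3 p4 +++ linepath p4 p1) F = 0"
      by (rule contour_integral_unique)
    then have sum0: "contour_integral (linepath p1 p2) F + (contour_integral (linepath p2 p3) F
        + (contour_integral (linepath p3 p4) F + contour_integral (linepath p4 p1) F)) = 0"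
      by (simp add: contour_integral_join cint contour_integrable_joinI valid_path_join)
    have v1: "contour_integral (linepath p2 p3) F = \<i> * I b n"
      unfolding I_def by (rule contour_integral_linepath_same_Re) (use n in \<open>auto simp: p\<close>)
    have "contour_integral (linepath p1 p4) F = \<i> * I a n"
      unfolding I_def by (rule contour_integral_linepath_same_Re) (use n in \<open>auto simp: p\<close>)
    then have v2: "contour_integral (linepath p4 p1) F = - (\<i> * I a n)"
      using contour_integral_reversepath[of "linepath p1 p4" F] by simp
    have h: "cmod (contour_integral (linepath u v) F) \<le> K / (1 + (real n)\<^sup>2) * (b - a)"
      if uv: "(u, v) = (p1, p2) \<or> (u, v) = (p3, p4)" for u v
    proof -
      have "cmod (contour_integral (linepath u v) F) \<le> K / (1 + (real n)\<^sup>2) * norm (v - u)"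
      proof (rule contour_integral_bound_linepath)
        show "F contour_integrable_on linepath u v" using uv by (intro cint) auto
        have "0 \<le> cmod (F (Complex a (real n)))" by simp
        also have "\<dots> \<le> K / (1 + (real n)\<^sup>2)" using bound[of a "real n"] ab by simp
        finally show "0 \<le> K / (1 + (real n)\<^sup>2)" .
        fix x assume "x \<in> closed_segment u v"
        then obtain r where r: "0 \<le> r" "r \<le> 1" and x: "x = (1 - r) *\<^sub>R u + r *\<^sub>R v"
          by (auto simp: closed_segment_def)
        have "0 \<le> r * (b - a)" "r * (b - a) \<le> b - a"
          using r ab by (auto intro: mult_left_le_one_le)
        then have re: "a \<le> Re x" "Re x \<le> b" using uv by (auto simp: x p algebra_simps)
        have im: "(Im x)\<^sup>2 = (real n)\<^sup>2"
          using uv by (auto simp: x p algebra_simps power2_eq_square)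
        show "cmod (F x) \<le> K / (1 + (real n)\<^sup>2)"
          using bound[OF re, of "Im x"] im by simp
      qed
      also have "norm (v - u) = b - a"
        using uv ab by (auto simp: p complex_diff cmod_def)
      finally show ?thesis .
    qed
    have "\<i> * (I b n - I a n) = - (contour_integral (linepath p1 p2) F + contour_integral (linepath p3 p4) F)"
      using sum0 unfolding v1 v2 by (simp add: algebra_simps add_eq_0_iff)
    then have "cmod (I b n - I a n) = cmod (contour_integral (linepath p1 p2) F + contour_integral (linepath p3 p4) F)"
      by (metis norm_minus_cancel norm_mult norm_ii mult_1)
    also have "\<dots> \<le> K / (1 + (real n)\<^sup>2) * (b - a) + K / (1 + (real n)\<^sup>2) * (b - a)"
      by (intro order_trans[OF norm_triangle_ineq] add_mono h) auto
    finally show ?thesis by simp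
  qed
  have lim: "(\<lambda>n. I b n - I a n) \<longlonglongrightarrow> (LINT w|lborel. F (Complex b w)) - (LINT w|lborel. F (Complex a w))"
    unfolding I_def using ab
    by (intro tendsto_diff vertical_line_integral_tendsto[where K = K] contl bound) auto
  moreover have "(\<lambda>n. I b n - I a n) \<longlonglongrightarrow> 0"
  proof (rule Lim_null_comparison)
    show "\<forall>\<^sub>F n in sequentially. norm (I b n - I a n) \<le> 2 * (K / (1 + (real n)\<^sup>2) * (b - a))"
      using eventually_gt_at_top[of 0] by eventually_elim (rule key)
    show "(\<lambda>n. 2 * (K / (1 + (real n)\<^sup>2) * (b - a))) \<longlonglongrightarrow> 0"
      by real_asymp
  qed
  ultimately show ?thesis using LIMSEQ_unique by fastforce
qed

section \<open>Fourier inversion\<close>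

lemma gaussian_fourier:
  assumes "e > 0"
  shows "integrable lborel (\<lambda>w. exp (- (e * w)\<^sup>2 / 2) :: real)"
    and "(LINT w|lborel. complex_of_real (exp (- (e * w)\<^sup>2 / 2)) * exp (\<i> * of_real (w * y)))
      = of_real (sqrt (2 * pi) / e * exp (- (y / e)\<^sup>2 / 2))"
proof -
  have "integrable lborel (\<lambda>v. sqrt (2 * pi) * std_normal_density v)"
    by (intro integrable_mult_right integrable_normal_density) simp
  then have i0: "integrable lborel (\<lambda>v. exp (- v\<^sup>2 / 2) :: real)"
    by (simp add: std_normal_density_def)
  then show "integrable lborel (\<lambda>w. exp (- (e * w)\<^sup>2 / 2) :: real)"
    using lborel_integrable_real_affine[OF i0, of e 0] assms by simp
  have "complex_of_real (exp (- (y / e)\<^sup>2 / 2)) = char std_normal_distribution (y / e)"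
    by (simp add: char_std_normal_distribution)
  also have "\<dots> = (LINT v|lborel. std_normal_density v *\<^sub>R exp (\<i> * of_real (y / e * v)))"
    unfolding char_def by (subst integral_density) (auto simp: normal_density_nonneg)
  also have "\<dots> = e *\<^sub>R (LINT w|lborel. std_normal_density (0 + e * w) *\<^sub>R exp (\<i> * of_real (y / e * (0 + e * w))))"
    using lborel_integral_real_affine[of e "\<lambda>v. std_normal_density v *\<^sub>R exp (\<i> * of_real (y / e * v))" 0] assms
    by simp
  also have "(LINT w|lborel. std_normal_density (0 + e * w) *\<^sub>R exp (\<i> * of_real (y / e * (0 + e * w)))) =
     (LINT w|lborel. of_real (1 / sqrt (2 * pi)) * (complex_of_real (exp (- (e * w)\<^sup>2 / 2)) * exp (\<i> * of_real (w * y))))"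
    using assms by (intro Bochner_Integration.integral_cong refl)
      (simp add: std_normal_density_def scaleR_conv_of_real mult_ac)
  also have "\<dots> = of_real (1 / sqrt (2 * pi)) * (LINT w|lborel. complex_of_real (exp (- (e * w)\<^sup>2 / 2)) * exp (\<i> * of_real (w * y)))"
    by (rule integral_mult_right_zero)
  finally show "(LINT w|lborel. complex_of_real (exp (- (e * w)\<^sup>2 / 2)) * exp (\<i> * of_real (w * y)))
      = of_real (sqrt (2 * pi) / e * exp (- (y / e)\<^sup>2 / 2))"
    using assms by (simp add: scaleR_conv_of_real field_simps)
qed

text \<open>Gaussian summation: with the damping factor \<open>exp(- (e w)\<^sup>2 / 2)\<close>
  the inversion integral is, up to the factor \<open>2\<pi>\<close>, the average of
  \<open>g\<close> over a normal distribution around \<open>x\<close> with standard deviation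
  \<open>e\<close>. Both sides converge as \<open>e \<rightarrow> 0\<close>.\<close>

lemma fourier_inversion:
  fixes g :: "real \<Rightarrow> complex"
  defines "h \<equiv> \<lambda>w. LINT t|lborel. exp (- (\<i> * of_real (w * t))) * g t"
  assumes cont: "continuous_on UNIV g" and int: "integrable lborel g"
    and bdd: "\<And>t. cmod (g t) \<le> B" and inth: "integrable lborel h"
  shows "(LINT w|lborel. exp (\<i> * of_real (w * x)) * h w) = 2 * of_real pi * g x"
proof -
  have gm [measurable]: "g \<in> borel_measurable borel" by (rule borel_measurable_continuous_onI[OF cont])
  have hm [measurable]: "h \<in> borel_measurable borel" using inth by simp
  define e where "e n = 1 / real (Suc n)" for n
  have e: "e n > 0" for n by (simp add: e_def)
  have e0: "e \<longlonglongrightarrow> 0" unfolding e_def by (rule LIMSEQ_Suc[OF lim_1_over_n])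
  define A where "A n = (LINT w|lborel. complex_of_real (exp (- (e n * w)\<^sup>2 / 2)) * exp (\<i> * of_real (w * x)) * h w)" for n
  have lim1: "A \<longlonglongrightarrow> (LINT w|lborel. exp (\<i> * of_real (w * x)) * h w)"
    unfolding A_def
  proof (rule integral_dominated_convergence)
    show "integrable lborel (\<lambda>w. norm (h w))" using inth by simp
    show "AE w in lborel. (\<lambda>n. complex_of_real (exp (- (e n * w)\<^sup>2 / 2)) * exp (\<i> * of_real (w * x)) * h w)
        \<longlonglongrightarrow> exp (\<i> * of_real (w * x)) * h w"
    proof (intro AE_I2)
      fix w
      have "(\<lambda>n. complex_of_real (exp (- (e n * w)\<^sup>2 / 2)) * exp (\<i> * of_real (w * x)) * h w)
        \<longlonglongrightarrow> complex_of_real (exp (- (0 * w)\<^sup>2 / 2)) * exp (\<i> * of_real (w * x)) * h w"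
        by (intro tendsto_intros e0) auto
      then show "(\<lambda>n. complex_of_real (exp (- (e n * w)\<^sup>2 / 2)) * exp (\<i> * of_real (w * x)) * h w)
        \<longlonglongrightarrow> exp (\<i> * of_real (w * x)) * h w" by simp
    qed
    show "AE w in lborel. norm (complex_of_real (exp (- (e n * w)\<^sup>2 / 2)) * exp (\<i> * of_real (w * x)) * h w) \<le> norm (h w)" for n
      by (intro AE_I2) (auto simp: norm_mult intro!: mult_left_le_one_le)
  qed measurable
  have A_eq: "A n = 2 * of_real pi * (LINT v|lborel. std_normal_density v *\<^sub>R g (x + e n * v))" for n
  proof -
    let ?f = "\<lambda>w t. complex_of_real (exp (- (e n * w)\<^sup>2 / 2)) * exp (\<i> * of_real (w * (x - t))) * g t"
    have pint: "integrable (lborel \<Otimes>\<^sub>M lborel) (\<lambda>(w, t). ?f w t)"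
    proof (rule lborel_pair.Fubini_integrable)
      show "(\<lambda>(w, t). ?f w t) \<in> borel_measurable (lborel \<Otimes>\<^sub>M lborel)" by measurable
      have "(\<lambda>w. LINT t|lborel. norm (?f w t)) = (\<lambda>w. exp (- (e n * w)\<^sup>2 / 2) * (LINT t|lborel. norm (g t)))"
        by (auto simp: norm_mult)
      then show "integrable lborel (\<lambda>w. LINT t|lborel. norm (case (w, t) of (w, t) \<Rightarrow> ?f w t))"
        using gaussian_fourier(1)[OF e[of n]] by simp
      show "AE w in lborel. integrable lborel (\<lambda>t. case (w, t) of (w, t) \<Rightarrow> ?f w t)"
      proof (intro AE_I2)
        fix w
        show "integrable lborel (\<lambda>t. case (w, t) of (w, t) \<Rightarrow> ?f w t)"
          by (rule Bochner_Integration.integrable_bound[OF int]) (auto simp: norm_mult intro!: mult_left_le_one_le)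
      qed
    qed
    have "A n = (LINT w|lborel. LINT t|lborel. ?f w t)"
      unfolding A_def
    proof (intro Bochner_Integration.integral_cong refl)
      fix w
      have "?f w = (\<lambda>t. complex_of_real (exp (- (e n * w)\<^sup>2 / 2)) * exp (\<i> * of_real (w * x)) *
          (exp (- (\<i> * of_real (w * t))) * g t))"
        by (intro ext) (simp add: right_diff_distrib exp_diff exp_minus field_simps)
      then show "complex_of_real (exp (- (e n * w)\<^sup>2 / 2)) * exp (\<i> * of_real (w * x)) * h w = (LINT t|lborel. ?f w t)"
        by (simp add: h_def)
    qed
    also have "\<dots> = (LINT t|lborel. LINT w|lborel. ?f w t)"
      using lborel_pair.Fubini_integral[OF pint] by simp
    also have "\<dots> = (LINT t|lborel. of_real (sqrt (2 * pi) / e n * exp (- ((x - t) / e n)\<^sup>2 / 2)) * g t)"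
      by (simp only: integral_mult_left_zero gaussian_fourier(2)[OF e])
    also have "\<dots> = e n *\<^sub>R (LINT v|lborel. of_real (sqrt (2 * pi) / e n * exp (- ((x - (x + e n * v)) / e n)\<^sup>2 / 2)) * g (x + e n * v))"
      using lborel_integral_real_affine[of "e n" "\<lambda>t. of_real (sqrt (2 * pi) / e n * exp (- ((x - t) / e n)\<^sup>2 / 2)) * g t" x] e[of n]
      by simp
    also have "(LINT v|lborel. of_real (sqrt (2 * pi) / e n * exp (- ((x - (x + e n * v)) / e n)\<^sup>2 / 2)) * g (x + e n * v))
       = (LINT v|lborel. of_real (2 * pi / e n) * (std_normal_density v *\<^sub>R g (x + e n * v)))"
    proof (intro Bochner_Integration.integral_cong refl)
      fix v
      have *: "(x - (x + e n * v)) / e n = - v" using e[of n] by simp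
      then have "sqrt (2 * pi) / e n * exp (- ((x - (x + e n * v)) / e n)\<^sup>2 / 2) = 2 * pi / e n * std_normal_density v"
      proof -
        have "2 * pi * (1 / sqrt (2 * pi)) = sqrt (2 * pi)" using real_div_sqrt[of "2 * pi"] by simp
        then have "2 * pi / e n * (1 / sqrt (2 * pi) * exp (- v\<^sup>2 / 2)) = sqrt (2 * pi) / e n * exp (- v\<^sup>2 / 2)"
          by (metis (no_types, lifting) mult.assoc times_divide_eq_left)
        then show ?thesis unfolding * by (simp add: std_normal_density_def)
      qed
      then show "of_real (sqrt (2 * pi) / e n * exp (- ((x - (x + e n * v)) / e n)\<^sup>2 / 2)) * g (x + e n * v)
        = of_real (2 * pi / e n) * (std_normal_density v *\<^sub>R g (x + e n * v))"
        by (simp only: scaleR_conv_of_real of_real_mult mult.assoc)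
    qed
    also have "\<dots> = of_real (2 * pi / e n) * (LINT v|lborel. std_normal_density v *\<^sub>R g (x + e n * v))"
      by (rule integral_mult_right_zero)
    finally show ?thesis using e[of n] by (simp add: scaleR_conv_of_real)
  qed
  have "(\<lambda>n. LINT v|lborel. std_normal_density v *\<^sub>R g (x + e n * v)) \<longlonglongrightarrow> (LINT v|lborel. std_normal_density v *\<^sub>R g x)"
  proof (rule integral_dominated_convergence)
    show "integrable lborel (\<lambda>v. std_normal_density v * B)"
      by (intro integrable_mult_left integrable_normal_density) simp
    show "AE v in lborel. (\<lambda>n. std_normal_density v *\<^sub>R g (x + e n * v)) \<longlonglongrightarrow> std_normal_density v *\<^sub>R g x"
    proof (intro AE_I2 tendsto_scaleR tendsto_const)
      fix v
      have "(\<lambda>n. x + e n * v) \<longlonglongrightarrow> x + 0 * v" by (intro tendsto_intros e0)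
      moreover have "isCont g x" using cont by (simp add: continuous_on_eq_continuous_at)
      ultimately show "(\<lambda>n. g (x + e n * v)) \<longlonglongrightarrow> g x"
        using isCont_tendsto_compose[of x g "\<lambda>n. x + e n * v"] by simp
    qed
    show "AE v in lborel. norm (std_normal_density v *\<^sub>R g (x + e n * v)) \<le> std_normal_density v * B" for n
      by (intro AE_I2) (auto simp: normal_density_nonneg intro!: mult_left_mono bdd)
  qed measurable
  also have "(LINT v|lborel. std_normal_density v *\<^sub>R g x) = g x"
    using integral_normal_density[of 1 0] by (subst integral_scaleR_left) (auto intro: integrable_normal_density)
  finally have "A \<longlonglongrightarrow> 2 * of_real pi * g x"
    unfolding A_eq[abs_def] by (intro tendsto_intros)
  with lim1 show ?thesis by (rule LIMSEQ_unique)
qed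

section \<open>The deconvolution kernel\<close>

locale arrival_intensity =
  fixes lam :: "real \<Rightarrow> real" and \<sigma> lam0 k0 \<gamma> :: real
  assumes lam_measurable [measurable]: "lam \<in> borel_measurable borel"
    and lam_nonneg: "\<And>t. lam t \<ge> 0"
    and lam_neg: "\<And>t. t < 0 \<Longrightarrow> lam t = 0"
    and lam_le: "\<And>t. t \<ge> 0 \<Longrightarrow> lam t \<le> lam0 * exp (\<sigma> * t)"
    and \<sigma>_pos: "\<sigma> > 0" and lam0_pos: "lam0 > 0" and k0_pos: "k0 > 0" and \<gamma>_nonneg: "\<gamma> \<ge> 0"
    and laplace_lower: "\<And>x w. x > \<sigma> \<Longrightarrow>
       cmod (laplace lam (Complex x w)) \<ge> lam0 * k0 / ((x - \<sigma>)\<^sup>2 + w\<^sup>2) powr (\<gamma> / 2)"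
begin

lemma lam_abs_le: "t \<ge> 0 \<Longrightarrow> \<bar>lam t\<bar> \<le> lam0 * exp (\<sigma> * t)"
  using lam_le lam_nonneg by simp

lemma laplace_lam_nonzero: "Re z > \<sigma> \<Longrightarrow> laplace lam z \<noteq> 0"
proof -
  assume z: "Re z > \<sigma>"
  then have "(Re z - \<sigma>)\<^sup>2 + (Im z)\<^sup>2 > 0" by (simp add: add_pos_nonneg)
  then have "((Re z - \<sigma>)\<^sup>2 + (Im z)\<^sup>2) powr (\<gamma> / 2) > 0"
    by (metis less_irrefl powr_gt_zero)
  then have "0 < lam0 * k0 / ((Re z - \<sigma>)\<^sup>2 + (Im z)\<^sup>2) powr (\<gamma> / 2)"
    using lam0_pos k0_pos by (intro divide_pos_pos mult_pos_pos)
  also have "\<dots> \<le> cmod (laplace lam z)" using laplace_lower[OF z, of "Im z"] by simp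
  finally show ?thesis by auto
qed

text \<open>The bilateral Laplace transform of the kernel.\<close>

definition transfer :: "real \<Rightarrow> complex \<Rightarrow> complex" where
  "transfer b z = bilateral_laplace (psi b) z / laplace lam (- z)"

lemma deconv_kernel_eq:
  "deconv_kernel lam s b t = 1 / (2 * of_real pi) * (LINT w|lborel. transfer b (Complex s w) * exp (Complex s w * of_real t))"
  by (simp add: deconv_kernel_def transfer_def)

text \<open>For \<open>x < - \<sigma>\<close> one has \<open>0 < - x - \<sigma> < |x|\<close>,
  so the lower bound on the transform of the intensity yields growth of order at most
  \<open>\<gamma>\<close> in \<open>|z|\<close>. Decay of order \<open>\<lceil>\<gamma>\<rceil>
  + 2\<close> of the numerator leaves a quadratic decay. Later \<open>b\<close> and
  \<open>x\<close> both vary with the sample size, so \<open>D\<close> must not depend on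
  them.\<close>

lemma transfer_bound:
  "\<exists>D>0. \<forall>b\<ge>1/4. \<forall>x< - \<sigma>. \<forall>w. cmod (transfer b (Complex x w)) \<le> D * exp (\<bar>x\<bar> * (b + 1/4)) / (1 + w\<^sup>2)"
proof -
  \<comment> \<open>Two orders of decay beyond \<open>\<gamma>\<close> make the transfer
    function integrable along vertical lines.\<close>
  define q where "q = nat \<lceil>\<gamma>\<rceil>"
  have q: "\<gamma> \<le> real q" using \<gamma>_nonneg by (simp add: q_def)
  obtain C where C0: "C \<ge> 0" and C: "\<And>b z. b \<ge> 1/4 \<Longrightarrow>
      cmod z ^ Suc (Suc q) * cmod (bilateral_laplace (psi b) z) \<le> C * exp (\<bar>Re z\<bar> * (b + 1/4))"
    using bilateral_laplace_psi_decay[of "Suc q"] by blast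
  define D where "D = (C + 1) * (1 + 1 / \<sigma>\<^sup>2) * \<sigma> powr (\<gamma> - real q) / (lam0 * k0)"
  have "cmod (transfer b (Complex x w)) \<le> D * exp (\<bar>x\<bar> * (b + 1/4)) / (1 + w\<^sup>2)"
    if b: "b \<ge> 1/4" and x: "x < -\<sigma>" for b x w
  proof -
    define z where "z = Complex x w"
    define r where "r = cmod z"
    have r2: "r\<^sup>2 = x\<^sup>2 + w\<^sup>2" by (simp add: r_def z_def cmod_def)
    have "\<sigma> < \<bar>Re z\<bar>" using x by (simp add: z_def)
    also have "\<dots> \<le> r" unfolding r_def by (rule abs_Re_le_cmod)
    finally have r: "r > \<sigma>" .
    have r0: "r > 0" using r \<sigma>_pos by simp
    have low: "lam0 * k0 / r powr \<gamma> \<le> cmod (laplace lam (- z))"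
    proof -
      have "0 < (- x - \<sigma>)\<^sup>2 + (- w)\<^sup>2" using x by (simp add: add_pos_nonneg)
      then have pos: "0 < ((- x - \<sigma>)\<^sup>2 + (- w)\<^sup>2) powr (\<gamma> / 2)"
        by (metis less_irrefl powr_gt_zero)
      have "(- x - \<sigma>)\<^sup>2 \<le> x\<^sup>2"
        using x \<sigma>_pos by (subst power2_abs[of x, symmetric], intro power_mono) auto
      then have "(- x - \<sigma>)\<^sup>2 + (- w)\<^sup>2 \<le> r\<^sup>2" by (simp add: r2)
      then have "((- x - \<sigma>)\<^sup>2 + (- w)\<^sup>2) powr (\<gamma> / 2) \<le> (r\<^sup>2) powr (\<gamma> / 2)"
        using \<gamma>_nonneg by (intro powr_mono2) auto
      also have "(r\<^sup>2) powr (\<gamma> / 2) = r powr \<gamma>"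
        using r0 by (simp add: powr_powr flip: powr_numeral)
      finally have "lam0 * k0 / r powr \<gamma> \<le> lam0 * k0 / ((- x - \<sigma>)\<^sup>2 + (- w)\<^sup>2) powr (\<gamma> / 2)"
        using pos lam0_pos k0_pos r0 by (intro divide_left_mono mult_pos_pos) auto
      also have "\<dots> \<le> cmod (laplace lam (Complex (- x) (- w)))"
        using x by (intro laplace_lower) simp
      finally show ?thesis by (simp add: z_def complex_minus)
    qed
    have "r powr \<gamma> \<le> \<sigma> powr (\<gamma> - real q) * r ^ q"
    proof -
      have "(r / \<sigma>) powr \<gamma> \<le> (r / \<sigma>) powr real q"
        using q r \<sigma>_pos by (intro powr_mono) auto
      then have "r powr \<gamma> / \<sigma> powr \<gamma> \<le> r ^ q / \<sigma> powr real q"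
        using r0 \<sigma>_pos by (simp add: powr_divide powr_realpow)
      then show ?thesis using \<sigma>_pos by (simp add: powr_diff field_simps)
    qed
    then have up: "r powr \<gamma> / r ^ Suc (Suc q) \<le> \<sigma> powr (\<gamma> - real q) / r\<^sup>2"
      using r0 by (simp add: field_simps power2_eq_square)
    have inv: "1 / r\<^sup>2 \<le> (1 + 1 / \<sigma>\<^sup>2) / (1 + w\<^sup>2)"
    proof -
      have "\<sigma>\<^sup>2 \<le> x\<^sup>2" using x \<sigma>_pos by (subst power2_abs[of x, symmetric], intro power_mono) auto
      then have "1 + w\<^sup>2 \<le> (1 + 1 / \<sigma>\<^sup>2) * r\<^sup>2"
        using \<sigma>_pos by (simp add: r2 field_simps) (smt (verit) mult_nonneg_nonneg zero_le_power2)
      then show ?thesis using r0 by (simp add: field_simps add_pos_nonneg)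
    qed
    have num: "cmod (bilateral_laplace (psi b) z) \<le> C * exp (\<bar>x\<bar> * (b + 1/4)) / r ^ Suc (Suc q)"
      using C[OF b, of z] r0
      by (subst pos_le_divide_eq) (simp_all add: r_def z_def mult.commute del: power_Suc)
    have "cmod (transfer b z) = cmod (bilateral_laplace (psi b) z) / cmod (laplace lam (- z))"
      by (simp add: transfer_def norm_divide)
    also have "\<dots> \<le> (C * exp (\<bar>x\<bar> * (b + 1/4)) / r ^ Suc (Suc q)) / (lam0 * k0 / r powr \<gamma>)"
      using r0 lam0_pos k0_pos C0 by (intro frac_le num low) auto
    also have "\<dots> = C * exp (\<bar>x\<bar> * (b + 1/4)) / (lam0 * k0) * (r powr \<gamma> / r ^ Suc (Suc q))"
      by simp
    also have "\<dots> \<le> (C + 1) * exp (\<bar>x\<bar> * (b + 1/4)) / (lam0 * k0) * (\<sigma> powr (\<gamma> - real q) * ((1 + 1 / \<sigma>\<^sup>2) / (1 + w\<^sup>2)))"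
    proof (rule mult_mono)
      have "\<sigma> powr (\<gamma> - real q) * (1 / r\<^sup>2) \<le> \<sigma> powr (\<gamma> - real q) * ((1 + 1 / \<sigma>\<^sup>2) / (1 + w\<^sup>2))"
        by (intro mult_left_mono inv) simp
      with up show "r powr \<gamma> / r ^ Suc (Suc q) \<le> \<sigma> powr (\<gamma> - real q) * ((1 + 1 / \<sigma>\<^sup>2) / (1 + w\<^sup>2))"
        by simp
      show "C * exp (\<bar>x\<bar> * (b + 1/4)) / (lam0 * k0) \<le> (C + 1) * exp (\<bar>x\<bar> * (b + 1/4)) / (lam0 * k0)"
        using lam0_pos k0_pos by (intro divide_right_mono mult_right_mono) auto
    qed (use C0 lam0_pos k0_pos r0 in auto)
    also have "\<dots> = D * exp (\<bar>x\<bar> * (b + 1/4)) / (1 + w\<^sup>2)" by (simp add: D_def)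
    finally show ?thesis by (simp add: z_def)
  qed
  moreover have "D > 0" using C0 \<sigma>_pos lam0_pos k0_pos by (auto simp: D_def add_pos_pos intro!: divide_pos_pos mult_pos_pos)
  ultimately show ?thesis by blast
qed

lemma holomorphic_transfer:
  assumes "b \<ge> 0"
  shows "transfer b holomorphic_on {z. Re z < - \<sigma>}"
proof -
  have lam_hol: "(\<lambda>z. laplace lam (- z)) holomorphic_on {z. Re z < - \<sigma>}"
    by (rule holomorphic_on_compose_gen[OF holomorphic_on_minus[OF holomorphic_on_ident]
        holomorphic_laplace[OF lam_measurable lam_abs_le], unfolded o_def]) auto
  obtain K where K: "K \<ge> 0" "\<And>t. \<bar>psi0 t\<bar> \<le> K"
    using smooth_bump_bounded[of 1 0] unfolding psi0_eq_smooth_bump by blast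
  have psi0_hol: "laplace psi0 holomorphic_on A" for A
  proof -
    have "laplace psi0 holomorphic_on {z. Re z > a}" for a
    proof (rule holomorphic_laplace)
      fix t :: real assume "t \<ge> 0"
      have "\<bar>psi0 t\<bar> \<le> K * exp \<bar>a\<bar> * exp (a * t)"
      proof (cases "t < 1")
        case True
        then have "\<bar>a\<bar> * t \<le> \<bar>a\<bar>" using \<open>t \<ge> 0\<close> by (simp add: mult_left_le)
        then have "0 \<le> \<bar>a\<bar> + a * t" using \<open>t \<ge> 0\<close> by (cases "a \<ge> 0") auto
        then have "K * 1 \<le> K * exp (\<bar>a\<bar> + a * t)" by (intro mult_left_mono K(1)) auto
        then show ?thesis using K(2)[of t] by (simp add: exp_add mult.assoc)
      qed (use K(1) in \<open>simp add: psi0_outside\<close>)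
      then show "\<bar>psi0 t\<bar> \<le> K * exp \<bar>a\<bar> * exp (a * t)" .
    qed measurable
    then have "laplace psi0 field_differentiable (at z)" for z
      by (rule holomorphic_on_imp_differentiable_at[of _ "{w. Re w > Re z - 1}"])
         (auto simp: open_halfspace_Re_gt)
    then show ?thesis by (auto simp: holomorphic_on_def field_differentiable_at_within)
  qed
  have psi_hol: "(\<lambda>z. of_real c0 * laplace psi0 (z / 4) * (exp (z / 4) - exp (- z * of_real b)) / z)
      holomorphic_on {z. Re z < - \<sigma>}"
    using \<sigma>_pos
    by (intro holomorphic_intros holomorphic_on_compose_gen[OF _ psi0_hol[of UNIV], unfolded o_def]) auto
  have "(\<lambda>z. of_real c0 * laplace psi0 (z / 4) * (exp (z / 4) - exp (- z * of_real b)) / z / laplace lam (- z))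
      holomorphic_on {z. Re z < - \<sigma>}"
    by (intro holomorphic_on_divide psi_hol lam_hol) (use laplace_lam_nonzero in auto)
  then show ?thesis
  proof (rule holomorphic_transform)
    fix z assume "z \<in> {z. Re z < - \<sigma>}"
    then have "z \<noteq> 0" using \<sigma>_pos by auto
    then show "of_real c0 * laplace psi0 (z / 4) * (exp (z / 4) - exp (- z * of_real b)) / z / laplace lam (- z) = transfer b z"
      unfolding transfer_def bilateral_laplace_psi[OF assms, symmetric] by simp
  qed
qed

lemma deconv_kernel_shift_aux:
  assumes "b \<ge> 1/4" "s < s'" "s' < - \<sigma>"
  shows "deconv_kernel lam s b t = deconv_kernel lam s' b t"
proof -
  obtain D where D: "D > 0" "\<And>x w. x < -\<sigma> \<Longrightarrow> cmod (transfer b (Complex x w)) \<le> D * exp (\<bar>x\<bar> * (b + 1/4)) / (1 + w\<^sup>2)"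
    using transfer_bound assms(1) by blast
  have "(LINT w|lborel. transfer b (Complex s w) * exp (Complex s w * of_real t))
      = (LINT w|lborel. transfer b (Complex s' w) * exp (Complex s' w * of_real t))"
  proof (rule vertical_line_integral_shift[where F = "\<lambda>z. transfer b z * exp (z * of_real t)"])
    show "(\<lambda>z. transfer b z * exp (z * of_real t)) holomorphic_on {z. Re z < - \<sigma>}"
      using assms by (intro holomorphic_intros holomorphic_transfer) auto
    fix x w assume x: "s \<le> x" "x \<le> s'"
    then have xs: "\<bar>x\<bar> \<le> \<bar>s\<bar>" using assms \<sigma>_pos by auto
    have "x * t \<le> \<bar>s\<bar> * \<bar>t\<bar>"
      using mult_mono[OF xs order_refl[of "\<bar>t\<bar>"]] abs_ge_self[of "x * t"] by (simp add: abs_mult)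
    then have e: "cmod (exp (Complex x w * of_real t)) \<le> exp (\<bar>s\<bar> * \<bar>t\<bar>)" by simp
    have "cmod (transfer b (Complex x w)) \<le> D * exp (\<bar>x\<bar> * (b + 1/4)) / (1 + w\<^sup>2)"
      using x assms by (intro D(2)) auto
    also have "\<dots> \<le> D * exp (\<bar>s\<bar> * (b + 1/4)) / (1 + w\<^sup>2)"
      using D(1) xs assms(1) by (intro divide_right_mono mult_left_mono) (auto intro!: mult_right_mono)
    finally have "cmod (transfer b (Complex x w)) * cmod (exp (Complex x w * of_real t))
        \<le> (D * exp (\<bar>s\<bar> * (b + 1/4)) / (1 + w\<^sup>2)) * exp (\<bar>s\<bar> * \<bar>t\<bar>)"
      using e D(1) by (intro mult_mono) auto
    then show "cmod (transfer b (Complex x w) * exp (Complex x w * of_real t))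
        \<le> (D * exp (\<bar>s\<bar> * (b + 1/4)) * exp (\<bar>s\<bar> * \<bar>t\<bar>)) / (1 + w\<^sup>2)"
      by (simp add: norm_mult)
  qed (use assms in auto)
  then show ?thesis by (simp add: deconv_kernel_eq)
qed

text \<open>The estimator is built with one fixed line of integration, whereas the bounds below
  need lines that approach \<open>- \<sigma>\<close> as the sample grows.\<close>

lemma deconv_kernel_shift:
  assumes "b \<ge> 1/4" "s < - \<sigma>" "s' < - \<sigma>"
  shows "deconv_kernel lam s b t = deconv_kernel lam s' b t"
  using deconv_kernel_shift_aux[of b s s' t] deconv_kernel_shift_aux[of b s' s t] assms
  by (metis linorder_less_linear)

lemma continuous_transfer_line:
  assumes "b \<ge> 0" "x < - \<sigma>"
  shows "continuous_on A (\<lambda>w. transfer b (Complex x w))"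
  by (rule continuous_on_compose2[OF holomorphic_on_imp_continuous_on[OF holomorphic_transfer[OF assms(1)]]
        continuous_on_Complex_line]) (use assms in auto)

lemma integrable_transfer_line:
  assumes "b \<ge> 1/4" "x < - \<sigma>"
  shows "integrable lborel (\<lambda>w. transfer b (Complex x w))"
proof -
  obtain D where D: "D > 0" "\<And>x w. x < -\<sigma> \<Longrightarrow> cmod (transfer b (Complex x w)) \<le> D * exp (\<bar>x\<bar> * (b + 1/4)) / (1 + w\<^sup>2)"
    using transfer_bound assms(1) by blast
  show ?thesis
    by (rule vertical_line_integrable[OF continuous_transfer_line D(2)]) (use assms in auto)
qed

lemma deconv_kernel_bound:
  "\<exists>D>0. \<forall>b\<ge>1/4. \<forall>s< - \<sigma>. \<forall>\<delta>>0. \<forall>t.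
     cmod (deconv_kernel lam s b t) \<le> D * exp ((\<sigma> + \<delta>) * (b + 1/4)) * exp (- ((\<sigma> + \<delta>) * t))"
proof -
  obtain D where D: "D > 0" "\<And>b x w. b \<ge> 1/4 \<Longrightarrow> x < -\<sigma> \<Longrightarrow>
      cmod (transfer b (Complex x w)) \<le> D * exp (\<bar>x\<bar> * (b + 1/4)) / (1 + w\<^sup>2)"
    using transfer_bound by blast
  have "cmod (deconv_kernel lam s b t) \<le> D * exp ((\<sigma> + \<delta>) * (b + 1/4)) * exp (- ((\<sigma> + \<delta>) * t))"
    if b: "b \<ge> 1/4" and s: "s < -\<sigma>" and \<delta>: "\<delta> > 0" for b s \<delta> t
  proof -
    define x where "x = - (\<sigma> + \<delta>)"
    have x: "x < -\<sigma>" "\<bar>x\<bar> = \<sigma> + \<delta>" using \<delta> \<sigma>_pos by (auto simp: x_def)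
    have "cmod (LINT w|lborel. transfer b (Complex x w) * exp (Complex x w * of_real t))
        \<le> (LINT w|lborel. (D * exp ((\<sigma> + \<delta>) * (b + 1/4)) * exp (x * t)) * (1 / (1 + w\<^sup>2)))"
    proof (rule order_trans[OF integral_norm_bound integral_mono])
      have le: "cmod (transfer b (Complex x w) * exp (Complex x w * of_real t))
         \<le> (D * exp ((\<sigma> + \<delta>) * (b + 1/4)) * exp (x * t)) / (1 + w\<^sup>2)" for w
      proof -
        have "cmod (transfer b (Complex x w) * exp (Complex x w * of_real t))
           \<le> (D * exp (\<bar>x\<bar> * (b + 1/4)) / (1 + w\<^sup>2)) * exp (x * t)"
          using mult_right_mono[OF D(2)[OF b x(1), of w], of "exp (x * t)"] by (simp add: norm_mult)
        then show ?thesis by (simp add: x(2) mult_ac)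
      qed
      then show "cmod (transfer b (Complex x w) * exp (Complex x w * of_real t))
         \<le> (D * exp ((\<sigma> + \<delta>) * (b + 1/4)) * exp (x * t)) * (1 / (1 + w\<^sup>2))" for w
        by simp
      show "integrable lborel (\<lambda>w::real. (D * exp ((\<sigma> + \<delta>) * (b + 1/4)) * exp (x * t)) * (1 / (1 + w\<^sup>2)))"
        by (intro integrable_mult_right integrable_inverse_1_plus_square_UNIV)
      have "continuous_on UNIV (\<lambda>w. transfer b (Complex x w))"
        using b x by (intro continuous_transfer_line) auto
      then have "integrable lborel (\<lambda>w. transfer b (Complex x w) * exp (Complex x w * of_real t))"
        by (intro vertical_line_integrable[where F = "\<lambda>z. transfer b z * exp (z * of_real t)", OF _ le]
              continuous_intros continuous_on_Complex_line)
      then show "integrable lborel (\<lambda>w. cmod (transfer b (Complex x w) * exp (Complex x w * of_real t)))"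
        by simp
    qed
    also have "\<dots> = (D * exp ((\<sigma> + \<delta>) * (b + 1/4)) * exp (x * t)) * pi"
      by (simp only: integral_mult_right_zero lborel_integral_inverse_1_plus_square)
    finally have "cmod (deconv_kernel lam x b t) \<le> 1 / (2 * pi) * ((D * exp ((\<sigma> + \<delta>) * (b + 1/4)) * exp (x * t)) * pi)"
      unfolding deconv_kernel_eq norm_mult by (intro mult_mono) (auto simp: norm_divide)
    also have "\<dots> = D * exp ((\<sigma> + \<delta>) * (b + 1/4)) * exp (x * t) / 2" by simp
    also have "\<dots> \<le> D * exp ((\<sigma> + \<delta>) * (b + 1/4)) * exp (x * t)" using D(1) by simp
    finally show ?thesis
      using deconv_kernel_shift[OF b s x(1), of t] by (simp add: x_def algebra_simps)
  qed
  then show ?thesis using D(1) by blast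
qed

lemma deconv_kernel_measurable [measurable]:
  assumes "b \<ge> 1/4" "s < - \<sigma>"
  shows "deconv_kernel lam s b \<in> borel_measurable borel"
proof -
  have [measurable]: "(\<lambda>w. transfer b (Complex s w)) \<in> borel_measurable borel"
    using assms by (intro borel_measurable_continuous_onI continuous_transfer_line) auto
  have [measurable]: "(\<lambda>w. Complex s w) \<in> borel_measurable borel"
    by (intro borel_measurable_continuous_onI continuous_on_Complex_line)
  show ?thesis unfolding deconv_kernel_eq[abs_def] by measurable
qed

lemma bilateral_laplace_psi_inversion:
  assumes "b \<ge> 1/4" "s < 0"
  shows "(LINT w|lborel. exp (Complex s w * of_real x) * bilateral_laplace (psi b) (Complex s w)) = 2 * of_real pi * of_real (psi b x)"
proof -
  define g where "g t = complex_of_real (exp (- s * t) * psi b t)" for t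
  define h where "h w = (LINT t|lborel. exp (- (\<i> * of_real (w * t))) * g t)" for w
  have b0: "b \<ge> 0" using assms by simp
  have hw: "h w = bilateral_laplace (psi b) (Complex s w)" for w
    unfolding h_def bilateral_laplace_def g_def
  proof (intro Bochner_Integration.integral_cong refl)
    fix t :: real
    have "- Complex s w * of_real t = - (\<i> * of_real (w * t)) + of_real (- s * t)"
      by (simp add: Complex_eq algebra_simps)
    then have "exp (- Complex s w * of_real t) = exp (- (\<i> * of_real (w * t))) * of_real (exp (- s * t))"
      by (simp only: exp_add exp_of_real)
    then show "exp (- (\<i> * of_real (w * t))) * complex_of_real (exp (- s * t) * psi b t)
        = exp (- Complex s w * of_real t) * of_real (psi b t)" by simp
  qed
  have contg: "continuous_on A g" for A
    unfolding g_def by (intro continuous_intros continuous_psi b0)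
  have g_out: "t \<notin> {- 1/4..b + 1/4} \<Longrightarrow> g t = 0" for t
    using psi_outside[of t b] b0 by (auto simp: g_def)
  have intg: "integrable lborel g"
  proof -
    have "set_integrable lborel {- 1/4..b + 1/4} g"
      by (intro borel_integrable_atLeastAtMost' contg)
    then show ?thesis unfolding set_integrable_def
      by (rule Bochner_Integration.integrable_cong[OF refl, THEN iffD1, rotated])
         (use g_out in \<open>auto simp: indicator_def\<close>)
  qed
  have "bounded (g ` {- 1/4..b + 1/4})"
    by (intro compact_imp_bounded compact_continuous_image contg compact_Icc)
  then obtain B where B: "\<And>t. t \<in> {- 1/4..b + 1/4} \<Longrightarrow> cmod (g t) \<le> B"
    unfolding bounded_iff by blast
  have bdd: "cmod (g t) \<le> max B 0" for t
    using B[of t] g_out[of t] by (cases "t \<in> {- 1/4..b + 1/4}") auto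
  obtain C where C0: "C \<ge> 0" and C: "\<And>z. cmod z ^ Suc 1 * cmod (bilateral_laplace (psi b) z) \<le> C * exp (\<bar>Re z\<bar> * (b + 1/4))"
    using bilateral_laplace_psi_decay[of 1] assms(1) by blast
  have hm: "h \<in> borel_measurable borel"
  proof -
    have [measurable]: "g \<in> borel_measurable borel" by (rule borel_measurable_continuous_onI[OF contg])
    show ?thesis unfolding h_def by measurable
  qed
  have "integrable lborel h"
  proof (rule Bochner_Integration.integrable_bound)
    let ?K = "C * exp (\<bar>s\<bar> * (b + 1/4)) * (1 + 1 / s\<^sup>2)"
    show "integrable lborel (\<lambda>w::real. ?K * (1 / (1 + w\<^sup>2)))"
      by (intro integrable_mult_right integrable_inverse_1_plus_square_UNIV)
    show "AE w in lborel. norm (h w) \<le> norm (?K * (1 / (1 + w\<^sup>2)))"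
    proof (intro AE_I2)
      fix w :: real
      have pos: "s\<^sup>2 + w\<^sup>2 > 0" "1 + w\<^sup>2 > 0" using assms(2) by (auto simp: add_pos_nonneg)
      have "(s\<^sup>2 + w\<^sup>2) * cmod (h w) \<le> C * exp (\<bar>s\<bar> * (b + 1/4))"
        using C[of "Complex s w"] by (simp add: hw cmod_def power2_eq_square[symmetric])
      then have "cmod (h w) \<le> C * exp (\<bar>s\<bar> * (b + 1/4)) * (1 / (s\<^sup>2 + w\<^sup>2))"
        using pos by (simp add: field_simps)
      also have inv: "1 / (s\<^sup>2 + w\<^sup>2) \<le> (1 + 1 / s\<^sup>2) / (1 + w\<^sup>2)"
      proof -
        have "1 + w\<^sup>2 \<le> (1 + 1 / s\<^sup>2) * (s\<^sup>2 + w\<^sup>2)"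
          using assms(2) by (simp add: field_simps)
        then show ?thesis using pos by (simp add: field_simps)
      qed
      finally have "cmod (h w) \<le> C * exp (\<bar>s\<bar> * (b + 1/4)) * ((1 + 1 / s\<^sup>2) / (1 + w\<^sup>2))"
        using C0 by (simp add: mult_left_mono del: times_divide_eq_right)
      then have "cmod (h w) \<le> ?K * (1 / (1 + w\<^sup>2))" by simp
      then show "norm (h w) \<le> norm (?K * (1 / (1 + w\<^sup>2)))" by (metis abs_ge_self order_trans real_norm_def)
    qed
  qed (use hm in simp)
  from fourier_inversion[OF contg intg bdd this[unfolded h_def[abs_def]], of x]
  have "2 * of_real pi * g x = (LINT w|lborel. exp (\<i> * of_real (w * x)) * h w)" by (simp add: h_def)
  then have "exp (of_real (s * x)) * (2 * of_real pi * g x) = (LINT w|lborel. exp (of_real (s * x)) * (exp (\<i> * of_real (w * x)) * h w))"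
    by simp
  also have "\<dots> = (LINT w|lborel. exp (Complex s w * of_real x) * bilateral_laplace (psi b) (Complex s w))"
  proof (intro Bochner_Integration.integral_cong refl)
    fix w :: real
    have "Complex s w * of_real x = of_real (s * x) + \<i> * of_real (w * x)"
      by (simp add: Complex_eq algebra_simps)
    then have "exp (Complex s w * of_real x) = exp (of_real (s * x)) * exp (\<i> * of_real (w * x))"
      by (simp only: exp_add)
    then show "exp (of_real (s * x)) * (exp (\<i> * of_real (w * x)) * h w)
        = exp (Complex s w * of_real x) * bilateral_laplace (psi b) (Complex s w)"
      by (simp add: hw)
  qed
  also have "exp (of_real (s * x)) * (2 * of_real pi * g x) = 2 * of_real pi * of_real (psi b x)"
  proof -
    have "exp (complex_of_real (s * x)) * complex_of_real (exp (- s * x)) = 1"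
      by (simp add: exp_of_real[symmetric] mult_exp_exp)
    then show ?thesis by (simp add: g_def mult_ac)
  qed
  finally show ?thesis by simp
qed

text \<open>Integrating the kernel against the intensity multiplies the integrand by
  \<open>laplace lam (- z)\<close> and so cancels its denominator; the inversion integral of the
  cutoff is left.\<close>

lemma deconv_kernel_convolution:
  assumes b: "b \<ge> 1/4" and s: "s < - \<sigma>"
  shows "(LINT u|lborel. deconv_kernel lam s b (x + u) * of_real (lam u)) = of_real (psi b x)"
proof -
  let ?F = "\<lambda>w u. transfer b (Complex s w) * exp (Complex s w * of_real (x + u)) * of_real (lam u)"
  have [measurable]: "(\<lambda>w. transfer b (Complex s w)) \<in> borel_measurable borel"
    using assms by (intro borel_measurable_continuous_onI continuous_transfer_line) auto
  have [measurable]: "(\<lambda>w. Complex s w) \<in> borel_measurable borel"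
    by (intro borel_measurable_continuous_onI continuous_on_Complex_line)
  have li: "set_integrable lborel {0..} (\<lambda>u. exp (- z * of_real u) * complex_of_real (lam u))" if "Re z > \<sigma>" for z
    using set_integrable_laplace[OF lam_measurable lam_abs_le that] by blast
  have ind: "indicat_real {0..} u *\<^sub>R (v * complex_of_real (lam u)) = v * of_real (lam u)" for u v
    by (auto simp: indicator_def lam_neg)
  have li': "integrable lborel (\<lambda>u. exp (- z * of_real u) * complex_of_real (lam u))" if "Re z > \<sigma>" for z
    using li[OF that] unfolding set_integrable_def ind .
  have laplace_eq: "laplace lam z = (LINT u|lborel. exp (- z * of_real u) * complex_of_real (lam u))" for z
    unfolding laplace_def set_lebesgue_integral_def ind ..
  have split: "?F w u = (transfer b (Complex s w) * exp (Complex s w * of_real x)) * (exp (- (- Complex s w) * of_real u) * of_real (lam u))" for w u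
    by (simp add: distrib_left exp_add)
  have pint: "integrable (lborel \<Otimes>\<^sub>M lborel) (\<lambda>(w, u). ?F w u)"
  proof (rule lborel_pair.Fubini_integrable)
    show "(\<lambda>(w, u). ?F w u) \<in> borel_measurable (lborel \<Otimes>\<^sub>M lborel)" by measurable
    have "(\<lambda>w. LINT u|lborel. norm (?F w u))
       = (\<lambda>w. cmod (transfer b (Complex s w)) * (LINT u|lborel. exp (s * (x + u)) * lam u))"
      by (auto simp: norm_mult lam_nonneg mult.assoc)
    then show "integrable lborel (\<lambda>w. LINT u|lborel. norm (case (w, u) of (w, u) \<Rightarrow> ?F w u))"
      using integrable_transfer_line[OF b s] by simp
    show "AE w in lborel. integrable lborel (\<lambda>u. case (w, u) of (w, u) \<Rightarrow> ?F w u)"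
      unfolding split prod.case using s by (intro AE_I2 integrable_mult_right li') simp
  qed
  have "(LINT u|lborel. deconv_kernel lam s b (x + u) * of_real (lam u))
     = (LINT u|lborel. 1 / (2 * of_real pi) * (LINT w|lborel. ?F w u))"
    unfolding deconv_kernel_eq by (simp only: mult.assoc integral_mult_left_zero[symmetric])
  also have "\<dots> = 1 / (2 * of_real pi) * (LINT u|lborel. LINT w|lborel. ?F w u)"
    by (rule integral_mult_right_zero)
  also have "(LINT u|lborel. LINT w|lborel. ?F w u) = (LINT w|lborel. LINT u|lborel. ?F w u)"
    by (rule lborel_pair.Fubini_integral[OF pint])
  also have "\<dots> = (LINT w|lborel. exp (Complex s w * of_real x) * bilateral_laplace (psi b) (Complex s w))"
  proof (intro Bochner_Integration.integral_cong refl)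
    fix w
    have "laplace lam (- Complex s w) \<noteq> 0" using s by (intro laplace_lam_nonzero) simp
    then show "(LINT u|lborel. ?F w u) = exp (Complex s w * of_real x) * bilateral_laplace (psi b) (Complex s w)"
      unfolding split by (simp only: integral_mult_right_zero laplace_eq[symmetric]) (simp add: transfer_def)
  qed
  also have "\<dots> = 2 * of_real pi * of_real (psi b x)"
    using s \<sigma>_pos by (intro bilateral_laplace_psi_inversion b) simp
  finally show ?thesis by simp
qed

end

section \<open>The bias\<close>

text \<open>Here \<open>H\<close> plays the role of \<open>1 - G\<close> on \<open>[0,
  \<infinity>)\<close>, and \<open>M\<close> bounds its two moments as in the service
  class.\<close>

locale queue_mean = arrival_intensity +
  fixes H :: "real \<Rightarrow> real" and M :: real
  assumes H_measurable [measurable]: "H \<in> borel_measurable borel"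
    and H_nonneg: "\<And>y. H y \<ge> 0" and H_neg: "\<And>y. y < 0 \<Longrightarrow> H y = 0"
    and H_integrable: "integrable lborel H" and H_integral_le: "(LINT y|lborel. H y) \<le> M"
    and H_moment_integrable: "integrable lborel (\<lambda>y. y * H y)"
    and H_moment_le: "(LINT y|lborel. y * H y) \<le> M / 2"
begin

lemma M_nonneg: "M \<ge> 0"
  by (meson Bochner_Integration.integral_nonneg H_integral_le H_nonneg order_trans)

definition mean_queue :: "real \<Rightarrow> real" where
  "mean_queue t = (LINT x|lborel. lam x * H (t - x))"

lemma mean_queue_measurable [measurable]: "mean_queue \<in> borel_measurable borel"
  unfolding mean_queue_def by measurable

lemma H_reflected: "integrable lborel (\<lambda>x. H (t - x))" "(LINT x|lborel. H (t - x)) = (LINT y|lborel. H y)"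
  using lborel_integrable_real_affine[OF H_integrable, of "-1" t] lborel_integral_real_affine[of "-1" H t]
  by simp_all

lemma mean_queue_integrand_le: "lam x * H (t - x) \<le> lam0 * exp (\<sigma> * t) * H (t - x)"
proof -
  consider "x < 0" | "x > t" | "0 \<le> x" "x \<le> t" by linarith
  then show ?thesis
  proof cases
    case 3
    then have "lam x \<le> lam0 * exp (\<sigma> * x)" by (intro lam_le)
    also have "\<dots> \<le> lam0 * exp (\<sigma> * t)" using 3 lam0_pos \<sigma>_pos by (intro mult_left_mono) auto
    finally show ?thesis using H_nonneg by (intro mult_right_mono) auto
  qed (use lam0_pos in \<open>auto simp: lam_neg H_neg H_nonneg\<close>)
qed

lemma mean_queue_integrable: "integrable lborel (\<lambda>x. lam x * H (t - x))"
proof (rule Bochner_Integration.integrable_bound)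
  show "integrable lborel (\<lambda>x. lam0 * exp (\<sigma> * t) * H (t - x))"
    by (intro integrable_mult_right H_reflected)
  show "AE x in lborel. norm (lam x * H (t - x)) \<le> norm (lam0 * exp (\<sigma> * t) * H (t - x))"
    using mean_queue_integrand_le[of _ t] lam0_pos
    by (intro AE_I2) (simp add: abs_mult lam_nonneg H_nonneg)
qed measurable

lemma mean_queue_nonneg: "mean_queue t \<ge> 0"
  unfolding mean_queue_def by (intro Bochner_Integration.integral_nonneg) (simp add: lam_nonneg H_nonneg)

lemma mean_queue_le: "mean_queue t \<le> lam0 * M * exp (\<sigma> * t)"
proof -
  have "mean_queue t \<le> (LINT x|lborel. lam0 * exp (\<sigma> * t) * H (t - x))"
    unfolding mean_queue_def
    by (intro integral_mono mean_queue_integrable integrable_mult_right H_reflected mean_queue_integrand_le)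
  also have "\<dots> = lam0 * exp (\<sigma> * t) * (LINT y|lborel. H y)" by (simp add: H_reflected)
  also have "\<dots> \<le> lam0 * exp (\<sigma> * t) * M"
    using lam0_pos by (intro mult_left_mono H_integral_le) auto
  finally show ?thesis by (simp add: mult_ac)
qed

lemma mean_queue_neg: "t < 0 \<Longrightarrow> mean_queue t = 0"
proof -
  assume "t < 0"
  then have "(\<lambda>x. lam x * H (t - x)) = (\<lambda>x. 0)" by (intro ext) (metis H_neg add.commute diff_add_cancel lam_neg less_diff_eq linorder_less_linear mult_eq_0_iff diff_less_0_iff_less order_less_trans)
  then show ?thesis by (simp add: mean_queue_def)
qed

lemma mean_queue_alt: "mean_queue t = (LINT y|lborel. lam (t - y) * H y)"
  unfolding mean_queue_def
  using lborel_integral_real_affine[of "-1" "\<lambda>x. lam x * H (t - x)" t] by simp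

lemma kernel_times_mean_queue:
  assumes b: "b \<ge> 1/4" and s: "s < - \<sigma>" and \<delta>: "\<delta> > 0" and K0: "K \<ge> 0"
    and K: "\<And>t. cmod (deconv_kernel lam s b t) \<le> K * exp (- ((\<sigma> + \<delta>) * t))"
  shows kernel_times_mean_queue_bound: "cmod (deconv_kernel lam s b t * of_real (mean_queue t))
          \<le> indicator {0..} t * (K * lam0 * M * exp (- (\<delta> * t)))"
    and kernel_times_mean_queue_integrable: "integrable lborel (\<lambda>t. deconv_kernel lam s b t * of_real (mean_queue t))"
proof -
  note [measurable] = deconv_kernel_measurable[OF b s]
  show bnd: "cmod (deconv_kernel lam s b t * of_real (mean_queue t))
          \<le> indicator {0..} t * (K * lam0 * M * exp (- (\<delta> * t)))" for t
  proof (cases "t < 0")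
    case False
    have "cmod (deconv_kernel lam s b t * of_real (mean_queue t)) \<le>
       (K * exp (- ((\<sigma> + \<delta>) * t))) * (lam0 * M * exp (\<sigma> * t))"
      using K[of t] mean_queue_le[of t] mean_queue_nonneg[of t] K0
      by (simp add: norm_mult) (intro mult_mono, auto)
    also have "\<dots> = K * lam0 * M * (exp (- ((\<sigma> + \<delta>) * t)) * exp (\<sigma> * t))" by simp
    also have "exp (- ((\<sigma> + \<delta>) * t)) * exp (\<sigma> * t) = exp (- (\<delta> * t))"
      by (simp add: mult_exp_exp algebra_simps)
    finally show ?thesis using False by simp
  qed (simp add: mean_queue_neg)
  show "integrable lborel (\<lambda>t. deconv_kernel lam s b t * of_real (mean_queue t))"
  proof (rule Bochner_Integration.integrable_bound)
    show "integrable lborel (\<lambda>t. K * lam0 * M * (indicator {0..} t *\<^sub>R exp (- (\<delta> * t))))"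
      using set_integral_exp_tail(1)[OF \<delta>, of 0] unfolding set_integrable_def by (rule integrable_mult_right)
    show "AE t in lborel. cmod (deconv_kernel lam s b t * of_real (mean_queue t)) \<le>
       norm (K * lam0 * M * (indicator {0..} t *\<^sub>R exp (- (\<delta> * t))))"
    proof (intro AE_I2)
      fix t
      have "cmod (deconv_kernel lam s b t * of_real (mean_queue t)) \<le> K * lam0 * M * (indicator {0..} t *\<^sub>R exp (- (\<delta> * t)))"
        using bnd[of t] by (simp add: mult_ac)
      then show "cmod (deconv_kernel lam s b t * of_real (mean_queue t)) \<le>
       norm (K * lam0 * M * (indicator {0..} t *\<^sub>R exp (- (\<delta> * t))))"
        unfolding real_norm_def by (rule order_trans[OF _ abs_ge_self])
    qed
  qed measurable
qed

lemma integral_kernel_mean_queue: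
  assumes b: "b \<ge> 1/4" and s: "s < - \<sigma>"
  shows "(LINT t|lborel. deconv_kernel lam s b t * of_real (mean_queue t)) = of_real (LINT y|lborel. psi b y * H y)"
proof -
  let ?J = "deconv_kernel lam s b"
  note [measurable] = deconv_kernel_measurable[OF b s]
  obtain D where D: "D > 0" "\<And>\<delta> t. \<delta> > 0 \<Longrightarrow>
      cmod (?J t) \<le> D * exp ((\<sigma> + \<delta>) * (b + 1/4)) * exp (- ((\<sigma> + \<delta>) * t))"
    using deconv_kernel_bound b s by blast
  define K where "K = D * exp ((\<sigma> + 1) * (b + 1/4))"
  have K0: "K \<ge> 0" using D(1) by (simp add: K_def)
  have K: "cmod (?J t) \<le> K * exp (- ((\<sigma> + 1) * t))" for t using D(2)[of 1 t] by (simp add: K_def)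
  have bnd: "cmod (?J t * of_real (lam (t - y))) \<le> K * lam0 * (indicator {0..} t *\<^sub>R exp (- (1 * t)))"
    if y: "y \<ge> 0" for t y
  proof (cases "t < y")
    case False
    have "cmod (?J t * of_real (lam (t - y))) \<le> (K * exp (- ((\<sigma> + 1) * t))) * (lam0 * exp (\<sigma> * (t - y)))"
      using K[of t] lam_le[of "t - y"] lam_nonneg K0 False
      by (simp add: norm_mult) (intro mult_mono, auto)
    also have "\<dots> = K * lam0 * (exp (- ((\<sigma> + 1) * t)) * exp (\<sigma> * (t - y)))" by simp
    also have "exp (- ((\<sigma> + 1) * t)) * exp (\<sigma> * (t - y)) \<le> exp (- (1 * t))"
      using y \<sigma>_pos by (simp add: mult_exp_exp algebra_simps)
    finally show ?thesis using False y K0 lam0_pos by (simp add: mult_left_mono)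
  qed (use K0 lam0_pos in \<open>simp add: lam_neg\<close>)
  have int_exp: "integrable lborel (\<lambda>t. K * lam0 * (indicator {0..} t *\<^sub>R exp (- (1 * t))))"
    using set_integral_exp_tail(1)[of 1 0] unfolding set_integrable_def by (intro integrable_mult_right) simp
  have intt: "integrable lborel (\<lambda>t. ?J t * of_real (lam (t - y)))" if "y \<ge> 0" for y
    by (rule Bochner_Integration.integrable_bound[OF int_exp])
       (use bnd[OF that] in \<open>auto intro!: AE_I2 order_trans[OF _ abs_ge_self]\<close>)
  let ?F = "\<lambda>y t. ?J t * of_real (lam (t - y)) * of_real (H y)"
  have pint: "integrable (lborel \<Otimes>\<^sub>M lborel) (\<lambda>(y, t). ?F y t)"
  proof (rule lborel_pair.Fubini_integrable)
    show "(\<lambda>(y, t). ?F y t) \<in> borel_measurable (lborel \<Otimes>\<^sub>M lborel)" by measurable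
    show "AE y in lborel. integrable lborel (\<lambda>t. case (y, t) of (y, t) \<Rightarrow> ?F y t)"
    proof (intro AE_I2)
      fix y show "integrable lborel (\<lambda>t. case (y, t) of (y, t) \<Rightarrow> ?F y t)"
        using intt[of y] by (cases "y < 0") (auto simp: H_neg)
    qed
    show "integrable lborel (\<lambda>y. LINT t|lborel. norm (case (y, t) of (y, t) \<Rightarrow> ?F y t))"
    proof (rule Bochner_Integration.integrable_bound)
      show "integrable lborel (\<lambda>y. (K * lam0) * H y)" by (intro integrable_mult_right H_integrable)
      show "AE y in lborel. norm (LINT t|lborel. norm (case (y, t) of (y, t) \<Rightarrow> ?F y t)) \<le> norm (K * lam0 * H y)"
      proof (intro AE_I2)
        fix y
        show "norm (LINT t|lborel. norm (case (y, t) of (y, t) \<Rightarrow> ?F y t)) \<le> norm (K * lam0 * H y)"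
        proof (cases "y < 0")
          case False
          have "(LINT t|lborel. norm (?J t * of_real (lam (t - y)))) \<le> (LINT t|lborel. K * lam0 * (indicator {0..} t *\<^sub>R exp (- (1 * t))))"
            using False by (intro integral_mono integrable_norm intt int_exp bnd) auto
          also have "\<dots> = K * lam0"
            using set_integral_exp_tail(2)[of 1 0] by (simp add: set_lebesgue_integral_def)
          finally have 1: "(LINT t|lborel. norm (?J t * of_real (lam (t - y)))) \<le> K * lam0" .
          have "(LINT t|lborel. norm (?F y t)) = (LINT t|lborel. norm (?J t * of_real (lam (t - y)))) * H y"
            by (simp add: norm_mult H_nonneg)
          also have "\<dots> \<le> K * lam0 * H y" using 1 H_nonneg by (rule mult_right_mono)
          finally show ?thesis using K0 lam0_pos H_nonneg[of y]
            by (simp add: Bochner_Integration.integral_nonneg)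
        qed (simp add: H_neg)
      qed
    qed measurable
  qed
  have "(LINT t|lborel. ?J t * of_real (mean_queue t)) = (LINT t|lborel. LINT y|lborel. ?F y t)"
  proof (intro Bochner_Integration.integral_cong refl)
    fix t
    have "(\<lambda>y. ?F y t) = (\<lambda>y. ?J t * complex_of_real (lam (t - y) * H y))" by (simp add: fun_eq_iff)
    then show "?J t * of_real (mean_queue t) = (LINT y|lborel. ?F y t)"
      by (simp only: integral_mult_right_zero integral_complex_of_real mean_queue_alt)
  qed
  also have "\<dots> = (LINT y|lborel. LINT t|lborel. ?F y t)"
    by (rule lborel_pair.Fubini_integral[OF pint])
  also have "\<dots> = (LINT y|lborel. complex_of_real (psi b y * H y))"
  proof (intro Bochner_Integration.integral_cong refl)
    fix y
    have "(LINT t|lborel. ?J t * of_real (lam (t - y))) = (LINT u|lborel. ?J (y + u) * of_real (lam u))"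
      using lborel_integral_real_affine[of 1 "\<lambda>t. ?J t * of_real (lam (t - y))" y] by simp
    also have "\<dots> = of_real (psi b y)" by (rule deconv_kernel_convolution[OF b s])
    finally show "(LINT t|lborel. ?F y t) = complex_of_real (psi b y * H y)" by simp
  qed
  also have "\<dots> = of_real (LINT y|lborel. psi b y * H y)" by (rule integral_complex_of_real)
  finally show ?thesis .
qed

text \<open>The first term is the price of the cutoff: \<open>1 - \<psi>\<^sub>b\<close>
  vanishes on \<open>[0, b]\<close> and is at most \<open>y / b\<close> beyond, so the moment of
  \<open>H\<close> bounds it. The second term is the price of observing only up to
  \<open>T\<close>.\<close>

lemma bias_bound:
  assumes b: "b \<ge> 1/4" and s: "s < - \<sigma>" and \<delta>: "\<delta> > 0" and K0: "K \<ge> 0"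
    and K: "\<And>t. cmod (deconv_kernel lam s b t) \<le> K * exp (- ((\<sigma> + \<delta>) * t))"
  shows "cmod ((LINT t:{0..T}|lborel. deconv_kernel lam s b t * of_real (mean_queue t)) - of_real (LINT y|lborel. H y))
     \<le> M / (2 * b) + K * lam0 * M * exp (- (\<delta> * T)) / \<delta>"
proof -
  let ?J = "deconv_kernel lam s b"
  let ?f = "\<lambda>t. ?J t * of_real (mean_queue t)"
  have psim [measurable]: "psi b \<in> borel_measurable borel"
    using b by (intro borel_measurable_continuous_onI continuous_psi) auto
  note fint = kernel_times_mean_queue_integrable[OF b s \<delta> K0 K]
  note fbnd = kernel_times_mean_queue_bound[OF b s \<delta> K0 K]
  have fint': "integrable lborel (\<lambda>t. indicator {0..T} t *\<^sub>R ?f t)"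
    using fint by (rule integrable_mult_indicator[rotated]) simp
  have "cmod ((LINT t|lborel. indicator {0..T} t *\<^sub>R ?f t) - (LINT t|lborel. ?f t))
      = cmod (LINT t|lborel. indicator {0..T} t *\<^sub>R ?f t - ?f t)"
    by (simp only: Bochner_Integration.integral_diff[OF fint' fint])
  also have "\<dots> \<le> (LINT t|lborel. K * lam0 * M * (indicator {T..} t *\<^sub>R exp (- (\<delta> * t))))"
  proof (rule order_trans[OF integral_norm_bound integral_mono])
    show "integrable lborel (\<lambda>t. norm (indicator {0..T} t *\<^sub>R ?f t - ?f t))"
      using fint' fint by (intro integrable_norm Bochner_Integration.integrable_diff)
    show "integrable lborel (\<lambda>t. K * lam0 * M * (indicator {T..} t *\<^sub>R exp (- (\<delta> * t))))"
      using set_integral_exp_tail(1)[OF \<delta>, of T] unfolding set_integrable_def by (rule integrable_mult_right)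
    fix t :: real
    have nn: "0 \<le> K * lam0 * M * exp (- (\<delta> * t))" using K0 lam0_pos M_nonneg by simp
    consider "t < 0" | "t \<in> {0..T}" | "t > T" "t \<ge> 0" by fastforce
    then show "cmod (indicator {0..T} t *\<^sub>R ?f t - ?f t) \<le> K * lam0 * M * (indicator {T..} t *\<^sub>R exp (- (\<delta> * t)))"
    proof cases
      case 1
      then show ?thesis using nn by (simp add: mean_queue_neg indicator_def)
    next
      case 2
      then show ?thesis using nn by (simp add: indicator_def)
    next
      case 3
      then show ?thesis using fbnd[of t] by (simp add: indicator_def)
    qed
  qed
  also have "\<dots> = K * lam0 * M * exp (- (\<delta> * T)) / \<delta>"
    using set_integral_exp_tail(2)[OF \<delta>, of T] by (simp add: set_lebesgue_integral_def)
  finally have tail: "cmod ((LINT t:{0..T}|lborel. ?f t) - of_real (LINT y|lborel. psi b y * H y))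
      \<le> K * lam0 * M * exp (- (\<delta> * T)) / \<delta>"
    unfolding set_lebesgue_integral_def integral_kernel_mean_queue[OF b s] .
  have psiH: "integrable lborel (\<lambda>y. psi b y * H y)"
    by (rule Bochner_Integration.integrable_bound[OF H_integrable])
       (use psi_bounds[of b] b H_nonneg in \<open>auto intro!: AE_I2 mult_left_le_one_le simp: abs_mult\<close>)
  have "\<bar>(LINT y|lborel. psi b y * H y) - (LINT y|lborel. H y)\<bar> = \<bar>LINT y|lborel. psi b y * H y - H y\<bar>"
    by (simp add: psiH H_integrable)
  also have "\<dots> \<le> (LINT y|lborel. (1 / b) * (y * H y))"
    unfolding real_norm_def[symmetric]
  proof (rule order_trans[OF integral_norm_bound integral_mono])
    show "integrable lborel (\<lambda>y. norm (psi b y * H y - H y))"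
      by (intro integrable_norm Bochner_Integration.integrable_diff psiH H_integrable)
    show "integrable lborel (\<lambda>y. (1 / b) * (y * H y))" by (intro integrable_mult_right H_moment_integrable)
    fix y
    consider "y < 0" | "0 \<le> y" "y \<le> b" | "y > b" by linarith
    then show "norm (psi b y * H y - H y) \<le> (1 / b) * (y * H y)"
    proof cases
      case 2
      then show ?thesis using b H_nonneg by (simp add: psi_eq_1)
    next
      case 3
      have "psi b y * H y - H y = - ((1 - psi b y) * H y)" by (simp add: algebra_simps)
      then have "\<bar>psi b y * H y - H y\<bar> = (1 - psi b y) * H y"
        using psi_bounds[of b y] b H_nonneg[of y] by simp
      also have "\<dots> \<le> (y / b) * H y"
        proof (rule mult_right_mono)
        have "1 - psi b y \<le> 1" using psi_bounds[of b y] b by simp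
        also have "1 \<le> y / b" using b 3 by simp
        finally show "1 - psi b y \<le> y / b" .
      qed (rule H_nonneg)
      finally show ?thesis by simp
    qed (simp add: H_neg)
  qed
  also have "\<dots> = (1 / b) * (LINT y|lborel. y * H y)" by simp
  also have "\<dots> \<le> (1 / b) * (M / 2)" using b by (intro mult_left_mono H_moment_le) auto
  also have "\<dots> = M / (2 * b)" by simp
  finally have main: "cmod (of_real (LINT y|lborel. psi b y * H y) - of_real (LINT y|lborel. H y)) \<le> M / (2 * b)"
    by (simp flip: of_real_diff)
  show ?thesis using norm_triangle_mono[OF tail main] by (simp add: add.commute)
qed

end

section \<open>Poisson moments\<close>

lemma poisson_weights_sums:
  fixes L :: real
  shows "(\<lambda>k. L ^ k / fact k * exp (- L)) sums 1"
    and "(\<lambda>k. real k * (L ^ k / fact k * exp (- L))) sums L"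
    and "(\<lambda>k. real (k * (k - 1)) * (L ^ k / fact k * exp (- L))) sums L\<^sup>2"
proof -
  show s0: "(\<lambda>k. L ^ k / fact k * exp (- L)) sums 1"
    using sums_mult2[OF exp_converges[of L], of "exp (- L)"]
    by (simp add: scaleR_conv_of_real divide_inverse mult_ac flip: exp_add)
  have "(\<lambda>k. L * (L ^ k / fact k * exp (- L))) sums (L * 1)" by (rule sums_mult[OF s0])
  moreover have "real (Suc k) * (L ^ Suc k / fact (Suc k) * exp (- L)) = L * (L ^ k / fact k * exp (- L))" for k
    by (simp add: field_simps del: of_nat_Suc)
  ultimately have "(\<lambda>k. real (Suc k) * (L ^ Suc k / fact (Suc k) * exp (- L))) sums L" by (simp only: mult_1_right)
  then show s1: "(\<lambda>k. real k * (L ^ k / fact k * exp (- L))) sums L"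
    by (subst (asm) sums_Suc_iff) simp
  have "(\<lambda>k. L * (real k * (L ^ k / fact k * exp (- L)))) sums (L * L)" by (rule sums_mult[OF s1])
  moreover have "real (Suc k * (Suc k - 1)) * (L ^ Suc k / fact (Suc k) * exp (- L))
      = L * (real k * (L ^ k / fact k * exp (- L)))" for k
    by (simp only: diff_Suc_1 of_nat_mult fact_Suc power_Suc) (simp add: field_simps del: of_nat_Suc)
  ultimately have "(\<lambda>k. real (Suc k * (Suc k - 1)) * (L ^ Suc k / fact (Suc k) * exp (- L))) sums (L * L)" by (simp only:)
  then show "(\<lambda>k. real (k * (k - 1)) * (L ^ k / fact k * exp (- L))) sums L\<^sup>2"
    by (subst (asm) sums_Suc_iff) (simp add: power2_eq_square)
qed

lemma (in prob_space) nn_integral_poisson_distributed: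
  assumes [measurable]: "N \<in> measurable M (count_space UNIV)"
    and p: "\<And>k. prob {\<omega> \<in> space M. N \<omega> = k} = L ^ k / fact k * exp (- L)"
    and L: "L \<ge> 0" and f: "\<And>k. f k \<ge> 0" and s: "(\<lambda>k. f k * (L ^ k / fact k * exp (- L))) sums S"
  shows "(\<integral>\<^sup>+\<omega>. ennreal (f (N \<omega>)) \<partial>M) = ennreal S"
proof -
  have "(\<integral>\<^sup>+\<omega>. ennreal (f (N \<omega>)) \<partial>M) = (\<integral>\<^sup>+\<omega>. (\<Sum>k. ennreal (f k) * indicator {\<omega> \<in> space M. N \<omega> = k} \<omega>) \<partial>M)"
  proof (intro nn_integral_cong)
    fix \<omega> assume w: "\<omega> \<in> space M"
    have "(\<Sum>k. ennreal (f k) * indicator {\<omega> \<in> space M. N \<omega> = k} \<omega>) = (\<Sum>k\<in>{N \<omega>}. ennreal (f k) * indicator {\<omega> \<in> space M. N \<omega> = k} \<omega>)"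
      using w by (intro suminf_finite) auto
    then show "ennreal (f (N \<omega>)) = (\<Sum>k. ennreal (f k) * indicator {\<omega> \<in> space M. N \<omega> = k} \<omega>)"
      using w by simp
  qed
  also have "\<dots> = (\<Sum>k. \<integral>\<^sup>+\<omega>. ennreal (f k) * indicator {\<omega> \<in> space M. N \<omega> = k} \<omega> \<partial>M)"
    by (intro nn_integral_suminf) measurable
  also have "\<dots> = (\<Sum>k. ennreal (f k * (L ^ k / fact k * exp (- L))))"
  proof (intro suminf_cong)
    fix k
    have "(\<integral>\<^sup>+\<omega>. ennreal (f k) * indicator {\<omega> \<in> space M. N \<omega> = k} \<omega> \<partial>M) = ennreal (f k) * emeasure M {\<omega> \<in> space M. N \<omega> = k}"
      by (intro nn_integral_cmult_indicator) measurable
    then show "(\<integral>\<^sup>+\<omega>. ennreal (f k) * indicator {\<omega> \<in> space M. N \<omega> = k} \<omega> \<partial>M) = ennreal (f k * (L ^ k / fact k * exp (- L)))"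
      by (simp only: emeasure_eq_measure p ennreal_mult'[OF f])
  qed
  also have "\<dots> = ennreal S"
    using s L f by (intro suminf_ennreal_eq) auto
  finally show ?thesis .
qed

lemma nn_integral_count_space_indicator_finite:
  "finite A \<Longrightarrow> (\<integral>\<^sup>+x. indicator A x \<partial>count_space UNIV) = ennreal (real (card A))"
  by (simp add: ennreal_of_nat_eq_real_of_nat)

lemma card_offdiagonal:
  assumes "finite A"
  shows "card {(j, k). j \<noteq> k \<and> j \<in> A \<and> k \<in> A} = card A * (card A - 1)"
proof -
  have "{(j, k). j \<noteq> k \<and> j \<in> A \<and> k \<in> A} = A \<times> A - (\<lambda>j. (j, j)) ` A" by auto
  also have "card \<dots> = card (A \<times> A) - card ((\<lambda>j. (j, j)) ` A)"
    using assms by (intro card_Diff_subset) auto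
  also have "card ((\<lambda>j. (j, j)) ` A) = card A" by (rule card_image) (auto simp: inj_on_def)
  finally show ?thesis by (simp add: card_cartesian_product diff_mult_distrib2)
qed

section \<open>First and second factorial moment measures\<close>

locale poisson_process_with_rate = poisson_process +
  assumes rate_measurable [measurable]: "lam \<in> borel_measurable borel"
    and rate_nonneg: "\<And>t. lam t \<ge> 0"
    and rate_locally_integrable: "\<And>R. set_integrable lborel {0..R} lam"
begin

declare arrival_measurable [measurable]

text \<open>The intensity measure restricted to \<open>[0, t]\<close>, where it is finite; only
  arrivals up to \<open>t\<close> can be present at time \<open>t\<close>.\<close>

definition window :: "real \<Rightarrow> real measure" where
  "window t = density lborel (\<lambda>x. ennreal (indicator {0..t} x * lam x))"

lemma sets_window [simp, measurable_cong]: "sets (window t) = sets borel" by (simp add: window_def)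
lemma space_window [simp]: "space (window t) = UNIV" by (simp add: window_def)

lemma rate_integrable_on:
  assumes "B \<in> sets borel" "B \<subseteq> {0..t}"
  shows "set_integrable lborel B lam"
  by (rule set_integrable_subset[OF rate_locally_integrable[of t]]) (use assms in auto)

lemma rate_integral_nonneg: "(LINT x:B|lborel. lam x) \<ge> 0"
  unfolding set_lebesgue_integral_def by (intro Bochner_Integration.integral_nonneg) (simp add: rate_nonneg)

lemma emeasure_window:
  assumes "B \<in> sets borel"
  shows "emeasure (window t) B = ennreal (LINT x:B \<inter> {0..t}|lborel. lam x)"
proof -
  have i: "set_integrable lborel (B \<inter> {0..t}) lam" using assms by (intro rate_integrable_on[of _ t]) auto
  have "emeasure (window t) B = (\<integral>\<^sup>+x. ennreal (indicator {0..t} x * lam x) * indicator B x \<partial>lborel)"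
    using assms unfolding window_def by (intro emeasure_density) auto
  also have "\<dots> = (\<integral>\<^sup>+x. ennreal (indicator (B \<inter> {0..t}) x *\<^sub>R lam x) \<partial>lborel)"
    by (intro nn_integral_cong) (auto simp: indicator_def)
  also have "\<dots> = ennreal (LINT x:B \<inter> {0..t}|lborel. lam x)"
    using i unfolding set_integrable_def set_lebesgue_integral_def
    by (intro nn_integral_eq_integral) (auto simp: rate_nonneg)
  finally show ?thesis .
qed

lemma nn_integral_window:
  "f \<in> borel_measurable borel \<Longrightarrow> (\<integral>\<^sup>+x. f x \<partial>window t) = (\<integral>\<^sup>+x. ennreal (indicator {0..t} x * lam x) * f x \<partial>lborel)"
  unfolding window_def by (intro nn_integral_density) auto

lemma finite_measure_window: "finite_measure (window t)"
  by (rule finite_measureI) (simp add: emeasure_window)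

lemma finite_arrivals_in: "AE \<omega> in P. \<forall>B. B \<subseteq> {0..t} \<longrightarrow> finite {j. \<tau> j \<omega> \<in> B}"
  using locally_finite
proof eventually_elim
  case (elim \<omega>)
  show ?case
  proof (intro allI impI)
    fix B :: "real set" assume "B \<subseteq> {0..t}"
    then have "{j. \<tau> j \<omega> \<in> B} \<subseteq> {j. \<tau> j \<omega> \<le> t}" by auto
    then show "finite {j. \<tau> j \<omega> \<in> B}" using elim finite_subset by blast
  qed
qed

lemma count_measurable:
  assumes "B \<in> sets borel" "B \<subseteq> {0..t}"
  shows "(\<lambda>\<omega>. card {j. \<tau> j \<omega> \<in> B}) \<in> measurable P (count_space UNIV)"
proof -
  have "bounded B" using assms(2) by (intro bounded_subset[OF compact_imp_bounded[OF compact_Icc[of 0 t]]])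
  then have "indep_vars (\<lambda>_. count_space UNIV) (\<lambda>i \<omega>. card {j. \<tau> j \<omega> \<in> B}) {0::nat}"
    using assms by (intro count_indep[where B = "\<lambda>_. B" and I = "{0::nat}"]) (auto simp: disjoint_family_on_def)
  then show ?thesis by (simp add: indep_vars_def)
qed

lemma count_moments:
  assumes "B \<in> sets borel" "B \<subseteq> {0..t}"
  shows "(\<integral>\<^sup>+\<omega>. ennreal (real (card {j. \<tau> j \<omega> \<in> B})) \<partial>P) = ennreal (LINT x:B|lborel. lam x)"
    and "(\<integral>\<^sup>+\<omega>. ennreal (real (card {j. \<tau> j \<omega> \<in> B} * (card {j. \<tau> j \<omega> \<in> B} - 1))) \<partial>P)
      = ennreal ((LINT x:B|lborel. lam x)\<^sup>2)"
proof -
  have bd: "bounded B" using assms(2) by (intro bounded_subset[OF compact_imp_bounded[OF compact_Icc[of 0 t]]])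
  have "B \<subseteq> {0..}" using assms(2) by auto
  note c = count_poisson[OF assms(1) bd this]
  show "(\<integral>\<^sup>+\<omega>. ennreal (real (card {j. \<tau> j \<omega> \<in> B})) \<partial>P) = ennreal (LINT x:B|lborel. lam x)"
    by (rule nn_integral_poisson_distributed[OF count_measurable[OF assms] c rate_integral_nonneg _ poisson_weights_sums(2)]) simp
  show "(\<integral>\<^sup>+\<omega>. ennreal (real (card {j. \<tau> j \<omega> \<in> B} * (card {j. \<tau> j \<omega> \<in> B} - 1))) \<partial>P)
      = ennreal ((LINT x:B|lborel. lam x)\<^sup>2)"
    by (rule nn_integral_poisson_distributed[OF count_measurable[OF assms] c rate_integral_nonneg _ poisson_weights_sums(3)]) simp
qed

lemma count_product_moment:
  assumes "A \<in> sets borel" "A \<subseteq> {0..t}" "B \<in> sets borel" "B \<subseteq> {0..t}" "A \<inter> B = {}"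
  shows "(\<integral>\<^sup>+\<omega>. ennreal (real (card {j. \<tau> j \<omega> \<in> A} * card {j. \<tau> j \<omega> \<in> B})) \<partial>P)
     = ennreal ((LINT x:A|lborel. lam x) * (LINT x:B|lborel. lam x))"
proof -
  define D where "D = (\<lambda>i::nat. if i = 0 then A else B)"
  define X where "X i \<omega> = ennreal (real (card {j. \<tau> j \<omega> \<in> D i}))" for i \<omega>
  have D: "D i \<in> sets borel" "D i \<subseteq> {0..t}" for i using assms by (auto simp: D_def)
  have bd: "bounded (D i)" for i using D(2)[of i] by (intro bounded_subset[OF compact_imp_bounded[OF compact_Icc[of 0 t]]])
  have "indep_vars (\<lambda>_. count_space UNIV) (\<lambda>i \<omega>. card {j. \<tau> j \<omega> \<in> D i}) {0, 1}"
    using assms(5) D bd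
    by (intro count_indep[where B = D and I = "{0, 1}"]) (auto simp: disjoint_family_on_def D_def subset_iff)
  then have "indep_vars (\<lambda>_. borel) X {0, 1}"
    unfolding X_def by (rule indep_vars_compose2) simp
  then have "(\<integral>\<^sup>+\<omega>. (\<Prod>i\<in>{0, 1}. X i \<omega>) \<partial>P) = (\<Prod>i\<in>{0, 1}. \<integral>\<^sup>+\<omega>. X i \<omega> \<partial>P)"
    by (intro indep_vars_nn_integral) auto
  then have "(\<integral>\<^sup>+\<omega>. X 0 \<omega> * X 1 \<omega> \<partial>P) = (\<integral>\<^sup>+\<omega>. X 0 \<omega> \<partial>P) * (\<integral>\<^sup>+\<omega>. X 1 \<omega> \<partial>P)" by simp
  also have "\<dots> = ennreal (LINT x:A|lborel. lam x) * ennreal (LINT x:B|lborel. lam x)"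
    unfolding X_def count_moments(1)[OF D] by (simp add: D_def)
  finally show ?thesis
    by (simp add: X_def D_def ennreal_mult' rate_integral_nonneg)
qed

lemma measurable_countable_index:
  fixes h :: "'i :: countable \<Rightarrow> 'a \<Rightarrow> 'c"
  assumes "\<And>i. h i \<in> measurable P N"
  shows "(\<lambda>q. h (snd q) (fst q)) \<in> measurable (P \<Otimes>\<^sub>M count_space UNIV) N"
  by (rule measurable_compose_countable[where f = "\<lambda>i q. h i (fst q)" and g = snd])
     (auto intro: measurable_compose[OF measurable_fst assms])

lemma nn_integral_countable_index:
  fixes h :: "'i :: countable \<Rightarrow> 'a \<Rightarrow> ennreal"
  assumes "\<And>i. h i \<in> borel_measurable P"
  shows "(\<lambda>\<omega>. \<integral>\<^sup>+i. h i \<omega> \<partial>count_space UNIV) \<in> borel_measurable P"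
    and "(\<integral>\<^sup>+q. h (snd q) (fst q) \<partial>(P \<Otimes>\<^sub>M count_space UNIV)) = (\<integral>\<^sup>+\<omega>. \<integral>\<^sup>+i. h i \<omega> \<partial>count_space UNIV \<partial>P)"
proof -
  interpret c: sigma_finite_measure "count_space (UNIV :: 'i set)"
    by (rule sigma_finite_measure_count_space)
  note m = measurable_countable_index[OF assms]
  show "(\<lambda>\<omega>. \<integral>\<^sup>+i. h i \<omega> \<partial>count_space UNIV) \<in> borel_measurable P"
    using c.borel_measurable_nn_integral_fst[OF m] by simp
  show "(\<integral>\<^sup>+q. h (snd q) (fst q) \<partial>(P \<Otimes>\<^sub>M count_space UNIV)) = (\<integral>\<^sup>+\<omega>. \<integral>\<^sup>+i. h i \<omega> \<partial>count_space UNIV \<partial>P)"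
    using c.nn_integral_fst[OF m] by simp
qed

lemma first_moment:
  fixes g :: "real \<Rightarrow> ennreal"
  assumes g [measurable]: "g \<in> borel_measurable borel" and g0: "\<And>x. x \<notin> {0..t} \<Longrightarrow> g x = 0"
  shows "(\<integral>\<^sup>+\<omega>. \<integral>\<^sup>+j. g (\<tau> j \<omega>) \<partial>count_space UNIV \<partial>P) = (\<integral>\<^sup>+x. ennreal (indicator {0..t} x * lam x) * g x \<partial>lborel)"
proof -
  define Q where "Q = P \<Otimes>\<^sub>M count_space (UNIV :: nat set)"
  define d where "d j \<omega> = (indicator {0..t} (\<tau> j \<omega>) :: ennreal)" for j \<omega>
  define N where "N = distr (density Q (\<lambda>q. d (snd q) (fst q))) borel (\<lambda>q. \<tau> (snd q) (fst q))"
  have dm: "(\<lambda>q. d (snd q) (fst q)) \<in> borel_measurable Q"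
    unfolding Q_def d_def by (rule measurable_countable_index) measurable
  have \<tau>m: "(\<lambda>q. \<tau> (snd q) (fst q)) \<in> borel_measurable Q"
    unfolding Q_def by (rule measurable_countable_index) measurable
  have nnN: "(\<integral>\<^sup>+x. f x \<partial>N) = (\<integral>\<^sup>+\<omega>. \<integral>\<^sup>+j. indicator {0..t} (\<tau> j \<omega>) * f (\<tau> j \<omega>) \<partial>count_space UNIV \<partial>P)"
    if f [measurable]: "f \<in> borel_measurable borel" for f
  proof -
    have "(\<integral>\<^sup>+x. f x \<partial>N) = (\<integral>\<^sup>+q. f (\<tau> (snd q) (fst q)) \<partial>density Q (\<lambda>q. d (snd q) (fst q)))"
      unfolding N_def by (rule nn_integral_distr) (use \<tau>m f in auto)
    also have "\<dots> = (\<integral>\<^sup>+q. d (snd q) (fst q) * f (\<tau> (snd q) (fst q)) \<partial>Q)"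
      by (rule nn_integral_density[OF dm measurable_compose[OF \<tau>m f]])
    also have "\<dots> = (\<integral>\<^sup>+\<omega>. \<integral>\<^sup>+j. d j \<omega> * f (\<tau> j \<omega>) \<partial>count_space UNIV \<partial>P)"
      unfolding Q_def d_def by (rule nn_integral_countable_index(2)) measurable
    finally show ?thesis by (simp add: d_def)
  qed
  have "N = window t"
  proof (rule measure_eqI)
    show "sets N = sets (window t)" by (simp add: N_def)
    fix B assume "B \<in> sets N"
    then have B [measurable]: "B \<in> sets borel" by (simp add: N_def)
    have "emeasure N B = (\<integral>\<^sup>+x. indicator B x \<partial>N)" using B by (simp add: N_def)
    also have "\<dots> = (\<integral>\<^sup>+\<omega>. \<integral>\<^sup>+j. indicator {0..t} (\<tau> j \<omega>) * indicator B (\<tau> j \<omega>) \<partial>count_space UNIV \<partial>P)"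
      by (rule nnN) measurable
    also have "\<dots> = (\<integral>\<^sup>+\<omega>. ennreal (real (card {j. \<tau> j \<omega> \<in> B \<inter> {0..t}})) \<partial>P)"
    proof (rule nn_integral_cong_AE)
      show "AE \<omega> in P. (\<integral>\<^sup>+j. indicator {0..t} (\<tau> j \<omega>) * indicator B (\<tau> j \<omega>) \<partial>count_space UNIV) = ennreal (real (card {j. \<tau> j \<omega> \<in> B \<inter> {0..t}}))"
        using finite_arrivals_in[of t]
      proof eventually_elim
        case (elim \<omega>)
        then have "finite {j. \<tau> j \<omega> \<in> B \<inter> {0..t}}"
          using elim[rule_format, of "B \<inter> {0..t}"] by simp
        have "indicator {0..t} (\<tau> j \<omega>) * indicator B (\<tau> j \<omega>) = (indicator {j. \<tau> j \<omega> \<in> B \<inter> {0..t}} j :: ennreal)" for j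
          by (auto simp: indicator_def)
        then show ?case
          by (simp only: nn_integral_count_space_indicator_finite[OF \<open>finite {j. \<tau> j \<omega> \<in> B \<inter> {0..t}}\<close>])
      qed
    qed
    also have "\<dots> = emeasure (window t) B"
      by (subst count_moments(1)[of _ t]) (auto simp: emeasure_window)
    finally show "emeasure N B = emeasure (window t) B" .
  qed
  then have "(\<integral>\<^sup>+x. g x \<partial>window t) = (\<integral>\<^sup>+\<omega>. \<integral>\<^sup>+j. indicator {0..t} (\<tau> j \<omega>) * g (\<tau> j \<omega>) \<partial>count_space UNIV \<partial>P)"
    using nnN[OF g] by simp
  also have "\<dots> = (\<integral>\<^sup>+\<omega>. \<integral>\<^sup>+j. g (\<tau> j \<omega>) \<partial>count_space UNIV \<partial>P)"
    by (intro nn_integral_cong) (auto simp: indicator_def g0)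
  finally show ?thesis by (simp add: nn_integral_window)
qed

text \<open>For disjoint sets the counts are independent, and for equal sets the number of
  ordered pairs of distinct points is \<open>N (N - 1)\<close>, whose Poisson mean is the square
  of that of \<open>N\<close>. Both sides are additive in each set, which reduces the general
  case to these two.\<close>

lemma factorial_moment_rectangle:
  assumes A: "A \<in> sets borel" "A \<subseteq> {0..t}" and B: "B \<in> sets borel" "B \<subseteq> {0..t}"
  shows "(\<integral>\<^sup>+\<omega>. \<integral>\<^sup>+p. indicator {(j, k). j \<noteq> k \<and> \<tau> j \<omega> \<in> A \<and> \<tau> k \<omega> \<in> B} p \<partial>count_space UNIV \<partial>P)
     = ennreal ((LINT x:A|lborel. lam x) * (LINT x:B|lborel. lam x))"
proof -
  let ?F = "\<lambda>A B \<omega>. {(j, k). j \<noteq> k \<and> \<tau> j \<omega> \<in> A \<and> \<tau> k \<omega> \<in> B}"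
  let ?S = "\<lambda>A B. \<integral>\<^sup>+\<omega>. \<integral>\<^sup>+p. indicator (?F A B \<omega>) p \<partial>count_space UNIV \<partial>P"
  let ?L = "\<lambda>A. LINT x:A|lborel. lam x"
  have count: "(\<integral>\<^sup>+p. indicator (?F A B \<omega>) p \<partial>count_space UNIV) = ennreal (real (card (?F A B \<omega>)))"
    if "finite {j. \<tau> j \<omega> \<in> A}" "finite {j. \<tau> j \<omega> \<in> B}" for A B \<omega>
  proof (rule nn_integral_count_space_indicator_finite)
    have "?F A B \<omega> \<subseteq> {j. \<tau> j \<omega> \<in> A} \<times> {j. \<tau> j \<omega> \<in> B}" by auto
    then show "finite (?F A B \<omega>)" using that by (meson finite_SigmaI finite_subset)
  qed
  have same: "?S C C = ennreal (?L C * ?L C)" if C: "C \<in> sets borel" "C \<subseteq> {0..t}" for C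
  proof -
    have "?S C C = (\<integral>\<^sup>+\<omega>. ennreal (real (card {j. \<tau> j \<omega> \<in> C} * (card {j. \<tau> j \<omega> \<in> C} - 1))) \<partial>P)"
    proof (rule nn_integral_cong_AE)
      show "AE \<omega> in P. (\<integral>\<^sup>+p. indicator (?F C C \<omega>) p \<partial>count_space UNIV) = ennreal (real (card {j. \<tau> j \<omega> \<in> C} * (card {j. \<tau> j \<omega> \<in> C} - 1)))"
        using finite_arrivals_in[of t]
      proof eventually_elim
        case (elim \<omega>)
        then have fin: "finite {j. \<tau> j \<omega> \<in> C}" using C by blast
        show ?case using count[OF fin fin] card_offdiagonal[OF fin] by simp
      qed
    qed
    then show ?thesis by (simp only: count_moments(2)[OF C] power2_eq_square)
  qed
  have disj: "?S C D = ennreal (?L C * ?L D)"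
    if C: "C \<in> sets borel" "C \<subseteq> {0..t}" and D: "D \<in> sets borel" "D \<subseteq> {0..t}" and CD: "C \<inter> D = {}" for C D
  proof -
    have "?S C D = (\<integral>\<^sup>+\<omega>. ennreal (real (card {j. \<tau> j \<omega> \<in> C} * card {j. \<tau> j \<omega> \<in> D})) \<partial>P)"
    proof (rule nn_integral_cong_AE)
      show "AE \<omega> in P. (\<integral>\<^sup>+p. indicator (?F C D \<omega>) p \<partial>count_space UNIV) = ennreal (real (card {j. \<tau> j \<omega> \<in> C} * card {j. \<tau> j \<omega> \<in> D}))"
        using finite_arrivals_in[of t]
      proof eventually_elim
        case (elim \<omega>)
        then have fin: "finite {j. \<tau> j \<omega> \<in> C}" "finite {j. \<tau> j \<omega> \<in> D}" using C D by blast+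
        have "?F C D \<omega> = {j. \<tau> j \<omega> \<in> C} \<times> {j. \<tau> j \<omega> \<in> D}" using CD by auto
        then show ?case using count[OF fin] by (simp add: card_cartesian_product)
      qed
    qed
    then show ?thesis by (simp only: count_product_moment[OF C D CD])
  qed
  have meas: "(\<lambda>\<omega>. \<integral>\<^sup>+p. indicator (?F C D \<omega>) p \<partial>count_space UNIV) \<in> borel_measurable P"
    if [measurable]: "C \<in> sets borel" "D \<in> sets borel" for C D
  proof -
    have "(\<lambda>\<omega>. \<integral>\<^sup>+p. indicator (?F C D \<omega>) p \<partial>count_space UNIV)
        = (\<lambda>\<omega>. \<integral>\<^sup>+p. (if fst p \<noteq> snd p then indicator C (\<tau> (fst p) \<omega>) * indicator D (\<tau> (snd p) \<omega>) else 0) \<partial>count_space UNIV)"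
      by (intro ext nn_integral_cong) (auto simp: indicator_def)
    also have "\<dots> \<in> borel_measurable P"
      by (rule nn_integral_countable_index(1)) measurable
    finally show ?thesis .
  qed
  have addl: "?S (C \<union> C') D = ?S C D + ?S C' D"
    if "C \<in> sets borel" "C' \<in> sets borel" "D \<in> sets borel" "C \<inter> C' = {}" for C C' D
  proof -
    have "indicator (?F (C \<union> C') D \<omega>) p = (indicator (?F C D \<omega>) p + indicator (?F C' D \<omega>) p :: ennreal)" for \<omega> p
      using that(4) by (auto simp: indicator_def)
    then show ?thesis
      by (simp only: nn_integral_add[OF borel_measurable_count_space borel_measurable_count_space]
            nn_integral_add[OF meas meas] that)
  qed
  have addr: "?S D (C \<union> C') = ?S D C + ?S D C'"
    if "C \<in> sets borel" "C' \<in> sets borel" "D \<in> sets borel" "C \<inter> C' = {}" for C C' D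
  proof -
    have "indicator (?F D (C \<union> C') \<omega>) p = (indicator (?F D C \<omega>) p + indicator (?F D C' \<omega>) p :: ennreal)" for \<omega> p
      using that(4) by (auto simp: indicator_def)
    then show ?thesis
      by (simp only: nn_integral_add[OF borel_measurable_count_space borel_measurable_count_space]
            nn_integral_add[OF meas meas] that)
  qed
  have L_un: "?L (C \<union> C') = ?L C + ?L C'"
    if "C \<in> sets borel" "C \<subseteq> {0..t}" "C' \<in> sets borel" "C' \<subseteq> {0..t}" "C \<inter> C' = {}" for C C'
    by (rule set_integral_Un[OF that(5)]) (use rate_integrable_on that in auto)
  \<comment> \<open>Any two of the sets \<open>E\<close>, \<open>A'\<close>,
    \<open>B'\<close> are equal or disjoint.\<close>
  define E A' B' where "E = A \<inter> B" and "A' = A - B" and "B' = B - A"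
  have sets: "E \<in> sets borel" "E \<subseteq> {0..t}" "A' \<in> sets borel" "A' \<subseteq> {0..t}" "B' \<in> sets borel" "B' \<subseteq> {0..t}"
    using A B by (auto simp: E_def A'_def B'_def)
  have AE: "A = E \<union> A'" "E \<inter> A' = {}" and BE: "B = E \<union> B'" "E \<inter> B' = {}" and AB: "A' \<inter> B' = {}" "A' \<inter> E = {}"
    by (auto simp: E_def A'_def B'_def)
  have "?S A B = ?S E B + ?S A' B"
    unfolding AE(1) by (rule addl) (use sets AE B in auto)
  also have "?S E B = ?S E E + ?S E B'"
    unfolding BE(1) by (rule addr) (use sets BE in auto)
  also have "?S A' B = ?S A' E + ?S A' B'"
    unfolding BE(1) by (rule addr) (use sets BE in auto)
  also have "?S E E + ?S E B' + (?S A' E + ?S A' B')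
     = ennreal (?L E * ?L E) + ennreal (?L E * ?L B') + (ennreal (?L A' * ?L E) + ennreal (?L A' * ?L B'))"
    using same[OF sets(1,2)] disj[OF sets(1,2,5,6) BE(2)] disj[OF sets(3,4,1,2) AB(2)] disj[OF sets(3,4,5,6) AB(1)]
    by simp
  also have "\<dots> = ennreal ((?L E + ?L A') * (?L E + ?L B'))"
    by (simp add: rate_integral_nonneg algebra_simps flip: ennreal_plus)
  also have "?L E + ?L A' = ?L A" unfolding AE(1) by (rule L_un[symmetric]) (use sets AE in auto)
  also have "?L E + ?L B' = ?L B" unfolding BE(1) by (rule L_un[symmetric]) (use sets BE in auto)
  finally show ?thesis .
qed

text \<open>The second factorial moment measure of a Poisson process is the square of the
  intensity measure, because the two agree on rectangles.\<close>

lemma second_factorial_moment: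
  fixes g :: "real \<Rightarrow> ennreal"
  assumes g [measurable]: "g \<in> borel_measurable borel" and g0: "\<And>x. x \<notin> {0..t} \<Longrightarrow> g x = 0"
  shows "(\<integral>\<^sup>+\<omega>. \<integral>\<^sup>+p. (if fst p \<noteq> snd p then g (\<tau> (fst p) \<omega>) * g (\<tau> (snd p) \<omega>) else 0) \<partial>count_space UNIV \<partial>P)
     = (\<integral>\<^sup>+x. ennreal (indicator {0..t} x * lam x) * g x \<partial>lborel)\<^sup>2"
proof -
  define Q where "Q = P \<Otimes>\<^sub>M count_space (UNIV :: (nat \<times> nat) set)"
  define d where "d p \<omega> = (if fst p \<noteq> snd p then indicator {0..t} (\<tau> (fst p) \<omega>) * indicator {0..t} (\<tau> (snd p) \<omega>) else 0 :: ennreal)"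
    for p \<omega>
  define \<phi> where "\<phi> p \<omega> = (\<tau> (fst p) \<omega>, \<tau> (snd p) \<omega>)" for p \<omega>
  define N where "N = distr (density Q (\<lambda>q. d (snd q) (fst q))) (borel \<Otimes>\<^sub>M borel) (\<lambda>q. \<phi> (snd q) (fst q))"
  have dm': "d p \<in> borel_measurable P" for p unfolding d_def by measurable
  have \<phi>m': "\<phi> p \<in> P \<rightarrow>\<^sub>M borel \<Otimes>\<^sub>M borel" for p unfolding \<phi>_def by measurable
  have dm: "(\<lambda>q. d (snd q) (fst q)) \<in> borel_measurable Q"
    unfolding Q_def by (rule measurable_countable_index[OF dm'])
  have \<phi>m: "(\<lambda>q. \<phi> (snd q) (fst q)) \<in> Q \<rightarrow>\<^sub>M borel \<Otimes>\<^sub>M borel"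
    unfolding Q_def by (rule measurable_countable_index[OF \<phi>m'])
  have nnN: "(\<integral>\<^sup>+x. f x \<partial>N) = (\<integral>\<^sup>+\<omega>. \<integral>\<^sup>+p. d p \<omega> * f (\<phi> p \<omega>) \<partial>count_space UNIV \<partial>P)"
    if f: "f \<in> borel_measurable (borel \<Otimes>\<^sub>M borel)" for f
  proof -
    have "(\<integral>\<^sup>+x. f x \<partial>N) = (\<integral>\<^sup>+q. f (\<phi> (snd q) (fst q)) \<partial>density Q (\<lambda>q. d (snd q) (fst q)))"
      unfolding N_def by (rule nn_integral_distr) (use \<phi>m f in auto)
    also have "\<dots> = (\<integral>\<^sup>+q. d (snd q) (fst q) * f (\<phi> (snd q) (fst q)) \<partial>Q)"
      by (rule nn_integral_density[OF dm measurable_compose[OF \<phi>m f]])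
    also have "\<dots> = (\<integral>\<^sup>+\<omega>. \<integral>\<^sup>+p. d p \<omega> * f (\<phi> p \<omega>) \<partial>count_space UNIV \<partial>P)"
      unfolding Q_def
      by (rule nn_integral_countable_index(2)[OF borel_measurable_times_ennreal[OF dm' measurable_compose[OF \<phi>m' f]]])
    finally show ?thesis .
  qed
  interpret w: finite_measure "window t" by (rule finite_measure_window)
  have "window t \<Otimes>\<^sub>M window t = N"
  proof (rule pair_measure_eqI)
    show "sigma_finite_measure (window t)" "sigma_finite_measure (window t)" by unfold_locales
    have "sets (window t \<Otimes>\<^sub>M window t) = sets (borel \<Otimes>\<^sub>M borel)" by (intro sets_pair_measure_cong) simp_all
    then show "sets (window t \<Otimes>\<^sub>M window t) = sets N" by (simp add: N_def)
    fix A B assume "A \<in> sets (window t)" "B \<in> sets (window t)"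
    then have [measurable]: "A \<in> sets borel" "B \<in> sets borel" by simp_all
    have "emeasure N (A \<times> B) = (\<integral>\<^sup>+x. indicator (A \<times> B) x \<partial>N)" by (simp add: N_def)
    also have "\<dots> = (\<integral>\<^sup>+\<omega>. \<integral>\<^sup>+p. d p \<omega> * indicator (A \<times> B) (\<phi> p \<omega>) \<partial>count_space UNIV \<partial>P)"
      by (rule nnN) measurable
    also have "\<dots> = (\<integral>\<^sup>+\<omega>. \<integral>\<^sup>+p. indicator {(j, k). j \<noteq> k \<and> \<tau> j \<omega> \<in> A \<inter> {0..t} \<and> \<tau> k \<omega> \<in> B \<inter> {0..t}} p \<partial>count_space UNIV \<partial>P)"
      by (intro nn_integral_cong) (auto simp: indicator_def d_def \<phi>_def)
    also have "\<dots> = ennreal ((LINT x:A \<inter> {0..t}|lborel. lam x) * (LINT x:B \<inter> {0..t}|lborel. lam x))"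
      by (rule factorial_moment_rectangle[of _ t]) auto
    also have "\<dots> = emeasure (window t) A * emeasure (window t) B"
      by (simp add: emeasure_window ennreal_mult' rate_integral_nonneg)
    finally show "emeasure (window t) A * emeasure (window t) B = emeasure N (A \<times> B)" by simp
  qed
  then have "(\<integral>\<^sup>+\<omega>. \<integral>\<^sup>+p. d p \<omega> * (g (\<tau> (fst p) \<omega>) * g (\<tau> (snd p) \<omega>)) \<partial>count_space UNIV \<partial>P)
     = (\<integral>\<^sup>+x. g (fst x) * g (snd x) \<partial>(window t \<Otimes>\<^sub>M window t))"
    by (simp add: nnN \<phi>_def)
  also have "\<dots> = (\<integral>\<^sup>+x. \<integral>\<^sup>+y. g x * g y \<partial>window t \<partial>window t)"
    by (subst w.nn_integral_fst[symmetric]) auto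
  also have "\<dots> = (\<integral>\<^sup>+x. g x \<partial>window t)\<^sup>2"
    by (simp add: nn_integral_cmult nn_integral_multc power2_eq_square)
  finally have "(\<integral>\<^sup>+\<omega>. \<integral>\<^sup>+p. d p \<omega> * (g (\<tau> (fst p) \<omega>) * g (\<tau> (snd p) \<omega>)) \<partial>count_space UNIV \<partial>P)
     = (\<integral>\<^sup>+x. g x \<partial>window t)\<^sup>2" .
  moreover have "d p \<omega> * (g (\<tau> (fst p) \<omega>) * g (\<tau> (snd p) \<omega>)) =
      (if fst p \<noteq> snd p then g (\<tau> (fst p) \<omega>) * g (\<tau> (snd p) \<omega>) else 0)" for \<omega> p
    by (auto simp: indicator_def g0 d_def)
  ultimately show ?thesis by (simp add: nn_integral_window)
qed

end

section \<open>Mean and variance of the queue length\<close>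

lemma (in prob_space) nn_integral_countable_swap:
  fixes h :: "'i :: countable \<Rightarrow> 'a \<Rightarrow> ennreal"
  assumes h: "\<And>i. h i \<in> borel_measurable M"
  shows "(\<integral>\<^sup>+\<omega>. \<integral>\<^sup>+i. h i \<omega> \<partial>count_space UNIV \<partial>M) = (\<integral>\<^sup>+i. \<integral>\<^sup>+\<omega>. h i \<omega> \<partial>M \<partial>count_space UNIV)"
proof -
  interpret p: pair_sigma_finite M "count_space (UNIV :: 'i set)"
    by (intro pair_sigma_finite.intro sigma_finite_measure_count_space prob_space_imp_sigma_finite prob_space_axioms)
  have "(\<lambda>q. h (snd q) (fst q)) \<in> borel_measurable (M \<Otimes>\<^sub>M count_space UNIV)"
    by (rule measurable_compose_countable[where f = "\<lambda>i q. h i (fst q)" and g = snd])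
       (auto intro: measurable_compose[OF measurable_fst h])
  from p.Fubini[OF this] show ?thesis by simp
qed

locale queue = MtG_infinity P lam \<tau> \<sigma> G + poisson_process_with_rate P lam \<tau>
  for P :: "'w measure" and lam :: "real \<Rightarrow> real" and \<tau> \<sigma> :: "nat \<Rightarrow> 'w \<Rightarrow> real" and G :: "real \<Rightarrow> real" +
  assumes rate_neg: "\<And>t. t < 0 \<Longrightarrow> lam t = 0"
begin

lemma service_measurable [measurable]: "\<sigma> j \<in> borel_measurable P"
  using service_indep by (auto simp: indep_vars_def)

lemma G_measurable [measurable]: "G \<in> borel_measurable borel"
proof -
  interpret D: real_distribution "distr P borel (\<sigma> 0)" by (rule real_distribution_distr) simp
  have "mono G" using D.cdf_nondecreasing unfolding service_distribution by (auto simp: mono_def)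
  then show ?thesis by (rule borel_measurable_mono)
qed

lemma G_le_1: "G y \<le> 1"
proof -
  interpret D: real_distribution "distr P borel (\<sigma> 0)" by (rule real_distribution_distr) simp
  show ?thesis using D.cdf_bounded_prob[of y] by (simp add: service_distribution)
qed

definition tail :: "real \<Rightarrow> real" where
  "tail y = (if y < 0 then 0 else 1 - G y)"

lemma tail_measurable [measurable]: "tail \<in> borel_measurable borel"
  unfolding tail_def by measurable

lemma tail_nonneg: "tail y \<ge> 0" using G_le_1[of y] by (simp add: tail_def)

lemma service_tail:
  "y \<ge> 0 \<Longrightarrow> (\<integral>\<^sup>+\<omega>. (if y < \<sigma> j \<omega> then 1 else 0) \<partial>P) = ennreal (tail y)"
proof -
  assume y: "y \<ge> 0"
  have "G y = prob {\<omega> \<in> space P. \<sigma> j \<omega> \<le> y}"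
    unfolding service_distribution[of j, symmetric] cdf_def
    by (subst measure_distr) (auto simp: vimage_def Int_def conj_commute)
  moreover have "prob {\<omega> \<in> space P. y < \<sigma> j \<omega>} = 1 - prob {\<omega> \<in> space P. \<sigma> j \<omega> \<le> y}"
    by (subst prob_compl[symmetric]) (auto intro!: arg_cong[where f = prob])
  ultimately have "prob {\<omega> \<in> space P. y < \<sigma> j \<omega>} = tail y" using y by (simp add: tail_def)
  moreover have "(\<integral>\<^sup>+\<omega>. (if y < \<sigma> j \<omega> then 1 else 0) \<partial>P) = (\<integral>\<^sup>+\<omega>. indicator {\<omega> \<in> space P. y < \<sigma> j \<omega>} \<omega> \<partial>P)"
    by (intro nn_integral_cong) auto
  moreover have "\<dots> = ennreal (prob {\<omega> \<in> space P. y < \<sigma> j \<omega>})"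
    by (subst nn_integral_indicator) (auto simp: emeasure_eq_measure)
  ultimately show ?thesis by simp
qed

lemma two_services_tail:
  assumes "y \<ge> 0" "y' \<ge> 0" "j \<noteq> k"
  shows "(\<integral>\<^sup>+\<omega>. (if y < \<sigma> j \<omega> then 1 else 0) * (if y' < \<sigma> k \<omega> then 1 else 0) \<partial>P) = ennreal (tail y) * ennreal (tail y')"
proof -
  define c where "c i = (if i = j then y else y')" for i
  define X where "X i \<omega> = (if c i < \<sigma> i \<omega> then 1 else 0 :: ennreal)" for i \<omega>
  have "indep_vars (\<lambda>_. borel) \<sigma> {j, k}" by (rule indep_vars_subset[OF service_indep]) auto
  then have "indep_vars (\<lambda>_. borel) X {j, k}"
    unfolding X_def by (rule indep_vars_compose2[where Y = "\<lambda>i s. if c i < s then 1 else 0"]) simp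
  then have "(\<integral>\<^sup>+\<omega>. (\<Prod>i\<in>{j, k}. X i \<omega>) \<partial>P) = (\<Prod>i\<in>{j, k}. \<integral>\<^sup>+\<omega>. X i \<omega> \<partial>P)"
    by (intro indep_vars_nn_integral) auto
  then have "(\<integral>\<^sup>+\<omega>. X j \<omega> * X k \<omega> \<partial>P) = (\<integral>\<^sup>+\<omega>. X j \<omega> \<partial>P) * (\<integral>\<^sup>+\<omega>. X k \<omega> \<partial>P)"
    using assms(3) by simp
  then show ?thesis
    using assms by (simp add: X_def c_def service_tail)
qed

text \<open>Service times can be averaged out while the arrivals are held fixed.\<close>

lemma nn_integral_arrivals_services:
  assumes f: "f \<in> borel_measurable (PiM UNIV (\<lambda>_. borel) \<Otimes>\<^sub>M PiM UNIV (\<lambda>_. borel))"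
  shows "(\<integral>\<^sup>+\<omega>. f (\<lambda>j. \<tau> j \<omega>, \<lambda>j. \<sigma> j \<omega>) \<partial>P) = (\<integral>\<^sup>+\<omega>. \<integral>\<^sup>+\<omega>'. f (\<lambda>j. \<tau> j \<omega>, \<lambda>j. \<sigma> j \<omega>') \<partial>P \<partial>P)"
proof -
  let ?S = "PiM UNIV (\<lambda>_. borel) :: (nat \<Rightarrow> real) measure"
  let ?X = "\<lambda>\<omega> j. \<tau> j \<omega>" and ?Y = "\<lambda>\<omega> j. \<sigma> j \<omega>"
  have X [measurable]: "?X \<in> P \<rightarrow>\<^sub>M ?S" and Y [measurable]: "?Y \<in> P \<rightarrow>\<^sub>M ?S"
    and eq: "distr P ?S ?X \<Otimes>\<^sub>M distr P ?S ?Y = distr P (?S \<Otimes>\<^sub>M ?S) (\<lambda>\<omega>. (?X \<omega>, ?Y \<omega>))"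
    using arrivals_services_indep unfolding indep_var_distribution_eq by auto
  interpret Y: prob_space "distr P ?S ?Y" by (rule prob_space_distr[OF Y])
  have f': "f \<in> borel_measurable (distr P ?S ?X \<Otimes>\<^sub>M distr P ?S ?Y)" using f by simp
  have "(\<integral>\<^sup>+\<omega>. f (?X \<omega>, ?Y \<omega>) \<partial>P) = (\<integral>\<^sup>+x. f x \<partial>distr P (?S \<Otimes>\<^sub>M ?S) (\<lambda>\<omega>. (?X \<omega>, ?Y \<omega>)))"
    using f by (subst nn_integral_distr) auto
  also have "\<dots> = (\<integral>\<^sup>+x. \<integral>\<^sup>+y. f (x, y) \<partial>distr P ?S ?Y \<partial>distr P ?S ?X)"
    unfolding eq[symmetric] by (rule Y.nn_integral_fst[OF f', symmetric])
  also have "\<dots> = (\<integral>\<^sup>+\<omega>. \<integral>\<^sup>+y. f (?X \<omega>, y) \<partial>distr P ?S ?Y \<partial>P)"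
    using Y.borel_measurable_nn_integral_fst[OF f'] by (subst nn_integral_distr) auto
  also have "\<dots> = (\<integral>\<^sup>+\<omega>. \<integral>\<^sup>+\<omega>'. f (?X \<omega>, ?Y \<omega>') \<partial>P \<partial>P)"
  proof (intro nn_integral_cong)
    fix \<omega>
    have "(\<lambda>y. f (?X \<omega>, y)) \<in> borel_measurable ?S"
      by (rule measurable_compose[OF _ f]) (auto simp: space_PiM)
    then show "(\<integral>\<^sup>+y. f (?X \<omega>, y) \<partial>distr P ?S ?Y) = (\<integral>\<^sup>+\<omega>'. f (?X \<omega>, ?Y \<omega>') \<partial>P)"
      by (subst nn_integral_distr) auto
  qed
  finally show ?thesis .
qed

text \<open>The indicator that customer \<open>j\<close> is in the system at time
  \<open>t\<close>; averaging over the service times turns it into a function of the arrival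
  time alone.\<close>

definition present :: "real \<Rightarrow> nat \<Rightarrow> 'w \<Rightarrow> ennreal" where
  "present t j \<omega> = indicator {0..t} (\<tau> j \<omega>) * (if t - \<tau> j \<omega> < \<sigma> j \<omega> then 1 else 0)"

definition weight :: "real \<Rightarrow> real \<Rightarrow> ennreal" where
  "weight t x = indicator {0..t} x * ennreal (tail (t - x))"

lemma present_measurable [measurable]: "present t j \<in> borel_measurable P"
  unfolding present_def by measurable

lemma weight_measurable [measurable]: "weight t \<in> borel_measurable borel"
  unfolding weight_def by measurable

lemma nn_integral_present: "(\<integral>\<^sup>+\<omega>. present t j \<omega> \<partial>P) = (\<integral>\<^sup>+\<omega>. weight t (\<tau> j \<omega>) \<partial>P)"
proof -
  let ?f = "\<lambda>(a :: nat \<Rightarrow> real, b :: nat \<Rightarrow> real). indicator {0..t} (a j) * (if t - a j < b j then 1 else 0) :: ennreal"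
  have "(\<integral>\<^sup>+\<omega>. present t j \<omega> \<partial>P) = (\<integral>\<^sup>+\<omega>. \<integral>\<^sup>+\<omega>'. indicator {0..t} (\<tau> j \<omega>) * (if t - \<tau> j \<omega> < \<sigma> j \<omega>' then 1 else 0) \<partial>P \<partial>P)"
    unfolding present_def
    by (rule nn_integral_arrivals_services[of ?f, unfolded prod.case]) measurable
  also have "\<dots> = (\<integral>\<^sup>+\<omega>. weight t (\<tau> j \<omega>) \<partial>P)"
    by (intro nn_integral_cong) (auto simp: indicator_def weight_def service_tail)
  finally show ?thesis .
qed

lemma nn_integral_two_present:
  assumes "j \<noteq> k"
  shows "(\<integral>\<^sup>+\<omega>. present t j \<omega> * present t k \<omega> \<partial>P) = (\<integral>\<^sup>+\<omega>. weight t (\<tau> j \<omega>) * weight t (\<tau> k \<omega>) \<partial>P)"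
proof -
  let ?f = "\<lambda>(a :: nat \<Rightarrow> real, b :: nat \<Rightarrow> real). (indicator {0..t} (a j) * indicator {0..t} (a k)) *
     ((if t - a j < b j then 1 else 0) * (if t - a k < b k then 1 else 0)) :: ennreal"
  have "(\<integral>\<^sup>+\<omega>. present t j \<omega> * present t k \<omega> \<partial>P) = (\<integral>\<^sup>+\<omega>. (indicator {0..t} (\<tau> j \<omega>) * indicator {0..t} (\<tau> k \<omega>)) *
     ((if t - \<tau> j \<omega> < \<sigma> j \<omega> then 1 else 0) * (if t - \<tau> k \<omega> < \<sigma> k \<omega> then 1 else 0)) \<partial>P)"
    by (simp only: present_def mult_ac)
  also have "\<dots> = (\<integral>\<^sup>+\<omega>. \<integral>\<^sup>+\<omega>'. (indicator {0..t} (\<tau> j \<omega>) * indicator {0..t} (\<tau> k \<omega>)) *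
     ((if t - \<tau> j \<omega> < \<sigma> j \<omega>' then 1 else 0) * (if t - \<tau> k \<omega> < \<sigma> k \<omega>' then 1 else 0)) \<partial>P \<partial>P)"
    by (rule nn_integral_arrivals_services[of ?f, unfolded prod.case]) measurable
  also have "\<dots> = (\<integral>\<^sup>+\<omega>. (indicator {0..t} (\<tau> j \<omega>) * indicator {0..t} (\<tau> k \<omega>)) *
     (\<integral>\<^sup>+\<omega>'. (if t - \<tau> j \<omega> < \<sigma> j \<omega>' then 1 else 0) * (if t - \<tau> k \<omega> < \<sigma> k \<omega>' then 1 else 0) \<partial>P) \<partial>P)"
    by (intro nn_integral_cong nn_integral_cmult) measurable
  also have "\<dots> = (\<integral>\<^sup>+\<omega>. weight t (\<tau> j \<omega>) * weight t (\<tau> k \<omega>) \<partial>P)"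
  proof (intro nn_integral_cong)
    fix \<omega>
    show "(indicator {0..t} (\<tau> j \<omega>) * indicator {0..t} (\<tau> k \<omega>)) *
     (\<integral>\<^sup>+\<omega>'. (if t - \<tau> j \<omega> < \<sigma> j \<omega>' then 1 else 0) * (if t - \<tau> k \<omega> < \<sigma> k \<omega>' then 1 else 0) \<partial>P)
       = weight t (\<tau> j \<omega>) * weight t (\<tau> k \<omega>)"
    proof (cases "\<tau> j \<omega> \<in> {0..t} \<and> \<tau> k \<omega> \<in> {0..t}")
      case True
      then show ?thesis using assms by (subst two_services_tail) (auto simp: weight_def)
    next
      case False
      then show ?thesis by (auto simp: weight_def indicator_def)
    qed
  qed
  finally show ?thesis .
qed

abbreviation queue_at :: "real \<Rightarrow> 'w \<Rightarrow> nat" where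
  "queue_at t \<omega> \<equiv> queue_length (\<lambda>j. \<tau> j \<omega>) (\<lambda>j. \<sigma> j \<omega>) t"

lemma queue_at_present:
  "AE \<omega> in P. (\<integral>\<^sup>+j. present t j \<omega> \<partial>count_space UNIV) = ennreal (real (queue_at t \<omega>)) \<and>
     (\<integral>\<^sup>+p. (if fst p \<noteq> snd p then present t (fst p) \<omega> * present t (snd p) \<omega> else 0) \<partial>count_space UNIV)
       = ennreal (real (queue_at t \<omega> * (queue_at t \<omega> - 1)))"
  using locally_finite arrival_nonneg
proof eventually_elim
  case (elim \<omega>)
  define S where "S = {j. \<tau> j \<omega> \<le> t \<and> \<sigma> j \<omega> > t - \<tau> j \<omega>}"
  have "S \<subseteq> {j. \<tau> j \<omega> \<le> t}" by (auto simp: S_def)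
  then have fin: "finite S" using elim(1) finite_subset by blast
  have pr: "present t j \<omega> = indicator S j" for j
    using elim(2) by (auto simp: present_def S_def indicator_def)
  have q: "queue_at t \<omega> = card S" by (simp add: queue_length_def S_def)
  have "{(j, k). j \<noteq> k \<and> j \<in> S \<and> k \<in> S} \<subseteq> S \<times> S" by auto
  then have fin2: "finite {(j, k). j \<noteq> k \<and> j \<in> S \<and> k \<in> S}" using fin by (meson finite_SigmaI finite_subset)
  have "(if fst p \<noteq> snd p then present t (fst p) \<omega> * present t (snd p) \<omega> else 0)
      = indicator {(j, k). j \<noteq> k \<and> j \<in> S \<and> k \<in> S} p" for p
    by (auto simp: pr indicator_def)
  then show ?case
    by (simp only: pr q nn_integral_count_space_indicator_finite[OF fin]
          nn_integral_count_space_indicator_finite[OF fin2] card_offdiagonal[OF fin])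
qed

text \<open>Given the arrivals, distinct customers are present independently of each other.
  Hence the mean of \<open>X (X - 1)\<close> is an integral over the second factorial moment
  measure and, as for a Poisson variable, equals the square of the mean of
  \<open>X\<close>.\<close>

lemma queue_factorial_moments:
  assumes int: "integrable lborel (\<lambda>x. lam x * tail (t - x))"
  defines "m \<equiv> LINT x|lborel. lam x * tail (t - x)"
  shows "(\<integral>\<^sup>+\<omega>. ennreal (real (queue_at t \<omega>)) \<partial>P) = ennreal m"
    and "(\<integral>\<^sup>+\<omega>. ennreal (real (queue_at t \<omega> * (queue_at t \<omega> - 1))) \<partial>P) = ennreal (m\<^sup>2)"
proof -
  have w0: "x \<notin> {0..t} \<Longrightarrow> weight t x = 0" for x by (simp add: weight_def)
  have m0: "m \<ge> 0" unfolding m_def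
    by (intro Bochner_Integration.integral_nonneg) (simp add: rate_nonneg tail_nonneg)
  have rate_weight: "(\<integral>\<^sup>+x. ennreal (indicator {0..t} x * lam x) * weight t x \<partial>lborel) = ennreal m"
  proof -
    have "ennreal (indicator {0..t} x * lam x) * weight t x = ennreal (lam x * tail (t - x))" for x
      using rate_nonneg[of x]
      by (auto simp: weight_def indicator_def ennreal_mult' rate_neg tail_def not_le)
    then show ?thesis unfolding m_def
      using nn_integral_eq_integral[OF int] by (simp add: rate_nonneg tail_nonneg)
  qed
  have "(\<integral>\<^sup>+\<omega>. ennreal (real (queue_at t \<omega>)) \<partial>P) = (\<integral>\<^sup>+\<omega>. \<integral>\<^sup>+j. present t j \<omega> \<partial>count_space UNIV \<partial>P)"
    using queue_at_present[of t] by (intro nn_integral_cong_AE) auto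
  also have "\<dots> = (\<integral>\<^sup>+j. \<integral>\<^sup>+\<omega>. weight t (\<tau> j \<omega>) \<partial>P \<partial>count_space UNIV)"
    by (subst nn_integral_countable_swap) (auto simp: nn_integral_present)
  also have "\<dots> = (\<integral>\<^sup>+\<omega>. \<integral>\<^sup>+j. weight t (\<tau> j \<omega>) \<partial>count_space UNIV \<partial>P)"
    by (rule nn_integral_countable_swap[symmetric]) measurable
  also have "\<dots> = ennreal m"
    by (subst first_moment[of _ t]) (auto simp: w0 rate_weight)
  finally show "(\<integral>\<^sup>+\<omega>. ennreal (real (queue_at t \<omega>)) \<partial>P) = ennreal m" .
  let ?off = "\<lambda>h p \<omega>. (if fst p \<noteq> snd p then h (fst p) \<omega> * h (snd p) \<omega> else 0) :: ennreal"
  have meas: "?off h p \<in> borel_measurable P" if "\<And>j. h j \<in> borel_measurable P" for h p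
    using that by (cases "fst p = snd p") auto
  have meas2: "?off (\<lambda>j \<omega>. weight t (\<tau> j \<omega>)) p \<in> borel_measurable P" for p
    by (rule meas) measurable
  have "(\<integral>\<^sup>+\<omega>. ennreal (real (queue_at t \<omega> * (queue_at t \<omega> - 1))) \<partial>P)
      = (\<integral>\<^sup>+\<omega>. \<integral>\<^sup>+p. ?off (present t) p \<omega> \<partial>count_space UNIV \<partial>P)"
  proof (rule nn_integral_cong_AE)
    show "AE \<omega> in P. ennreal (real (queue_at t \<omega> * (queue_at t \<omega> - 1))) = (\<integral>\<^sup>+p. ?off (present t) p \<omega> \<partial>count_space UNIV)"
      using queue_at_present[of t] by eventually_elim (simp only:)
  qed
  also have "\<dots> = (\<integral>\<^sup>+p. \<integral>\<^sup>+\<omega>. ?off (present t) p \<omega> \<partial>P \<partial>count_space UNIV)"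
    by (rule nn_integral_countable_swap[OF meas]) measurable
  also have "\<dots> = (\<integral>\<^sup>+p. \<integral>\<^sup>+\<omega>. ?off (\<lambda>j \<omega>. weight t (\<tau> j \<omega>)) p \<omega> \<partial>P \<partial>count_space UNIV)"
  proof (rule nn_integral_cong)
    fix p :: "nat \<times> nat"
    show "(\<integral>\<^sup>+\<omega>. ?off (present t) p \<omega> \<partial>P) = (\<integral>\<^sup>+\<omega>. ?off (\<lambda>j \<omega>. weight t (\<tau> j \<omega>)) p \<omega> \<partial>P)"
      using nn_integral_two_present[of "fst p" "snd p" t] by (cases "fst p = snd p") simp_all
  qed
  also have "\<dots> = (\<integral>\<^sup>+\<omega>. \<integral>\<^sup>+p. ?off (\<lambda>j \<omega>. weight t (\<tau> j \<omega>)) p \<omega> \<partial>count_space UNIV \<partial>P)"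
    by (rule nn_integral_countable_swap[OF meas2, symmetric])
  also have "\<dots> = (ennreal m)\<^sup>2"
    by (subst second_factorial_moment[of _ t]) (auto simp: w0 rate_weight)
  finally show "(\<integral>\<^sup>+\<omega>. ennreal (real (queue_at t \<omega> * (queue_at t \<omega> - 1))) \<partial>P) = ennreal (m\<^sup>2)"
    using m0 by (simp add: power2_eq_square ennreal_mult')
qed

lemma queue_at_measurable_pair:
  "(\<lambda>q. real (queue_at (snd q) (fst q))) \<in> borel_measurable (P \<Otimes>\<^sub>M borel)"
proof -
  have "(\<lambda>q. enn2real (\<Sum>j. (if \<tau> j (fst q) \<le> snd q \<and> \<sigma> j (fst q) > snd q - \<tau> j (fst q) then 1 else 0)))
     \<in> borel_measurable (P \<Otimes>\<^sub>M borel)"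
    by measurable
  also have "(\<lambda>q. enn2real (\<Sum>j. (if \<tau> j (fst q) \<le> snd q \<and> \<sigma> j (fst q) > snd q - \<tau> j (fst q) then 1 else 0)))
     = (\<lambda>q. real (queue_at (snd q) (fst q)))"
  proof
    fix q :: "'w \<times> real"
    let ?S = "{j. \<tau> j (fst q) \<le> snd q \<and> \<sigma> j (fst q) > snd q - \<tau> j (fst q)}"
    have "(\<Sum>j. (if \<tau> j (fst q) \<le> snd q \<and> \<sigma> j (fst q) > snd q - \<tau> j (fst q) then 1 else 0)) = (\<integral>\<^sup>+j. indicator ?S j \<partial>count_space UNIV)"
      by (subst nn_integral_count_space_nat) (auto intro!: suminf_cong simp: indicator_def)
    also have "\<dots> = emeasure (count_space UNIV) ?S" by simp
    finally show "enn2real (\<Sum>j. (if \<tau> j (fst q) \<le> snd q \<and> \<sigma> j (fst q) > snd q - \<tau> j (fst q) then 1 else 0)) = real (queue_at (snd q) (fst q))"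
      by (cases "finite ?S") (simp_all add: queue_length_def emeasure_count_space ennreal_of_nat_eq_real_of_nat)
  qed
  finally show ?thesis .
qed

lemma queue_at_measurable [measurable]: "(\<lambda>\<omega>. real (queue_at t \<omega>)) \<in> borel_measurable P"
  using measurable_compose[OF _ queue_at_measurable_pair, of "\<lambda>\<omega>. (\<omega>, t)" P] by simp

lemma queue_mean_variance:
  assumes int: "integrable lborel (\<lambda>x. lam x * tail (t - x))"
  defines "m \<equiv> LINT x|lborel. lam x * tail (t - x)"
  shows "integrable P (\<lambda>\<omega>. real (queue_at t \<omega>))" "expectation (\<lambda>\<omega>. real (queue_at t \<omega>)) = m"
    and "integrable P (\<lambda>\<omega>. (real (queue_at t \<omega>) - m)\<^sup>2)" "expectation (\<lambda>\<omega>. (real (queue_at t \<omega>) - m)\<^sup>2) = m"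
proof -
  let ?X = "\<lambda>\<omega>. real (queue_at t \<omega>)" and ?Y = "\<lambda>\<omega>. real (queue_at t \<omega> * (queue_at t \<omega> - 1))"
  note fm = queue_factorial_moments[OF int, folded m_def]
  have m0: "m \<ge> 0" unfolding m_def
    by (intro Bochner_Integration.integral_nonneg) (simp add: rate_nonneg tail_nonneg)
  have Y_eq: "?Y \<omega> = (?X \<omega>)\<^sup>2 - ?X \<omega>" for \<omega>
    by (cases "queue_at t \<omega>") (auto simp: power2_eq_square algebra_simps)
  have Y_meas: "?Y \<in> borel_measurable P" unfolding Y_eq by measurable
  show iX: "integrable P ?X" using fm(1) by (intro integrableI_nn_integral_finite) auto
  show eX: "expectation ?X = m" using fm(1) m0 by (subst integral_eq_nn_integral) auto
  have iY: "integrable P ?Y" using fm(2) Y_meas by (intro integrableI_nn_integral_finite) auto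
  have eY: "expectation ?Y = m\<^sup>2" using fm(2) Y_meas by (subst integral_eq_nn_integral) auto
  have sq: "(?X \<omega> - m)\<^sup>2 = ?Y \<omega> + (1 - 2 * m) * ?X \<omega> + m\<^sup>2" for \<omega>
    unfolding Y_eq by (simp add: power2_eq_square algebra_simps)
  show "integrable P (\<lambda>\<omega>. (?X \<omega> - m)\<^sup>2)"
    unfolding sq using iX iY by (intro Bochner_Integration.integrable_add integrable_mult_right) auto
  have "expectation (\<lambda>\<omega>. (?X \<omega> - m)\<^sup>2) = m\<^sup>2 + (1 - 2 * m) * m + m\<^sup>2"
    unfolding sq using iX iY eX eY by (simp add: prob_space del: of_nat_mult)
  then show "expectation (\<lambda>\<omega>. (?X \<omega> - m)\<^sup>2) = m"
    by (simp add: power2_eq_square algebra_simps)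
qed

end

section \<open>The variance of the estimator\<close>

lemma iid_average_variance:
  fixes f :: "'w \<Rightarrow> real"
  assumes "prob_space P" and n: "n > 0"
    and f: "integrable P f" "(LINT x|P. f x) = m"
    and v: "integrable P (\<lambda>x. (f x - m)\<^sup>2)" "(LINT x|P. (f x - m)\<^sup>2) = v"
  shows "(\<integral>\<^sup>+\<omega>. ennreal (((\<Sum>k<n. f (\<omega> k)) / real n - m)\<^sup>2) \<partial>PiM {..<n} (\<lambda>_. P)) = ennreal (v / real n)"
proof -
  interpret P: prob_space P by fact
  interpret product_sigma_finite "\<lambda>_::nat. P" by unfold_locales
  let ?Q = "PiM {..<n} (\<lambda>_. P)"
  define Z where "Z x = f x - m" for x
  have iZ: "integrable P Z" unfolding Z_def using f by simp
  have EZ: "(LINT x|P. Z x) = 0" unfolding Z_def using f by (simp add: P.prob_space)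
  have iZ2: "integrable P (\<lambda>x. Z x * Z x)" using v(1) by (simp add: Z_def power2_eq_square)
  have EZ2: "(LINT x|P. Z x * Z x) = v" using v(2) by (simp add: Z_def power2_eq_square)
  \<comment> \<open>A product of one-coordinate functions equal to \<open>Z (\<omega> k) * Z
    (\<omega> l)\<close>, also when \<open>k = l\<close>.\<close>
  define h where "h k l i x = (if i = k then Z x else 1) * (if i = l then Z x else 1)" for k l i :: nat and x
  have ih: "integrable P (h k l i)" for k l i
    unfolding h_def[abs_def] using iZ iZ2 by (cases "i = k"; cases "i = l") auto
  have prod_h: "(\<Prod>i<n. h k l i (\<omega> i)) = Z (\<omega> k) * Z (\<omega> l)" if "k < n" "l < n" for k l \<omega>
    using that by (simp add: h_def prod.distrib)
  have int: "integrable ?Q (\<lambda>\<omega>. Z (\<omega> k) * Z (\<omega> l))" if "k < n" "l < n" for k l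
    using product_integrable_prod[of "{..<n}" "h k l"] ih prod_h[OF that] by simp
  have E: "(LINT \<omega>|?Q. Z (\<omega> k) * Z (\<omega> l)) = (if k = l then v else 0)" if kl: "k < n" "l < n" for k l
  proof -
    have *: "(LINT \<omega>|?Q. Z (\<omega> k) * Z (\<omega> l)) = (\<Prod>i<n. LINT x|P. h k l i x)"
      using product_integral_prod[of "{..<n}" "h k l"] ih prod_h[OF kl] by simp
    have hi: "(LINT x|P. h k l i x) = (if i = k \<and> i = l then v else if i = k \<or> i = l then 0 else 1)" for i
      using EZ EZ2 by (cases "i = k"; cases "i = l") (simp_all add: h_def P.prob_space)
    show ?thesis
    proof (cases "k = l")
      case True
      have "(\<Prod>i<n. LINT x|P. h k l i x) = (\<Prod>i<n. if i = k then v else 1)"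
        by (intro prod.cong refl, unfold hi) (simp add: True)
      then show ?thesis using kl True unfolding * by simp
    next
      case False
      then have "\<exists>i\<in>{..<n}. (LINT x|P. h k l i x) = 0" using kl(1) by (intro bexI[of _ k]) (auto simp: hi)
      then show ?thesis using False unfolding * by (simp add: prod_zero)
    qed
  qed
  have avg: "(\<Sum>k<n. f (\<omega> k)) / real n - m = (\<Sum>k<n. Z (\<omega> k)) / real n" for \<omega>
    using n by (simp add: Z_def sum_subtractf field_simps)
  have sq: "((\<Sum>k<n. f (\<omega> k)) / real n - m)\<^sup>2 = (\<Sum>k<n. \<Sum>l<n. Z (\<omega> k) * Z (\<omega> l)) / (real n)\<^sup>2" for \<omega>
    unfolding avg by (simp add: power_divide power2_eq_square sum_product)
  have i: "integrable ?Q (\<lambda>\<omega>. (\<Sum>k<n. \<Sum>l<n. Z (\<omega> k) * Z (\<omega> l)) / (real n)\<^sup>2)"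
    by (intro integrable_divide Bochner_Integration.integrable_sum int) auto
  have "(LINT \<omega>|?Q. (\<Sum>k<n. \<Sum>l<n. Z (\<omega> k) * Z (\<omega> l)) / (real n)\<^sup>2)
     = (LINT \<omega>|?Q. (\<Sum>k<n. \<Sum>l<n. Z (\<omega> k) * Z (\<omega> l))) / (real n)\<^sup>2"
    by (rule integral_divide_zero)
  also have "(LINT \<omega>|?Q. (\<Sum>k<n. \<Sum>l<n. Z (\<omega> k) * Z (\<omega> l))) = (\<Sum>k<n. LINT \<omega>|?Q. (\<Sum>l<n. Z (\<omega> k) * Z (\<omega> l)))"
    by (intro Bochner_Integration.integral_sum Bochner_Integration.integrable_sum int) auto
  also have "\<dots> = (\<Sum>k<n. \<Sum>l<n. LINT \<omega>|?Q. Z (\<omega> k) * Z (\<omega> l))"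
    by (intro sum.cong refl Bochner_Integration.integral_sum int) auto
  also have "\<dots> = (\<Sum>k<n. \<Sum>l<n. if k = l then v else 0)"
    by (intro sum.cong refl E) auto
  also have "\<dots> / (real n)\<^sup>2 = v / real n" using n by (simp add: power2_eq_square)
  finally have "(LINT \<omega>|?Q. ((\<Sum>k<n. f (\<omega> k)) / real n - m)\<^sup>2) = v / real n" unfolding sq .
  moreover have "integrable ?Q (\<lambda>\<omega>. ((\<Sum>k<n. f (\<omega> k)) / real n - m)\<^sup>2)"
    unfolding sq by (rule i)
  ultimately show ?thesis
    by (subst nn_integral_eq_integral) simp_all
qed

text \<open>The square on the left is a double integral, and \<open>2 |z z'| \<le> z'\<^sup>2 w
  / w' + z\<^sup>2 w' / w\<close> for its integrand.\<close>

lemma weighted_cauchy_schwarz: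
  fixes a z w :: "'x \<Rightarrow> real"
  assumes [measurable]: "a \<in> borel_measurable M" "z \<in> borel_measurable M" "w \<in> borel_measurable M"
    and a: "\<And>x. a x \<ge> 0" and w: "\<And>x. w x > 0"
  shows "(\<integral>\<^sup>+x. ennreal (a x * \<bar>z x\<bar>) \<partial>M)\<^sup>2
     \<le> (\<integral>\<^sup>+x. ennreal (a x * w x) \<partial>M) * (\<integral>\<^sup>+x. ennreal (a x * (z x)\<^sup>2 / w x) \<partial>M)"
proof -
  let ?A = "\<integral>\<^sup>+x. ennreal (a x * w x) \<partial>M" and ?B = "\<integral>\<^sup>+x. ennreal (a x * (z x)\<^sup>2 / w x) \<partial>M"
  have pw: "ennreal (a x * \<bar>z x\<bar>) * ennreal (a y * \<bar>z y\<bar>)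
      \<le> ennreal (1/2) * (ennreal (a x * w x) * ennreal (a y * (z y)\<^sup>2 / w y) + ennreal (a y * w y) * ennreal (a x * (z x)\<^sup>2 / w x))" for x y
  proof -
    have "2 * (\<bar>z x\<bar> * \<bar>z y\<bar>) \<le> w x * (z y)\<^sup>2 / w y + w y * (z x)\<^sup>2 / w x"
    proof -
      have "0 \<le> (w x * \<bar>z y\<bar> - w y * \<bar>z x\<bar>)\<^sup>2 / (w x * w y)" using w[of x] w[of y] by simp
      also have "\<dots> = w x * (z y)\<^sup>2 / w y + w y * (z x)\<^sup>2 / w x - 2 * (\<bar>z x\<bar> * \<bar>z y\<bar>)"
        using w[of x] w[of y] by (simp add: power2_eq_square field_simps abs_mult_self_eq)
      finally show ?thesis by simp
    qed
    then have "(a x * a y) * (\<bar>z x\<bar> * \<bar>z y\<bar>) \<le> (a x * a y) * (1/2 * (w x * (z y)\<^sup>2 / w y + w y * (z x)\<^sup>2 / w x))"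
      using a by (intro mult_left_mono) auto
    also have "\<dots> = 1/2 * (a x * w x * (a y * (z y)\<^sup>2 / w y) + a y * w y * (a x * (z x)\<^sup>2 / w x))"
      by (simp add: field_simps)
    finally have le: "(a x * \<bar>z x\<bar>) * (a y * \<bar>z y\<bar>)
       \<le> 1/2 * (a x * w x * (a y * (z y)\<^sup>2 / w y) + a y * w y * (a x * (z x)\<^sup>2 / w x))" by (simp add: mult_ac)
    have nn: "0 \<le> a x * w x" "0 \<le> a x * (z x)\<^sup>2 / w x" "0 \<le> a x * \<bar>z x\<bar>" for x
      using a[of x] w[of x] by (simp_all add: less_imp_le)
    have "ennreal (a x * \<bar>z x\<bar>) * ennreal (a y * \<bar>z y\<bar>) = ennreal ((a x * \<bar>z x\<bar>) * (a y * \<bar>z y\<bar>))"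
      by (rule ennreal_mult[symmetric]) (rule nn)+
    also have "\<dots> \<le> ennreal (1/2 * (a x * w x * (a y * (z y)\<^sup>2 / w y) + a y * w y * (a x * (z x)\<^sup>2 / w x)))"
      by (rule ennreal_leI[OF le])
    also have "\<dots> = ennreal (1/2) * (ennreal (a x * w x) * ennreal (a y * (z y)\<^sup>2 / w y) + ennreal (a y * w y) * ennreal (a x * (z x)\<^sup>2 / w x))"
      using nn by (simp only: ennreal_mult ennreal_plus mult_nonneg_nonneg add_nonneg_nonneg)
    finally show ?thesis .
  qed
  have "(\<integral>\<^sup>+x. ennreal (a x * \<bar>z x\<bar>) \<partial>M)\<^sup>2 = (\<integral>\<^sup>+x. \<integral>\<^sup>+y. ennreal (a x * \<bar>z x\<bar>) * ennreal (a y * \<bar>z y\<bar>) \<partial>M \<partial>M)"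
    by (simp add: power2_eq_square nn_integral_cmult nn_integral_multc)
  also have "\<dots> \<le> (\<integral>\<^sup>+x. \<integral>\<^sup>+y. ennreal (1/2) * (ennreal (a x * w x) * ennreal (a y * (z y)\<^sup>2 / w y) + ennreal (a y * w y) * ennreal (a x * (z x)\<^sup>2 / w x)) \<partial>M \<partial>M)"
    by (intro nn_integral_mono pw)
  also have "\<dots> = ennreal (1/2) * (?A * ?B + ?A * ?B)"
    by (simp add: nn_integral_cmult nn_integral_multc nn_integral_add)
  also have "\<dots> = ?A * ?B"
  proof -
    have "ennreal (1/2) * (c + c) = c" for c :: ennreal
    proof -
      have "ennreal (1/2) * (c + c) = (ennreal (1/2) * 2) * c" by (simp only: mult_2[symmetric] mult.assoc)
      also have "ennreal (1/2) * 2 = ennreal (1/2 * 2)" by (subst ennreal_mult) simp_all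
      finally show ?thesis by simp
    qed
    then show ?thesis .
  qed
  finally show ?thesis .
qed

context queue
begin

lemma queue_at_measurable_product:
  assumes "k < n"
  shows "(\<lambda>q. real (queue_at (snd q) (fst q k))) \<in> borel_measurable (PiM {..<n} (\<lambda>_. P) \<Otimes>\<^sub>M borel)"
proof -
  have "(\<lambda>q. (fst q k, snd q)) \<in> PiM {..<n} (\<lambda>_. P) \<Otimes>\<^sub>M borel \<rightarrow>\<^sub>M P \<Otimes>\<^sub>M borel"
    using assms by (intro measurable_Pair measurable_compose[OF measurable_fst] measurable_component_singleton) auto
  from measurable_compose[OF this queue_at_measurable_pair] show ?thesis by simp
qed

definition mean_length :: "real \<Rightarrow> real" where
  "mean_length t = (LINT x|lborel. lam x * tail (t - x))"

lemma mean_length_measurable [measurable]: "mean_length \<in> borel_measurable borel"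
  unfolding mean_length_def by measurable

lemma mean_length_nonneg: "mean_length t \<ge> 0"
  unfolding mean_length_def by (intro Bochner_Integration.integral_nonneg) (simp add: rate_nonneg tail_nonneg)

lemma queue_path_bounded: "AE \<omega> in P. \<exists>C. \<forall>t\<le>T. real (queue_at t \<omega>) \<le> C"
  using locally_finite
proof eventually_elim
  case (elim \<omega>)
  have "real (queue_at t \<omega>) \<le> real (card {j. \<tau> j \<omega> \<le> T})" if "t \<le> T" for t
    unfolding queue_length_def of_nat_le_iff using elim that by (intro card_mono) auto
  then show ?case by blast
qed

text \<open>The weight \<open>exp(a t / 2)\<close> in the Cauchy-Schwarz inequality balances the
  decay \<open>exp(- a t)\<close> of the kernel against the growth \<open>exp(a t)\<close> of
  the variance of the queue length. Only pointwise variances enter, no correlations in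
  time.\<close>

lemma estimator_stochastic_error:
  fixes J :: "real \<Rightarrow> complex"
  assumes n: "n > 0" and J [measurable]: "J \<in> borel_measurable borel"
    and a: "a > 0" and K: "K \<ge> 0" and c: "c \<ge> 0"
    and J_le: "\<And>t. t \<ge> 0 \<Longrightarrow> cmod (J t) \<le> K * exp (- (a * t))"
    and int: "\<And>t. integrable lborel (\<lambda>x. lam x * tail (t - x))"
    and m_le: "\<And>t. mean_length t \<le> c * exp (a * t)"
  shows "(\<integral>\<^sup>+\<omega>. ennreal ((cmod (1 / of_nat n * (\<Sum>k<n. LINT t:{0..T}|lborel. J t * of_nat (queue_at t (\<omega> k)))
       - (LINT t:{0..T}|lborel. J t * of_real (mean_length t))))\<^sup>2) \<partial>PiM {..<n} (\<lambda>_. P))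
     \<le> ennreal (c / real n * (K * (2 / a))\<^sup>2)"
proof -
  let ?Q = "PiM {..<n} (\<lambda>_. P)"
  let ?err = "\<lambda>\<omega>. 1 / of_nat n * (\<Sum>k<n. LINT t:{0..T}|lborel. J t * of_nat (queue_at t (\<omega> k)))
       - (LINT t:{0..T}|lborel. J t * of_real (mean_length t))"
  interpret Q: prob_space ?Q by (rule prob_space_PiM) (rule prob_space_axioms)
  interpret QL: pair_sigma_finite ?Q lborel ..
  define w where "w t = exp (a * t / 2)" for t :: real
  define Z where "Z t \<omega> = (\<Sum>k<n. real (queue_at t (\<omega> k))) / real n - mean_length t" for t \<omega>
  define A where "A t = indicator {0..T} t * cmod (J t)" for t
  have [measurable]: "A \<in> borel_measurable borel" "w \<in> borel_measurable borel"
    unfolding A_def w_def by measurable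
  have A0: "A t \<ge> 0" and w0: "w t > 0" for t by (simp_all add: A_def w_def)
  note qm = queue_at_measurable_product
  have Zm: "(\<lambda>q. Z (snd q) (fst q)) \<in> borel_measurable (?Q \<Otimes>\<^sub>M borel)"
    unfolding Z_def by (intro borel_measurable_diff borel_measurable_divide borel_measurable_sum qm) auto
  have Zt: "(\<lambda>\<omega>. Z t \<omega>) \<in> borel_measurable ?Q" for t
    using measurable_compose[OF _ Zm, of "\<lambda>\<omega>. (\<omega>, t)" ?Q] by simp
  have Z\<omega>: "(\<lambda>t. Z t \<omega>) \<in> borel_measurable borel" if "\<omega> \<in> space ?Q" for \<omega>
    using measurable_compose[OF _ Zm, of "\<lambda>t. (\<omega>, t)" borel] that by simp
  have J_mean: "set_integrable lborel {0..T} (\<lambda>t. J t * of_real (mean_length t))"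
  proof (rule set_integrable_bound)
    show "set_integrable lborel {0..T} (\<lambda>t. K * c)" by (intro borel_integrable_atLeastAtMost' continuous_intros)
    show "AE t in lborel. t \<in> {0..T} \<longrightarrow> norm (J t * of_real (mean_length t)) \<le> norm (K * c)"
    proof (intro AE_I2 impI)
      fix t assume "t \<in> {0..T}"
      then have "norm (J t * of_real (mean_length t)) \<le> (K * exp (- (a * t))) * (c * exp (a * t))"
        using J_le[of t] m_le[of t] mean_length_nonneg[of t] K by (simp add: norm_mult) (intro mult_mono, auto)
      also have "\<dots> = K * c * (exp (- (a * t)) * exp (a * t))" by simp
      finally show "norm (J t * of_real (mean_length t)) \<le> norm (K * c)" using K c by (simp add: mult_exp_exp)
    qed
  qed (simp add: set_borel_measurable_def)
  have path: "AE \<omega> in ?Q. \<forall>k\<in>{..<n}. \<exists>C. \<forall>t\<le>T. real (queue_at t (\<omega> k)) \<le> C"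
    by (intro AE_finite_allI AE_PiM_component[where P = "\<lambda>\<omega>. \<exists>C. \<forall>t\<le>T. real (queue_at t \<omega>) \<le> C"])
       (auto intro: prob_space_axioms queue_path_bounded)
  have err: "AE \<omega> in ?Q. ennreal (cmod (?err \<omega>)) \<le> (\<integral>\<^sup>+t. ennreal (A t * \<bar>Z t \<omega>\<bar>) \<partial>lborel)"
    using path AE_space
  proof eventually_elim
    case (elim \<omega>)
    have J_queue: "set_integrable lborel {0..T} (\<lambda>t. J t * of_nat (queue_at t (\<omega> k)))" if k: "k < n" for k
    proof -
      obtain C where C: "\<And>t. t \<le> T \<Longrightarrow> real (queue_at t (\<omega> k)) \<le> C" using elim(1) k by auto
      have "(\<lambda>t. real (queue_at t (\<omega> k))) \<in> borel_measurable borel"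
        using measurable_compose[OF _ qm[OF k], of "\<lambda>t. (\<omega>, t)" borel] elim(2) by simp
      then have "(\<lambda>t. complex_of_real (real (queue_at t (\<omega> k)))) \<in> borel_measurable borel"
        by measurable
      then have [measurable]: "(\<lambda>t. complex_of_nat (queue_at t (\<omega> k))) \<in> borel_measurable borel"
        by simp
      have "set_integrable lborel {0..T} (\<lambda>t. J t * complex_of_real (real (queue_at t (\<omega> k))))"
      proof (rule set_integrable_bound)
        show "set_integrable lborel {0..T} (\<lambda>t. K * C)" by (intro borel_integrable_atLeastAtMost' continuous_intros)
        show "AE t in lborel. t \<in> {0..T} \<longrightarrow> norm (J t * complex_of_real (real (queue_at t (\<omega> k)))) \<le> norm (K * C)"
        proof (intro AE_I2 impI)
          fix t assume t: "t \<in> {0..T}"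
          have "0 \<le> C" using C[of T] by (metis of_nat_0_le_iff order_trans order_refl)
          have "cmod (J t) \<le> K * 1"
            using t a K by (intro order_trans[OF J_le] mult_left_mono) auto
          then have "cmod (J t) * real (queue_at t (\<omega> k)) \<le> K * C"
            using C[of t] t K by (intro mult_mono) auto
          then show "norm (J t * complex_of_real (real (queue_at t (\<omega> k)))) \<le> norm (K * C)"
            using K \<open>0 \<le> C\<close> by (simp add: norm_mult)
        qed
      qed (simp add: set_borel_measurable_def)
      then show ?thesis by simp
    qed
    have JZ: "1 / of_nat n * (\<Sum>k<n. J t * of_nat (queue_at t (\<omega> k))) - J t * of_real (mean_length t) = J t * of_real (Z t \<omega>)" for t
      by (simp add: Z_def sum_distrib_left[symmetric] right_diff_distrib)
    have "?err \<omega>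
      = (LINT t:{0..T}|lborel. 1 / of_nat n * (\<Sum>k<n. J t * of_nat (queue_at t (\<omega> k))) - J t * of_real (mean_length t))"
    proof -
      have "set_integrable lborel {0..T} (\<lambda>t. \<Sum>k<n. J t * of_nat (queue_at t (\<omega> k)))"
        using J_queue unfolding set_integrable_def scaleR_sum_right by (intro Bochner_Integration.integrable_sum) auto
      moreover have "(LINT t:{0..T}|lborel. (\<Sum>k<n. J t * of_nat (queue_at t (\<omega> k))))
          = (\<Sum>k<n. LINT t:{0..T}|lborel. J t * of_nat (queue_at t (\<omega> k)))"
        using J_queue unfolding set_integrable_def set_lebesgue_integral_def scaleR_sum_right
        by (intro Bochner_Integration.integral_sum) auto
      ultimately show ?thesis
        using J_mean by (simp only: set_integral_diff(2) set_integrable_mult_right set_integral_mult_right)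
    qed
    also have "\<dots> = (LINT t:{0..T}|lborel. J t * of_real (Z t \<omega>))"
      by (simp only: JZ)
    also have "ennreal (cmod \<dots>) \<le> (\<integral>\<^sup>+t. ennreal (norm (indicator {0..T} t *\<^sub>R (J t * of_real (Z t \<omega>)))) \<partial>lborel)"
      unfolding set_lebesgue_integral_def
    proof (rule integral_norm_bound_ennreal)
      have "set_integrable lborel {0..T} (\<lambda>t. 1 / of_nat n * (\<Sum>k<n. J t * of_nat (queue_at t (\<omega> k))) - J t * of_real (mean_length t))"
      proof (intro set_integral_diff J_mean set_integrable_mult_right)
        show "set_integrable lborel {0..T} (\<lambda>t. \<Sum>k<n. J t * of_nat (queue_at t (\<omega> k)))"
          using J_queue unfolding set_integrable_def scaleR_sum_right by (intro Bochner_Integration.integrable_sum) auto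
      qed
      then show "integrable lborel (\<lambda>t. indicator {0..T} t *\<^sub>R (J t * of_real (Z t \<omega>)))"
        unfolding JZ set_integrable_def .
    qed
    also have "\<dots> = (\<integral>\<^sup>+t. ennreal (A t * \<bar>Z t \<omega>\<bar>) \<partial>lborel)"
      by (intro nn_integral_cong) (simp add: A_def norm_mult mult.assoc)
    finally show ?case .
  qed
  have Aw: "(\<integral>\<^sup>+t. ennreal (A t * w t) \<partial>lborel) \<le> ennreal (K * (2 / a))"
  proof -
    have half: "a / 2 > 0" using a by simp
    have "(\<integral>\<^sup>+t. ennreal (A t * w t) \<partial>lborel) \<le> (\<integral>\<^sup>+t. ennreal (K * (indicator {0..} t *\<^sub>R exp (- (a / 2 * t)))) \<partial>lborel)"
    proof (intro nn_integral_mono ennreal_leI)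
      fix t
      have "cmod (J t) * w t \<le> K * exp (- (a / 2 * t))" if "t \<ge> 0"
      proof -
        have "cmod (J t) * w t \<le> (K * exp (- (a * t))) * w t"
          using J_le[OF that] w0[of t] by (intro mult_right_mono) auto
        also have "\<dots> = K * (exp (- (a * t)) * exp (a * t / 2))" by (simp add: w_def)
        also have "exp (- (a * t)) * exp (a * t / 2) = exp (- (a / 2 * t))" by (simp add: mult_exp_exp field_simps)
        finally show ?thesis .
      qed
      then show "A t * w t \<le> K * (indicator {0..} t *\<^sub>R exp (- (a / 2 * t)))"
        using K by (auto simp: A_def indicator_def)
    qed
    also have "\<dots> = ennreal (LINT t|lborel. K * (indicator {0..} t *\<^sub>R exp (- (a / 2 * t))))"
      using set_integral_exp_tail(1)[OF half, of 0] K unfolding set_integrable_def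
      by (intro nn_integral_eq_integral integrable_mult_right) auto
    also have "(LINT t|lborel. K * (indicator {0..} t *\<^sub>R exp (- (a / 2 * t)))) = K * (2 / a)"
      using set_integral_exp_tail(2)[OF half, of 0] by (simp add: set_lebesgue_integral_def)
    finally show ?thesis .
  qed
  have var: "(\<integral>\<^sup>+\<omega>. ennreal ((Z t \<omega>)\<^sup>2) \<partial>?Q) = ennreal (mean_length t / real n)" for t
    unfolding Z_def using queue_mean_variance[OF int[of t]]
    by (intro iid_average_variance[OF prob_space_axioms n]) (simp_all add: mean_length_def)
  have "(\<integral>\<^sup>+\<omega>. \<integral>\<^sup>+t. ennreal (A t * (Z t \<omega>)\<^sup>2 / w t) \<partial>lborel \<partial>?Q)
      = (\<integral>\<^sup>+t. \<integral>\<^sup>+\<omega>. ennreal (A t * (Z t \<omega>)\<^sup>2 / w t) \<partial>?Q \<partial>lborel)"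
  proof -
    have "(\<lambda>q. ennreal (A (snd q) * (Z (snd q) (fst q))\<^sup>2 / w (snd q))) \<in> borel_measurable (?Q \<Otimes>\<^sub>M lborel)"
      using Zm by measurable
    from QL.Fubini[OF this] show ?thesis by simp
  qed
  also have "\<dots> \<le> (\<integral>\<^sup>+t. ennreal (c / real n) * ennreal (A t * w t) \<partial>lborel)"
  proof (rule nn_integral_mono)
    fix t
    have "(\<integral>\<^sup>+\<omega>. ennreal (A t * (Z t \<omega>)\<^sup>2 / w t) \<partial>?Q) = (\<integral>\<^sup>+\<omega>. ennreal (A t / w t) * ennreal ((Z t \<omega>)\<^sup>2) \<partial>?Q)"
      using A0[of t] w0[of t] by (intro nn_integral_cong) (simp add: ennreal_mult[symmetric])
    also have "\<dots> = ennreal (A t / w t) * ennreal (mean_length t / real n)"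
      using Zt[of t] by (subst nn_integral_cmult) (auto simp: var)
    also have "\<dots> = ennreal (A t / w t * (mean_length t / real n))"
      using A0[of t] w0[of t] mean_length_nonneg[of t] by (subst ennreal_mult) auto
    also have "\<dots> \<le> ennreal (A t / w t * (c * exp (a * t) / real n))"
      using A0[of t] w0[of t] n by (intro ennreal_leI mult_left_mono divide_right_mono m_le) auto
    also have "A t / w t * (c * exp (a * t) / real n) = c / real n * (A t * w t)"
    proof -
      have "exp (a * t) = w t * w t" by (simp add: w_def mult_exp_exp)
      then show ?thesis using w0[of t] by simp
    qed
    also have "ennreal \<dots> = ennreal (c / real n) * ennreal (A t * w t)"
      using c A0[of t] w0[of t] by (intro ennreal_mult) auto
    finally show "(\<integral>\<^sup>+\<omega>. ennreal (A t * (Z t \<omega>)\<^sup>2 / w t) \<partial>?Q) \<le> ennreal (c / real n) * ennreal (A t * w t)" .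
  qed
  also have "\<dots> = ennreal (c / real n) * (\<integral>\<^sup>+t. ennreal (A t * w t) \<partial>lborel)"
    by (rule nn_integral_cmult) measurable
  also have "\<dots> \<le> ennreal (c / real n) * ennreal (K * (2 / a))"
    by (intro mult_left_mono Aw) simp
  finally have sec: "(\<integral>\<^sup>+\<omega>. \<integral>\<^sup>+t. ennreal (A t * (Z t \<omega>)\<^sup>2 / w t) \<partial>lborel \<partial>?Q) \<le> ennreal (c / real n) * ennreal (K * (2 / a))" .
  have "(\<integral>\<^sup>+\<omega>. ennreal ((cmod (?err \<omega>))\<^sup>2) \<partial>?Q)
     \<le> (\<integral>\<^sup>+\<omega>. ennreal (K * (2 / a)) * (\<integral>\<^sup>+t. ennreal (A t * (Z t \<omega>)\<^sup>2 / w t) \<partial>lborel) \<partial>?Q)"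
  proof (rule nn_integral_mono_AE)
    show "AE \<omega> in ?Q. ennreal ((cmod (?err \<omega>))\<^sup>2) \<le> ennreal (K * (2 / a)) * (\<integral>\<^sup>+t. ennreal (A t * (Z t \<omega>)\<^sup>2 / w t) \<partial>lborel)"
      using err AE_space
    proof eventually_elim
      case (elim \<omega>)
      note [measurable] = Z\<omega>[OF elim(2)]
      let ?e = "cmod (?err \<omega>)"
      have "ennreal (?e\<^sup>2) = (ennreal ?e)\<^sup>2" by (simp add: ennreal_power)
      also have "\<dots> \<le> (\<integral>\<^sup>+t. ennreal (A t * \<bar>Z t \<omega>\<bar>) \<partial>lborel)\<^sup>2"
        by (intro power_mono elim(1)) simp
      also have "\<dots> \<le> (\<integral>\<^sup>+t. ennreal (A t * w t) \<partial>lborel) * (\<integral>\<^sup>+t. ennreal (A t * (Z t \<omega>)\<^sup>2 / w t) \<partial>lborel)"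
        by (rule weighted_cauchy_schwarz) (use A0 w0 in auto)
      also have "\<dots> \<le> ennreal (K * (2 / a)) * (\<integral>\<^sup>+t. ennreal (A t * (Z t \<omega>)\<^sup>2 / w t) \<partial>lborel)"
        by (intro mult_right_mono Aw) simp
      finally show ?case .
    qed
  qed
  also have "\<dots> = ennreal (K * (2 / a)) * (\<integral>\<^sup>+\<omega>. \<integral>\<^sup>+t. ennreal (A t * (Z t \<omega>)\<^sup>2 / w t) \<partial>lborel \<partial>?Q)"
  proof (rule nn_integral_cmult)
    have "(\<lambda>q. ennreal (A (snd q) * (Z (snd q) (fst q))\<^sup>2 / w (snd q))) \<in> borel_measurable (?Q \<Otimes>\<^sub>M lborel)"
      using Zm by measurable
    from lborel.borel_measurable_nn_integral_fst[OF this]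
    show "(\<lambda>\<omega>. \<integral>\<^sup>+t. ennreal (A t * (Z t \<omega>)\<^sup>2 / w t) \<partial>lborel) \<in> borel_measurable ?Q" by simp
  qed
  also have "\<dots> \<le> ennreal (K * (2 / a)) * (ennreal (c / real n) * ennreal (K * (2 / a)))"
    by (intro mult_left_mono sec) simp
  also have "\<dots> = ennreal (c / real n * (K * (2 / a))\<^sup>2)"
    using K c a by (simp add: ennreal_mult[symmetric] power2_eq_square mult_ac)
  finally show ?thesis .
qed

lemma estimator_measurable:
  fixes J :: "real \<Rightarrow> complex"
  assumes [measurable]: "J \<in> borel_measurable borel"
  shows "(\<lambda>\<omega>. 1 / of_nat n * (\<Sum>k<n. LINT t:{0..T}|lborel. J t * of_nat (queue_at t (\<omega> k)))) \<in> borel_measurable (PiM {..<n} (\<lambda>_. P))"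
proof (intro borel_measurable_times borel_measurable_sum borel_measurable_const)
  fix k assume "k \<in> {..<n}"
  then have [measurable]: "(\<lambda>q. real (queue_at (snd q) (fst q k))) \<in> borel_measurable (PiM {..<n} (\<lambda>_. P) \<Otimes>\<^sub>M borel)"
    by (intro queue_at_measurable_product) simp
  have "(\<lambda>(\<omega>, t). indicator {0..T} t *\<^sub>R (J t * complex_of_real (real (queue_at t (\<omega> k))))) \<in> borel_measurable (PiM {..<n} (\<lambda>_. P) \<Otimes>\<^sub>M lborel)"
    unfolding split_beta' by measurable
  from lborel.borel_measurable_lebesgue_integral[OF this]
  show "(\<lambda>\<omega>. LINT t:{0..T}|lborel. J t * of_nat (queue_at t (\<omega> k))) \<in> borel_measurable (PiM {..<n} (\<lambda>_. P))"
    by (simp add: set_lebesgue_integral_def)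
qed

lemma estimator_mean_square_error:
  fixes J :: "real \<Rightarrow> complex"
  assumes n: "n > 0" and J: "J \<in> borel_measurable borel"
    and a: "a > 0" and K: "K \<ge> 0" and c: "c \<ge> 0"
    and J_le: "\<And>t. t \<ge> 0 \<Longrightarrow> cmod (J t) \<le> K * exp (- (a * t))"
    and int: "\<And>t. integrable lborel (\<lambda>x. lam x * tail (t - x))"
    and m_le: "\<And>t. mean_length t \<le> c * exp (a * t)"
    and bias: "cmod ((LINT t:{0..T}|lborel. J t * of_real (mean_length t)) - \<mu>) \<le> B"
  shows "(\<integral>\<^sup>+\<omega>. ennreal ((cmod (1 / of_nat n * (\<Sum>k<n. LINT t:{0..T}|lborel. J t * of_nat (queue_at t (\<omega> k))) - \<mu>))\<^sup>2) \<partial>PiM {..<n} (\<lambda>_. P))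
     \<le> ennreal (2 * B\<^sup>2 + 2 * (c / real n * (K * (2 / a))\<^sup>2))"
proof -
  let ?Q = "PiM {..<n} (\<lambda>_. P)"
  interpret Q: prob_space ?Q by (rule prob_space_PiM) (rule prob_space_axioms)
  let ?e = "\<lambda>\<omega>. 1 / of_nat n * (\<Sum>k<n. LINT t:{0..T}|lborel. J t * of_nat (queue_at t (\<omega> k)))"
  let ?a = "LINT t:{0..T}|lborel. J t * of_real (mean_length t)"
  have em: "?e \<in> borel_measurable ?Q" by (rule estimator_measurable[OF J])
  have em': "(\<lambda>\<omega>. ennreal ((cmod (?e \<omega> - ?a))\<^sup>2)) \<in> borel_measurable ?Q"
    by (intro measurable_compose[OF _ measurable_ennreal] borel_measurable_power
          measurable_compose[OF _ borel_measurable_norm] borel_measurable_diff em borel_measurable_const)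
  have "(\<integral>\<^sup>+\<omega>. ennreal ((cmod (?e \<omega> - \<mu>))\<^sup>2) \<partial>?Q) \<le> (\<integral>\<^sup>+\<omega>. ennreal (2 * B\<^sup>2) + ennreal 2 * ennreal ((cmod (?e \<omega> - ?a))\<^sup>2) \<partial>?Q)"
  proof (rule nn_integral_mono)
    fix \<omega>
    have "cmod (?e \<omega> - \<mu>) \<le> cmod (?e \<omega> - ?a) + cmod (?a - \<mu>)"
      using norm_triangle_ineq[of "?e \<omega> - ?a" "?a - \<mu>"] by simp
    also have "\<dots> \<le> cmod (?e \<omega> - ?a) + B" using bias by simp
    finally have "(cmod (?e \<omega> - \<mu>))\<^sup>2 \<le> (cmod (?e \<omega> - ?a) + B)\<^sup>2" by (intro power_mono) auto
    also have "\<dots> \<le> 2 * B\<^sup>2 + 2 * (cmod (?e \<omega> - ?a))\<^sup>2"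
      using zero_le_power2[of "cmod (?e \<omega> - ?a) - B"] by (simp add: power2_eq_square algebra_simps)
    finally have "ennreal ((cmod (?e \<omega> - \<mu>))\<^sup>2) \<le> ennreal (2 * B\<^sup>2 + 2 * (cmod (?e \<omega> - ?a))\<^sup>2)"
      by (rule ennreal_leI)
    also have "\<dots> = ennreal (2 * B\<^sup>2) + ennreal 2 * ennreal ((cmod (?e \<omega> - ?a))\<^sup>2)"
      by (simp only: ennreal_mult[symmetric] ennreal_plus[symmetric] zero_le_power2 zero_le_mult_iff zero_le_numeral simp_thms)
    finally show "ennreal ((cmod (?e \<omega> - \<mu>))\<^sup>2) \<le> ennreal (2 * B\<^sup>2) + ennreal 2 * ennreal ((cmod (?e \<omega> - ?a))\<^sup>2)" .
  qed
  also have "\<dots> = ennreal (2 * B\<^sup>2) + ennreal 2 * (\<integral>\<^sup>+\<omega>. ennreal ((cmod (?e \<omega> - ?a))\<^sup>2) \<partial>?Q)"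
    using em' by (subst nn_integral_add) (simp_all add: nn_integral_cmult Q.emeasure_space_1 del: ennreal_numeral)
  also have "\<dots> \<le> ennreal (2 * B\<^sup>2) + ennreal 2 * ennreal (c / real n * (K * (2 / a))\<^sup>2)"
    by (intro add_left_mono mult_left_mono estimator_stochastic_error[OF n J a K c J_le int m_le]) auto
  also have "\<dots> = ennreal (2 * B\<^sup>2 + 2 * (c / real n * (K * (2 / a))\<^sup>2))"
    using c K a by (simp only: ennreal_mult[symmetric] ennreal_plus[symmetric] zero_le_power2 zero_le_mult_iff zero_le_divide_iff of_nat_0_le_iff zero_le_numeral simp_thms)
  finally show ?thesis .
qed

end

section \<open>Asymptotics\<close>

text \<open>The cutoff bias is \<open>\<phi> n\<close> times a factor tending to 1. With
  \<open>\<delta> = 1 / L n\<close> the truncation error and the root mean square of the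
  stochastic error are \<open>o(\<phi> n)\<close>: the exponential of \<open>2 \<sigma> (b n +
  1/4)\<close> is \<open>n / (L n)\<^sup>3\<close> up to a constant, the extra
  \<open>\<delta>\<close> costs only a bounded factor, and \<open>T n > (L n)\<^sup>2\<close>
  eventually.\<close>

lemma risk_bound_asymptotics:
  fixes \<sigma> \<gamma> M lam0 D :: real and T :: "nat \<Rightarrow> real"
  assumes pos: "\<sigma> > 0" "M > 0" "lam0 > 0" "D > 0"
    and T: "filterlim T at_top sequentially"
    and lnT: "(\<lambda>n. 1 / T n * (ln (lam0 * real n))\<^sup>2) \<longlonglongrightarrow> 0"
  defines "L \<equiv> \<lambda>n. ln (\<sigma> powr (- 2 * \<gamma> + 1) * M * lam0 * real n)"
    and "b \<equiv> b_star \<sigma> \<gamma> M lam0" and "\<phi> \<equiv> rate_phi \<sigma> \<gamma> M lam0"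
  defines "K \<equiv> \<lambda>n. D * exp ((\<sigma> + 1 / L n) * (b n + 1/4))"
  shows "eventually (\<lambda>n. n > 0 \<and> b n \<ge> 1/4 \<and> L n > 0 \<and> \<phi> n > 0 \<and>
    2 * (M / (2 * b n) + K n * lam0 * M * exp (- (1 / L n * T n)) / (1 / L n))\<^sup>2
      + 2 * (lam0 * M / real n * (K n * (2 / \<sigma>))\<^sup>2) \<le> (2 * \<phi> n)\<^sup>2) sequentially"
proof -
  define c where "c = \<sigma> powr (- 2 * \<gamma> + 1) * M * lam0"
  have c: "c > 0" using pos by (simp add: c_def)
  have L_eq: "L n = ln (c * real n)" for n by (simp add: L_def c_def)
  have L_lim: "filterlim L at_top sequentially"
    unfolding L_eq[abs_def] using c by real_asymp
  define \<beta> where "\<beta> x = (x - 3 * ln (1 / (2 * \<sigma>) * x)) / (2 * \<sigma>)" for x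
  have b_eq: "b n = \<beta> (L n) - 1/4" for n
    by (simp add: b_def b_star_def L_def \<beta>_def Let_def)
  have \<phi>_eq: "\<phi> n = M * \<sigma> / L n" for n
  proof -
    have "M * lam0 * real n / \<sigma> powr (2 * \<gamma> - 1) = \<sigma> powr (- 2 * \<gamma> + 1) * M * lam0 * real n"
    proof -
      have "- 2 * \<gamma> + 1 = - (2 * \<gamma> - 1)" by simp
      then have "\<sigma> powr (- 2 * \<gamma> + 1) = inverse (\<sigma> powr (2 * \<gamma> - 1))"
        by (simp only: powr_minus)
      then show ?thesis by (simp add: divide_inverse)
    qed
    then show ?thesis by (simp only: \<phi>_def rate_phi_def L_def) (simp add: divide_inverse)
  qed
  define F where "F = D\<^sup>2 * exp (1 / \<sigma>) * (2 * \<sigma>) ^ 3"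
  have F: "F > 0" using pos by (simp add: F_def)
  define C2 where "C2 = lam0 * 4 * F * c / (M * \<sigma> ^ 4)"

  \<comment> \<open>The tolerances are chosen so that \<open>2 (11/10 + 1/10)\<^sup>2 + 2/10
    \<le> 2\<^sup>2\<close>.\<close>
  have e1: "\<forall>\<^sub>F x in at_top. x / (2 * \<sigma> * (\<beta> x - 1/4)) \<le> 11/10"
  proof -
    have "((\<lambda>x. x / (2 * \<sigma> * (\<beta> x - 1/4))) \<longlongrightarrow> 1) at_top"
      unfolding \<beta>_def using pos(1) by real_asymp
    then have "\<forall>\<^sub>F x in at_top. x / (2 * \<sigma> * (\<beta> x - 1/4)) < 11/10"
      by (rule order_tendstoD(2)) simp
    then show ?thesis by eventually_elim simp
  qed
  have e2: "\<forall>\<^sub>F x in at_top. sqrt F * lam0 / \<sigma> * (x\<^sup>2 * exp (- x / 2)) \<le> 1/10"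
  proof -
    have "((\<lambda>x. sqrt F * lam0 / \<sigma> * (x\<^sup>2 * exp (- x / 2))) \<longlongrightarrow> sqrt F * lam0 / \<sigma> * 0) at_top"
      by (intro tendsto_mult tendsto_const) real_asymp
    then have "\<forall>\<^sub>F x in at_top. sqrt F * lam0 / \<sigma> * (x\<^sup>2 * exp (- x / 2)) < 1/10"
      by (rule order_tendstoD(2)) simp
    then show ?thesis by eventually_elim simp
  qed
  have e3: "\<forall>\<^sub>F x in at_top. C2 / x \<le> 1/10"
  proof -
    have "((\<lambda>x. C2 / x) \<longlongrightarrow> 0) at_top" by real_asymp
    then have "\<forall>\<^sub>F x in at_top. C2 / x < 1/10" by (rule order_tendstoD(2)) simp
    then show ?thesis by eventually_elim simp
  qed
  have e4: "\<forall>\<^sub>F x in at_top. \<beta> x \<ge> 1/2"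
    unfolding \<beta>_def using pos(1) by real_asymp
  have e5: "\<forall>\<^sub>F n in sequentially. (L n)\<^sup>2 < T n \<and> T n > 0"
  proof -
    define d where "d = ln (c / lam0)"
    have "\<forall>\<^sub>F n in sequentially. 1 / T n * (ln (lam0 * real n))\<^sup>2 < 1/4"
      using lnT by (rule order_tendstoD(2)) simp
    moreover have "\<forall>\<^sub>F n in sequentially. T n > max 0 (4 * d\<^sup>2)"
      using T by (simp add: filterlim_at_top_dense)
    ultimately show ?thesis using eventually_gt_at_top[of 0]
    proof eventually_elim
      case (elim n)
      have Ln: "L n = ln (lam0 * real n) + d"
        using elim c pos by (simp add: L_eq d_def ln_mult ln_div)
      have "(ln (lam0 * real n))\<^sup>2 < T n / 4" using elim by (simp add: field_simps)
      moreover have "d\<^sup>2 < T n / 4" using elim by simp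
      moreover have "(L n)\<^sup>2 \<le> 2 * (ln (lam0 * real n))\<^sup>2 + 2 * d\<^sup>2"
        unfolding Ln using zero_le_power2[of "ln (lam0 * real n) - d"]
        by (simp add: power2_eq_square algebra_simps)
      moreover have "T n > 0" using elim(2) max.cobounded1[of 0 "4 * d\<^sup>2"] by linarith
      ultimately show ?case by simp
    qed
  qed
  have e6: "\<forall>\<^sub>F x in at_top. x \<ge> max 1 (2 * \<sigma>)" by (rule eventually_ge_at_top)
  note on_L = eventually_compose_filterlim[OF _ L_lim]
  show ?thesis
    using on_L[OF e1] on_L[OF e2] on_L[OF e3] on_L[OF e4] e5 on_L[OF e6] eventually_gt_at_top[of "0::nat"]
  proof eventually_elim
    case (elim n)
    define x where "x = L n"
    have x: "x \<ge> 1" "x \<ge> 2 * \<sigma>" using elim by (auto simp: x_def)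
    have n: "real n > 0" using elim by simp
    have ex: "exp x = c * real n" using c n by (simp add: x_def L_eq)
    have bn: "b n = \<beta> x - 1/4" by (simp add: b_eq x_def)
    have b_ge: "b n \<ge> 1/4" using elim(4) by (simp add: bn x_def)
    have \<phi>n: "\<phi> n = M * \<sigma> / x" by (simp add: \<phi>_eq x_def)
    have \<phi>_pos: "\<phi> n > 0" using pos x by (simp add: \<phi>n)
    have K_pos: "K n > 0" using pos by (simp add: K_def)
    have K_sq: "(K n)\<^sup>2 \<le> F * exp x / x ^ 3"
    proof -
      have ln0: "ln (1 / (2 * \<sigma>) * x) \<ge> 0" using x pos by (intro ln_ge_zero) simp
      have "\<beta> x / x \<le> 1 / (2 * \<sigma>)"
        using ln0 x pos by (simp add: \<beta>_def field_simps)
      then have "2 * (\<beta> x / x) \<le> 1 / \<sigma>" by simp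
      then have 1: "exp (2 * (\<beta> x / x)) \<le> exp (1 / \<sigma>)" by simp
      \<comment> \<open>The logarithmic correction in the definition of
        \<open>b\<^sub>*\<close> is what produces the factor
        \<open>x\<^sup>-\<^sup>3\<close>.\<close>
      have "2 * \<sigma> * \<beta> x = x - 3 * ln (x / (2 * \<sigma>))" using pos by (simp add: \<beta>_def)
      then have "exp (2 * \<sigma> * \<beta> x) = exp x / exp (3 * ln (x / (2 * \<sigma>)))" by (simp add: exp_diff)
      also have "exp (3 * ln (x / (2 * \<sigma>))) = (x / (2 * \<sigma>)) ^ 3"
        using x pos exp_of_nat_mult[of 3 "ln (x / (2 * \<sigma>))"] by simp
      finally have 2: "exp (2 * \<sigma> * \<beta> x) = exp x * (2 * \<sigma>) ^ 3 / x ^ 3" by (simp add: power_divide)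
      have "(K n)\<^sup>2 = D\<^sup>2 * (exp (2 * \<sigma> * \<beta> x) * exp (2 * (\<beta> x / x)))"
      proof -
        have "K n = D * exp ((\<sigma> + 1 / x) * \<beta> x)" by (simp add: K_def bn x_def)
        then have "(K n)\<^sup>2 = D\<^sup>2 * exp (2 * ((\<sigma> + 1 / x) * \<beta> x))"
          by (simp add: power_mult_distrib exp_double)
        also have "2 * ((\<sigma> + 1 / x) * \<beta> x) = 2 * \<sigma> * \<beta> x + 2 * (\<beta> x / x)" by (simp add: algebra_simps)
        finally show ?thesis by (simp only: exp_add)
      qed
      also have "\<dots> \<le> D\<^sup>2 * (exp (2 * \<sigma> * \<beta> x) * exp (1 / \<sigma>))"
        using 1 by (intro mult_left_mono) auto
      also have "\<dots> = F * exp x / x ^ 3" unfolding 2 F_def by simp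
      finally show ?thesis .
    qed
    have K_le: "K n \<le> sqrt F * exp (x / 2)"
    proof (rule power2_le_imp_le)
      have "(K n)\<^sup>2 \<le> F * exp x / 1"
        using F x by (intro order_trans[OF K_sq] divide_left_mono) auto
      also have "\<dots> = (sqrt F * exp (x / 2))\<^sup>2" using F by (simp add: power_mult_distrib exp_double[symmetric])
      finally show "(K n)\<^sup>2 \<le> (sqrt F * exp (x / 2))\<^sup>2" .
    qed (use F in simp)
    have main: "M / (2 * b n) \<le> 11/10 * \<phi> n"
    proof -
      have "M / (2 * b n) = \<phi> n * (x / (2 * \<sigma> * (\<beta> x - 1/4)))"
        using pos x by (simp add: \<phi>n bn)
      also have "\<dots> \<le> \<phi> n * (11/10)" using elim(1) \<phi>_pos by (intro mult_left_mono) (auto simp: x_def)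
      finally show ?thesis by simp
    qed
    have tail: "K n * lam0 * M * exp (- (1 / x * T n)) / (1 / x) \<le> 1/10 * \<phi> n"
    proof -
      have "x \<le> 1 / x * T n" using elim(5) x by (simp add: x_def field_simps power2_eq_square)
      then have "K n * exp (- (1 / x * T n)) \<le> (sqrt F * exp (x / 2)) * exp (- x)"
        using K_le K_pos by (intro mult_mono) auto
      also have "\<dots> = sqrt F * exp (- x / 2)" by (simp add: mult.assoc mult_exp_exp)
      finally have "K n * exp (- (1 / x * T n)) \<le> sqrt F * exp (- x / 2)" .
      then have "(K n * exp (- (1 / x * T n))) * (lam0 * M * x) \<le> (sqrt F * exp (- x / 2)) * (lam0 * M * x)"
        using pos x by (intro mult_right_mono) auto
      also have "\<dots> = \<phi> n * (sqrt F * lam0 / \<sigma> * (x\<^sup>2 * exp (- x / 2)))"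
        using pos x by (simp add: \<phi>n power2_eq_square)
      also have "\<dots> \<le> \<phi> n * (1/10)" using elim(2) \<phi>_pos by (intro mult_left_mono) (auto simp: x_def)
      finally show ?thesis by (simp add: mult_ac)
    qed
    have var: "lam0 * M / real n * (K n * (2 / \<sigma>))\<^sup>2 \<le> 1/10 * (\<phi> n)\<^sup>2"
    proof -
      have "lam0 * M / real n * (K n * (2 / \<sigma>))\<^sup>2 = lam0 * M / real n * (4 / \<sigma>\<^sup>2) * (K n)\<^sup>2"
        by (simp add: power_mult_distrib power_divide)
      also have "\<dots> \<le> lam0 * M / real n * (4 / \<sigma>\<^sup>2) * (F * exp x / x ^ 3)"
        using pos n by (intro mult_left_mono K_sq) auto
      also have "\<dots> = (\<phi> n)\<^sup>2 * (C2 / x)"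
        using pos n x unfolding ex \<phi>n C2_def by (simp add: power2_eq_square power3_eq_cube power4_eq_xxxx mult_ac)
      also have "\<dots> \<le> (\<phi> n)\<^sup>2 * (1/10)" using elim(3) by (intro mult_left_mono) (auto simp: x_def)
      finally show ?thesis by simp
    qed
    have nonneg: "0 \<le> M / (2 * b n) + K n * lam0 * M * exp (- (1 / x * T n)) / (1 / x)"
      using pos x b_ge K_pos by simp
    have "M / (2 * b n) + K n * lam0 * M * exp (- (1 / x * T n)) / (1 / x) \<le> 12/10 * \<phi> n"
      using main tail by simp
    then have "(M / (2 * b n) + K n * lam0 * M * exp (- (1 / x * T n)) / (1 / x))\<^sup>2 \<le> (12/10 * \<phi> n)\<^sup>2"
      using nonneg by (rule power_mono)
    then have "2 * (M / (2 * b n) + K n * lam0 * M * exp (- (1 / x * T n)) / (1 / x))\<^sup>2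
      + 2 * (lam0 * M / real n * (K n * (2 / \<sigma>))\<^sup>2) \<le> 2 * (12/10 * \<phi> n)\<^sup>2 + 2 * (1/10 * (\<phi> n)\<^sup>2)"
      using var by linarith
    also have "\<dots> \<le> (2 * \<phi> n)\<^sup>2" by (simp add: power2_eq_square)
    finally show ?case using n b_ge \<phi>_pos x by (simp add: x_def)
  qed
qed

section \<open>The maximal risk\<close>

lemma esqrt_le: "x \<le> ennreal (r\<^sup>2) \<Longrightarrow> r \<ge> 0 \<Longrightarrow> esqrt x \<le> ennreal r"
proof -
  assume x: "x \<le> ennreal (r\<^sup>2)" and r: "r \<ge> 0"
  have fin: "x \<noteq> \<infinity>" using x by (auto simp: top_unique)
  have "enn2real x \<le> r\<^sup>2" using enn2real_mono[OF x] by simp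
  then have "sqrt (enn2real x) \<le> r" using r by (simp add: real_le_lsqrt)
  then show ?thesis using fin by (simp add: esqrt_def ennreal_leI)
qed

text \<open>The two moment conditions of the class, read as Lebesgue integrals of \<open>1 -
  G\<close> over \<open>[0, \<infinity>)\<close>.\<close>

lemma service_class_tail:
  assumes "G \<in> service_class M" and M: "M > 0"
  defines "H \<equiv> \<lambda>y. if y < 0 then 0 else 1 - G y"
  shows "H \<in> borel_measurable borel" "\<And>y. H y \<ge> 0" "integrable lborel H" "(LINT y|lborel. H y) \<le> M"
    and "integrable lborel (\<lambda>y. y * H y)" "(LINT y|lborel. y * H y) \<le> M / 2"
    and "mean_service G = (LINT y|lborel. H y)"
proof -
  obtain \<nu> where \<nu>: "real_distribution \<nu>" "G = cdf \<nu>" using assms(1) by (auto simp: service_class_def)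
  interpret \<nu>: real_distribution \<nu> by (rule \<nu>(1))
  have G1: "G y \<le> 1" for y using \<nu>.cdf_bounded_prob by (simp add: \<nu>(2))
  have "mono G" using \<nu>.cdf_nondecreasing by (auto simp: mono_def \<nu>(2))
  then have [measurable]: "G \<in> borel_measurable borel" by (rule borel_measurable_mono)
  show H [measurable]: "H \<in> borel_measurable borel" unfolding H_def by measurable
  show H0: "H y \<ge> 0" for y using G1[of y] by (simp add: H_def)
  let ?I = "\<lambda>k. \<integral>\<^sup>+ t\<in>{0..}. ennreal (real k * t ^ (k - 1) * (1 - G t)) \<partial>lborel"
  have "(MAX k\<in>{1, 2::nat}. ?I k) \<le> ennreal M" using assms(1) by (simp add: service_class_def)
  then have "?I 1 \<le> ennreal M" "?I 2 \<le> ennreal M" by simp_all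
  moreover have "?I 1 = (\<integral>\<^sup>+y. ennreal (H y) \<partial>lborel)"
    by (intro nn_integral_cong) (auto simp: H_def indicator_def)
  moreover have "?I 2 = (\<integral>\<^sup>+y. ennreal (2 * (y * H y)) \<partial>lborel)"
    by (intro nn_integral_cong) (auto simp: H_def indicator_def mult.assoc)
  ultimately have 1: "(\<integral>\<^sup>+y. ennreal (H y) \<partial>lborel) \<le> ennreal M"
    and 2: "(\<integral>\<^sup>+y. ennreal (2 * (y * H y)) \<partial>lborel) \<le> ennreal M" by simp_all
  have yH0: "0 \<le> y * H y" for y using H0[of y] by (cases "y < 0") (simp_all add: H_def)
  have le_M: "integrable lborel f \<and> (LINT y|lborel. f y) \<le> M"
    if "f \<in> borel_measurable borel" "\<And>y. f y \<ge> 0" "(\<integral>\<^sup>+y. ennreal (f y) \<partial>lborel) \<le> ennreal M" for f :: "real \<Rightarrow> real"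
  proof
    show "integrable lborel f"
      using that by (intro integrableI_nonneg) (auto intro: le_less_trans)
    have "(LINT y|lborel. f y) = enn2real (\<integral>\<^sup>+y. ennreal (f y) \<partial>lborel)"
      using that by (intro integral_eq_nn_integral) auto
    also have "\<dots> \<le> M" using that(3) M by (intro enn2real_leI) auto
    finally show "(LINT y|lborel. f y) \<le> M" .
  qed
  show "integrable lborel H" "(LINT y|lborel. H y) \<le> M" using le_M[OF H H0 1] by auto
  have "integrable lborel (\<lambda>y. 2 * (y * H y)) \<and> (LINT y|lborel. 2 * (y * H y)) \<le> M"
    by (rule le_M) (use 2 yH0 in auto)
  then show "integrable lborel (\<lambda>y. y * H y)" "(LINT y|lborel. y * H y) \<le> M / 2" by auto
  show "mean_service G = (LINT y|lborel. H y)"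
    unfolding mean_service_def set_lebesgue_integral_def
    by (intro Bochner_Integration.integral_cong) (auto simp: H_def indicator_def)
qed

lemma risk_le:
  fixes P :: "(real \<Rightarrow> real) \<Rightarrow> realization measure"
  assumes lam: "arrival_intensity lam \<sigma> lam0 k0 \<gamma>"
    and lam_int: "\<And>R. set_integrable lborel {0..R} lam"
    and P: "\<And>G. G \<in> service_class M \<Longrightarrow> MtG_infinity (P G) lam arrival service G"
    and M: "M > 0" and n: "n > 0" and b: "b \<ge> 1/4" and s: "s < - \<sigma>" and \<delta>: "\<delta> > 0" and K: "K \<ge> 0"
    and J_le: "\<And>t. cmod (deconv_kernel lam s b t) \<le> K * exp (- ((\<sigma> + \<delta>) * t))"
    and r: "2 * (M / (2 * b) + K * lam0 * M * exp (- (\<delta> * T)) / \<delta>)\<^sup>2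
       + 2 * (lam0 * M / real n * (K * (2 / \<sigma>))\<^sup>2) \<le> r\<^sup>2" "r \<ge> 0"
  shows "risk (\<lambda>G. PiM {..<n} (\<lambda>_. P G)) (estimator (deconv_kernel lam s b) n T) mean_service (service_class M) \<le> ennreal r"
  unfolding risk_def
proof (rule SUP_least, rule esqrt_le[OF _ r(2)])
  fix G assume G: "G \<in> service_class M"
  interpret arrival_intensity lam \<sigma> lam0 k0 \<gamma> by (rule lam)
  interpret MtG_infinity "P G" lam arrival service G by (rule P[OF G])
  interpret queue "P G" lam arrival service G
    by unfold_locales (auto simp: lam_nonneg lam_neg intro: lam_int)
  have H: "tail \<in> borel_measurable borel" "integrable lborel tail" "(LINT y|lborel. tail y) \<le> M"
    "integrable lborel (\<lambda>y. y * tail y)" "(LINT y|lborel. y * tail y) \<le> M / 2"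
    "mean_service G = (LINT y|lborel. tail y)"
    using service_class_tail[OF G M] by (simp_all only: tail_def[abs_def])
  interpret queue_mean lam \<sigma> lam0 k0 \<gamma> tail M
    by unfold_locales (rule H tail_nonneg | simp add: tail_def)+
  have mean_eq: "mean_length t = mean_queue t" for t by (simp add: mean_length_def mean_queue_def)
  let ?J = "deconv_kernel lam s b"
  have "(\<integral>\<^sup>+ \<omega>. ennreal ((cmod (1 / of_nat n * (\<Sum>k<n. LINT t:{0..T}|lborel. ?J t * of_nat (queue_at t (\<omega> k))) - of_real (mean_service G)))\<^sup>2) \<partial>PiM {..<n} (\<lambda>_. P G))
     \<le> ennreal (2 * (M / (2 * b) + K * lam0 * M * exp (- (\<delta> * T)) / \<delta>)\<^sup>2 + 2 * (lam0 * M / real n * (K * (2 / \<sigma>))\<^sup>2))"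
  proof (rule estimator_mean_square_error)
    show "?J \<in> borel_measurable borel" by (rule deconv_kernel_measurable[OF b s])
    show "cmod (?J t) \<le> K * exp (- (\<sigma> * t))" if "t \<ge> 0" for t
      using K \<delta> that by (intro order_trans[OF J_le] mult_left_mono) (auto simp: distrib_right)
    show "integrable lborel (\<lambda>x. lam x * tail (t - x))" for t by (rule mean_queue_integrable)
    show "mean_length t \<le> lam0 * M * exp (\<sigma> * t)" for t unfolding mean_eq by (rule mean_queue_le)
    show "cmod ((LINT t:{0..T}|lborel. ?J t * of_real (mean_length t)) - of_real (mean_service G))
        \<le> M / (2 * b) + K * lam0 * M * exp (- (\<delta> * T)) / \<delta>"
      unfolding mean_eq H(6) by (rule bias_bound[OF b s \<delta> K J_le])
  qed (use n \<sigma>_pos K lam0_pos M in auto)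
  also have "\<dots> \<le> ennreal (r\<^sup>2)" by (rule ennreal_leI[OF r(1)])
  finally show "(\<integral>\<^sup>+ \<omega>. ennreal ((cmod (estimator ?J n T \<omega> - of_real (mean_service G)))\<^sup>2) \<partial>PiM {..<n} (\<lambda>_. P G)) \<le> ennreal (r\<^sup>2)"
    by (simp add: estimator_def)
qed

theorem theorem3:
  fixes \<gamma> k0 :: real
  assumes "\<gamma> \<ge> 0" and "k0 > 0"
  shows "\<exists>C1>0. \<forall>(lam :: real \<Rightarrow> real) (\<sigma> :: real) (lam0 :: real) (M :: real) (s :: real)
      (T :: nat \<Rightarrow> real) (P :: (real \<Rightarrow> real) \<Rightarrow> realization measure).
    (\<forall>t\<ge>0. lam t \<ge> 0) \<longrightarrow>
    (\<forall>t<0. lam t = 0) \<longrightarrow>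
    (\<forall>R\<ge>0. set_integrable lborel {0..R} lam) \<longrightarrow>
    abscissa_of_convergence lam = ereal \<sigma> \<longrightarrow>
    \<sigma> > 0 \<longrightarrow>
    lam0 > 0 \<longrightarrow>
    (\<forall>t\<ge>0. lam t \<le> lam0 * exp (\<sigma> * t)) \<longrightarrow>
    (\<forall>z. Re z > \<sigma> \<longrightarrow> laplace lam z \<noteq> 0) \<longrightarrow>
    (\<forall>x w. x > \<sigma> \<longrightarrow>
       cmod (laplace lam (Complex x w)) \<ge> lam0 * k0 / ((x - \<sigma>)\<^sup>2 + w\<^sup>2) powr (\<gamma> / 2)) \<longrightarrow>
    M > 0 \<longrightarrow>
    s < - \<sigma> \<longrightarrow>
    (\<forall>G\<in>service_class M. MtG_infinity (P G) lam arrival service G) \<longrightarrow>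
    filterlim T at_top sequentially \<longrightarrow>
    (\<lambda>n. 1 / T n * (ln (lam0 * real n))\<^sup>2) \<longlonglongrightarrow> 0 \<longrightarrow>
    limsup (\<lambda>n. risk (\<lambda>G. PiM {..<n} (\<lambda>_. P G))
        (estimator (deconv_kernel lam s (b_star \<sigma> \<gamma> M lam0 n)) n (T n)) mean_service (service_class M)
      / ennreal (rate_phi \<sigma> \<gamma> M lam0 n)) \<le> ennreal C1"
proof (intro exI[of _ 2] conjI allI impI)
  fix lam :: "real \<Rightarrow> real" and \<sigma> lam0 M s :: real and T :: "nat \<Rightarrow> real"
    and P :: "(real \<Rightarrow> real) \<Rightarrow> realization measure"
  assume lam_nonneg: "\<forall>t\<ge>0. lam t \<ge> 0" and lam_neg: "\<forall>t<0. lam t = 0"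
    and lam_int: "\<forall>R\<ge>0. set_integrable lborel {0..R} lam"
    and pos: "\<sigma> > 0" "lam0 > 0" "M > 0"
    and lam_le: "\<forall>t\<ge>0. lam t \<le> lam0 * exp (\<sigma> * t)"
    and lower: "\<forall>x w. x > \<sigma> \<longrightarrow>
       cmod (laplace lam (Complex x w)) \<ge> lam0 * k0 / ((x - \<sigma>)\<^sup>2 + w\<^sup>2) powr (\<gamma> / 2)"
    and s: "s < - \<sigma>" and P: "\<forall>G\<in>service_class M. MtG_infinity (P G) lam arrival service G"
    and T: "filterlim T at_top sequentially" "(\<lambda>n. 1 / T n * (ln (lam0 * real n))\<^sup>2) \<longlonglongrightarrow> 0"
  have lam_int': "set_integrable lborel {0..R} lam" for R
    using lam_int by (cases "R \<ge> 0") (auto simp: set_integrable_def)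
  have "lam \<in> borel_measurable borel"
  proof (rule borel_measurable_LIMSEQ_real)
    show "(\<lambda>t. indicator {0..real n} t *\<^sub>R lam t) \<in> borel_measurable borel" for n
      using lam_int'[of "real n"] unfolding set_integrable_def by (simp add: borel_measurable_integrable)
    fix t :: real
    have "eventually (\<lambda>n. indicat_real {0..real n} t *\<^sub>R lam t = lam t) sequentially"
      using eventually_ge_at_top[of "nat \<lceil>t\<rceil>"]
    proof eventually_elim
      case (elim n)
      then have "t \<le> real n" by linarith
      then show ?case using lam_neg by (cases "t < 0") (auto simp: indicator_def)
    qed
    then show "(\<lambda>n. indicat_real {0..real n} t *\<^sub>R lam t) \<longlonglongrightarrow> lam t" by (rule tendsto_eventually)
  qed
  then have lam: "arrival_intensity lam \<sigma> lam0 k0 \<gamma>"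
    using assms pos lam_le lower lam_nonneg lam_neg
    by unfold_locales (auto simp: not_less intro: leI, metis linorder_not_less order_refl)
  obtain D where D: "D > 0" "\<And>b \<delta> t. b \<ge> 1/4 \<Longrightarrow> \<delta> > 0 \<Longrightarrow>
      cmod (deconv_kernel lam s b t) \<le> D * exp ((\<sigma> + \<delta>) * (b + 1/4)) * exp (- ((\<sigma> + \<delta>) * t))"
    using arrival_intensity.deconv_kernel_bound[OF lam] s by blast
  let ?risk = "\<lambda>n. risk (\<lambda>G. PiM {..<n} (\<lambda>_. P G))
        (estimator (deconv_kernel lam s (b_star \<sigma> \<gamma> M lam0 n)) n (T n)) mean_service (service_class M)"
  have "\<forall>\<^sub>F n in sequentially. ?risk n / ennreal (rate_phi \<sigma> \<gamma> M lam0 n) \<le> ennreal 2"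
    using risk_bound_asymptotics[OF pos(1,3,2) D(1) T, of \<gamma>]
  proof eventually_elim
    case (elim n)
    let ?b = "b_star \<sigma> \<gamma> M lam0 n" and ?L = "ln (\<sigma> powr (- 2 * \<gamma> + 1) * M * lam0 * real n)"
      and ?\<phi> = "rate_phi \<sigma> \<gamma> M lam0 n"
    have \<phi>: "?\<phi> > 0" using elim by simp
    have "?risk n \<le> ennreal (2 * ?\<phi>)"
      by (rule risk_le[OF lam lam_int', where \<delta> = "1 / ?L" and K = "D * exp ((\<sigma> + 1 / ?L) * (?b + 1/4))"])
         (use elim P pos s D in auto)
    then have "?risk n / ennreal ?\<phi> \<le> ennreal (2 * ?\<phi>) / ennreal ?\<phi>"
      by (rule divide_right_mono_ennreal)
    also have "\<dots> = ennreal 2" using \<phi> by (subst divide_ennreal) auto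
    finally show ?case .
  qed
  then show "limsup (\<lambda>n. ?risk n / ennreal (rate_phi \<sigma> \<gamma> M lam0 n)) \<le> ennreal 2"
    by (rule Limsup_bounded)
qed simp

end
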